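(* Let $\{(M_n,Q_n):n\ge 1\}$ be i.i.d. $\mathbb{R}^2$-valued random vectors with generic copy $(M,Q)$ such that $\mathbb{P}\{M=0\}=0$ and $\mathbb{P}\{Q=0\}<1$. Let $b:[0,\infty)\to[0,\infty)$ be measurable, locally bounded and regularly varying at $\infty$ with exponent $\alpha>0$. Let $\Pi_n$, $Z_\infty$ and $J$ be as defined in the context. (i) If $\lim_{n\to\infty}\Pi_n=0$ a.s., $$\mathbb{E}\, b(\log^+|M|)\,J(\log^+|M|)<\infty \qquad\text{and}\qquad \mathbb{E}\, b(\log^+|Q|)\,J(\log^+|Q|)<\infty,$$ then $$\mathbb{E}\, b(\log^+|Z_\infty|)<\infty .$$ (ii) Conversely, if $Z_\infty$ is a.s. finite and nondegenerate (not a.s. equal to a constant) and $\mathbb{E}\, b(\log^+|Z_\infty|)<\infty$, then $$\mathbb{E}\, b(\log^+|M|)\,J(\log^+|M|)<\infty \qquad\text{and}\qquad \mathbb{E}\, b(\log^+|Q|)\,J(\log^+|Q|)<\infty.$$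
   Context: Notation: $\Pi_0=1$, $\Pi_n=M_1M_2\cdots M_n$, $Z_n=\sum_{k=1}^n\Pi_{k-1}Q_k$, and $Z_\infty=\sum_{k\ge1}\Pi_{k-1}Q_k$ denotes the a.s. limit of $Z_n$ (any assertion about $Z_\infty$ includes that this limit exists a.s.). $\log^+x=\max(\log x,0)$ and $\log^-x=\max(-\log x,0)$, with $\log^+0=0$. For $x>0$, $$A(x)=\int_0^x\mathbb{P}\{-\log|M|>y\}\,dy=\mathbb{E}\min(\log^-|M|,x),\qquad J(x)=\frac{x}{A(x)},$$ and $J(0)=\lim_{x\downarrow0}J(x)=1/\mathbb{P}\{|M|<1\}$ (if $\mathbb{P}\{|M|<1\}=0$, $J$ is read as $+\infty$). *)

theory Defs
  imports "HOL-Probability.Probability"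
begin

definition log_plus :: "real \<Rightarrow> real" where
  "log_plus x = max (ln x) 0"  \<comment> \<open>includes \<open>log_plus 0 = 0\<close>, since \<open>ln 0 = 0\<close> in HOL\<close>

definition regularly_varying :: "(real \<Rightarrow> real) \<Rightarrow> real \<Rightarrow> bool" where
  "regularly_varying b \<alpha> \<longleftrightarrow>
     (\<forall>c>0. ((\<lambda>x. b (c * x) / b x) \<longlongrightarrow> c powr \<alpha>) at_top)"

definition locally_bounded_nonneg :: "(real \<Rightarrow> real) \<Rightarrow> bool" where
  "locally_bounded_nonneg b \<longleftrightarrow> (\<forall>x\<ge>0. bounded (b ` {0..x}))"

text \<open>The sequences below are indexed from 1; the value at index 0 is never used.\<close>

definition Pi_prod :: "(nat \<Rightarrow> 'a \<Rightarrow> real) \<Rightarrow> nat \<Rightarrow> 'a \<Rightarrow> real" where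
  "Pi_prod M n \<omega> = (\<Prod>k=1..n. M k \<omega>)"

definition Z_sum :: "(nat \<Rightarrow> 'a \<Rightarrow> real) \<Rightarrow> (nat \<Rightarrow> 'a \<Rightarrow> real) \<Rightarrow> nat \<Rightarrow> 'a \<Rightarrow> real" where
  "Z_sum M Q n \<omega> = (\<Sum>k=1..n. Pi_prod M (k - 1) \<omega> * Q k \<omega>)"

text \<open>\<open>Z_inf\<close> is only meaningful where the partial sums converge, so every use has to be
  accompanied by almost sure convergence, \<open>Z_converges\<close>.\<close>

definition Z_converges :: "'a measure \<Rightarrow> (nat \<Rightarrow> 'a \<Rightarrow> real) \<Rightarrow> (nat \<Rightarrow> 'a \<Rightarrow> real) \<Rightarrow> bool" where
  "Z_converges P M Q \<longleftrightarrow> (AE \<omega> in P. convergent (\<lambda>n. Z_sum M Q n \<omega>))"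

definition Z_inf :: "(nat \<Rightarrow> 'a \<Rightarrow> real) \<Rightarrow> (nat \<Rightarrow> 'a \<Rightarrow> real) \<Rightarrow> 'a \<Rightarrow> real" where
  "Z_inf M Q \<omega> = lim (\<lambda>n. Z_sum M Q n \<omega>)"

text \<open>\<open>X\<close> is assumed to be almost surely nonzero wherever \<open>A_fun\<close> and \<open>J_fun\<close> are used, so that
  HOL's convention \<open>ln 0 = 0\<close> only affects a null set.\<close>

definition A_fun :: "'a measure \<Rightarrow> ('a \<Rightarrow> real) \<Rightarrow> real \<Rightarrow> ennreal" where
  "A_fun P X x =
     (\<integral>\<^sup>+y\<in>{0..x}. emeasure P {\<omega> \<in> space P. - ln \<bar>X \<omega>\<bar> > y} \<partial>lborel)"

text \<open>\<open>J_fun\<close> is used for \<open>x \<ge> 0\<close> only. The value at 0 is the right limit of \<open>x / A_fun P X x\<close>.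
  If \<open>\<bar>X\<bar> < 1\<close> has probability 0, both branches are \<open>c / 0 = \<infinity>\<close> with \<open>c > 0\<close>.\<close>

definition J_fun :: "'a measure \<Rightarrow> ('a \<Rightarrow> real) \<Rightarrow> real \<Rightarrow> ennreal" where
  "J_fun P X x =
     (if x = 0 then 1 / emeasure P {\<omega> \<in> space P. \<bar>X \<omega>\<bar> < 1}
      else ennreal x / A_fun P X x)"

end

theory Submission
  imports Defs
begin

text \<open>With \<open>b\<close> replaced by a comparable continuous function \<open>g\<close>, the function
  \<open>B y = \<integral>\<^sub>0\<^sup>y g / A\<close> is of the order of \<open>b y * J y\<close> and serves as a Lyapunov function in the variable
  \<open>y = ln (1 + \<bar>z\<bar>)\<close> for the recursion \<open>z \<mapsto> Q + M z\<close>. The downward jumps of \<open>B\<close> caused by small \<open>\<bar>M\<bar>\<close>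
  have mean of the order of \<open>g y\<close>, because \<open>A y\<close> is the mean of \<open>- ln \<bar>M\<bar>\<close> truncated at \<open>y\<close>.

  For (i), the upward jumps are negligible by dominated convergence if \<open>A\<close> is unbounded, and outweighed
  because \<open>ln \<bar>M\<bar>\<close> has negative mean otherwise. So \<open>B\<close> decreases by \<open>c * g y\<close> on average, up to a constant.
  The partial sums of \<open>\<Sum> \<bar>\<Pi>\<^sub>n\<^sub>-\<^sub>1 Q\<^sub>n\<bar>\<close> increase and each has the law of the image of the previous one
  under the recursion, so this bounds the \<open>g\<close>-moments of all of them at once.

  For (ii), the law of \<open>Z\<close> is invariant, so the mean upward and downward jumps of \<open>B\<close>, truncated at a level \<open>T\<close>,
  coincide. The downward jumps are controlled by the \<open>g\<close>-moment of \<open>Z\<close>, except for cancellation of \<open>Q\<close>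
  against \<open>M z\<close> with large \<open>z\<close>, which costs a small multiple of the truncated mean of \<open>B (ln (1 + \<bar>Q\<bar>))\<close>.
  The upward jumps from two different points of the support of \<open>Z\<close> control that mean and its analogue for \<open>M\<close>,
  and the small multiple is absorbed.\<close>

section \<open>Regularly varying functions\<close>

text \<open>The density \<open>g / A\<close> comes from one computation: from a large height
  \<open>y\<close>, a descent by \<open>s \<le> e * y\<close> changes \<open>B\<close> by about
  \<open>s * g y / A y\<close>, and the mean of \<open>min (neg_log m) (e * y)\<close> is
  \<open>A (e * y)\<close>, at least \<open>e * A y\<close>. Three points shape the details.
  \<open>A\<close> need not vary regularly; what is used of its shape is that it is nondecreasing
  while \<open>A x / x\<close> is nonincreasing. If \<open>A\<close> is bounded, upward and downward
  jumps have means of the same order, so the constants must be nearly sharp, and for this the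
  estimates keep a factor \<open>(1 - e) ^ k\<close> with \<open>e\<close> at free choice. In (ii),
  only the mean of \<open>g\<close> is known to be finite under the law of Z, and that of
  \<open>B\<close>, which can grow faster, may be infinite; invariance can therefore be exploited
  only after truncation. The case that \<open>\<bar>M\<bar> \<ge> 1\<close> almost surely, in which
  \<open>A\<close> vanishes and J is infinite, is split off at the end: neither set of premises is
  then possible.\<close>

lemma increment_bound_large_measure:
  fixes h :: "real \<Rightarrow> real"
  assumes [measurable]: "h \<in> borel_measurable borel"
    and lim: "\<And>u. ((\<lambda>x. h (x + u) - h x) \<longlongrightarrow> \<alpha> * u) at_top"
    and "\<alpha> \<ge> 0" and y: "filterlim y at_top sequentially"
  shows "\<forall>\<^sub>F n in sequentially.
    measure lborel {v\<in>{0..2}. \<forall>m\<ge>n. \<bar>h (y m + v) - h (y m)\<bar> \<le> 2 * \<alpha> + 1} > 3 / 2"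
proof -
  define V where "V n = {v\<in>{0..2}. \<forall>m\<ge>n. \<bar>h (y m + v) - h (y m)\<bar> \<le> 2 * \<alpha> + 1}" for n :: nat
  have meas: "V n \<in> sets lborel" for n
    unfolding V_def by measurable
  have "incseq V"
    by (auto simp: incseq_def V_def)
  have union: "(\<Union>n. V n) = {0..2}"
  proof (intro set_eqI iffI)
    fix v :: real assume v: "v \<in> {0..2}"
    have "(\<lambda>m. h (y m + v) - h (y m)) \<longlonglongrightarrow> \<alpha> * v"
      using filterlim_compose[OF lim y] .
    then have "\<forall>\<^sub>F m in sequentially. dist (h (y m + v) - h (y m)) (\<alpha> * v) < 1"
      by (rule tendstoD) simp
    then obtain n where n: "\<And>m. m \<ge> n \<Longrightarrow> \<bar>h (y m + v) - h (y m) - \<alpha> * v\<bar> < 1"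
      by (auto simp: eventually_sequentially dist_real_def)
    have "0 \<le> \<alpha> * v" "\<alpha> * v \<le> 2 * \<alpha>"
      using v \<open>\<alpha> \<ge> 0\<close> mult_left_mono[of v 2 \<alpha>] by auto
    then have "v \<in> V n"
      using n v by (fastforce simp: V_def)
    then show "v \<in> (\<Union>n. V n)" by blast
  qed (auto simp: V_def)
  \<comment> \<open>By pointwise convergence the sets \<open>V n\<close> exhaust
    \<open>{0..2}\<close>; the tolerance 1 is added to the largest limit
    \<open>2 * \<alpha>\<close>. The level 3/2 is half the length of the interval
    \<open>{0..3}\<close> in which two such sets are made to meet.\<close>
  have "(\<lambda>n. measure lborel (V n)) \<longlonglongrightarrow> measure lborel (\<Union>n. V n)"
    by (rule Lim_measure_incseq) (use meas \<open>incseq V\<close> union in auto)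
  then have "(\<lambda>n. measure lborel (V n)) \<longlonglongrightarrow> 2"
    unfolding union by simp
  from order_tendstoD(1)[OF this, of "3/2"] show ?thesis
    by (simp add: V_def)
qed

text \<open>A Steinhaus argument: two subsets of an interval of length 3, each of measure above 3/2,
  must meet.\<close>
lemma increments_locally_bounded:
  fixes h :: "real \<Rightarrow> real"
  assumes h[measurable]: "h \<in> borel_measurable borel"
    and lim: "\<And>u. ((\<lambda>x. h (x + u) - h x) \<longlongrightarrow> \<alpha> * u) at_top"
    and \<alpha>: "\<alpha> \<ge> 0"
  shows "\<exists>K x0. \<forall>x\<ge>x0. \<forall>u\<in>{0..1}. \<bar>h (x + u) - h x\<bar> \<le> K"
proof (rule ccontr)
  assume "\<not> ?thesis"
  then have "\<exists>x u. x \<ge> real n \<and> u \<in> {0..1} \<and> \<bar>h (x + u) - h x\<bar> > real n" for n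
    by (meson not_le)
  then obtain x u where x: "\<And>n. x n \<ge> real n" and u: "\<And>n. u n \<in> {0..1}"
    and big: "\<And>n. \<bar>h (x n + u n) - h (x n)\<bar> > real n"
    by metis
  have limx: "filterlim x at_top sequentially"
    by (rule filterlim_at_top_mono[OF filterlim_real_sequentially]) (simp add: x)
  have limxu: "filterlim (\<lambda>n. x n + u n) at_top sequentially"
    by (rule filterlim_at_top_mono[OF limx]) (use u in auto)
  define V where "V n = {v\<in>{0..2}. \<forall>m\<ge>n. \<bar>h (x m + v) - h (x m)\<bar> \<le> 2 * \<alpha> + 1}" for n :: nat
  define W where "W n = {v\<in>{0..2}. \<forall>m\<ge>n. \<bar>h ((x m + u m) + v) - h (x m + u m)\<bar> \<le> 2 * \<alpha> + 1}"
    for n :: nat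
  have "\<forall>\<^sub>F n in sequentially. measure lborel (V n) > 3 / 2"
    unfolding V_def by (rule increment_bound_large_measure[OF h lim \<alpha> limx])
  moreover have "\<forall>\<^sub>F n in sequentially. measure lborel (W n) > 3 / 2"
    unfolding W_def by (rule increment_bound_large_measure[OF h lim \<alpha> limxu])
  moreover have "\<forall>\<^sub>F n in sequentially. real n \<ge> 2 * (2 * \<alpha> + 1)"
    using filterlim_real_sequentially by (simp add: filterlim_at_top)
  ultimately have "\<forall>\<^sub>F n in sequentially. measure lborel (V n) > 3 / 2 \<and> measure lborel (W n) > 3 / 2
      \<and> real n \<ge> 2 * (2 * \<alpha> + 1)"
    by eventually_elim simp
  then obtain n where n: "measure lborel (V n) > 3 / 2" "measure lborel (W n) > 3 / 2"
      "real n \<ge> 2 * (2 * \<alpha> + 1)"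
    using eventually_happens'[OF sequentially_bot] by blast
  define W' where "W' = (\<lambda>v. v - u n) -` W n"
  have V_sets: "V n \<in> sets lborel" and W_sets: "W n \<in> sets borel"
    unfolding V_def W_def by measurable
  then have W'_sets: "W' \<in> sets borel"
    unfolding W'_def by (intro measurable_sets_borel[OF _ W_sets]) measurable
  have "W' = (+) (u n) ` W n"
  proof -
    have "z \<in> (+) (u n) ` W n" if "z - u n \<in> W n" for z
      using that by (intro image_eqI[of _ _ "z - u n"]) auto
    then show ?thesis by (auto simp: W'_def)
  qed
  then have W'_measure: "measure lborel W' = measure lborel (W n)"
    using measure_translation[of "u n" "W n"] W_sets W'_sets
    by (simp add: measure_completion)
  have V_sub: "V n \<subseteq> {0..3}" by (auto simp: V_def)
  have W'_sub: "W' \<subseteq> {0..3}" using u[of n] by (auto simp: W'_def W_def)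
  have fin: "S \<in> sets borel \<Longrightarrow> S \<subseteq> {0..3} \<Longrightarrow> S \<in> fmeasurable lborel" for S :: "real set"
    by (rule fmeasurableI2[of "{0..3}"]) (auto simp: fmeasurable_def)
  have "V n \<inter> W' \<noteq> {}"
  proof
    assume "V n \<inter> W' = {}"
    then have "measure lborel (V n \<union> W') = measure lborel (V n) + measure lborel W'"
      using fin[of "V n"] fin[of W'] V_sets W'_sets V_sub W'_sub
      by (intro measure_Un3[THEN trans]) auto
    moreover have "measure lborel (V n \<union> W') \<le> measure lborel {0..3::real}"
      using V_sub W'_sub V_sets W'_sets
      by (intro measure_mono_fmeasurable) (auto simp: fmeasurable_def)
    ultimately show False using n W'_measure by simp
  qed
  \<comment> \<open>Seen from \<open>x n\<close> and from \<open>x n + u n\<close>, the common point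
    \<open>x n + v\<close> has an increment of at most \<open>2 * \<alpha> + 1\<close>. So these two
    differ by at most twice that, against the choice of \<open>n\<close>.\<close>
  then obtain v where v: "v \<in> V n" "v - u n \<in> W n"
    by (auto simp: W'_def)
  then have "\<bar>h (x n + v) - h (x n)\<bar> \<le> 2 * \<alpha> + 1"
    "\<bar>h (x n + u n + (v - u n)) - h (x n + u n)\<bar> \<le> 2 * \<alpha> + 1"
    unfolding V_def W_def by blast+
  then have "\<bar>h (x n + u n) - h (x n)\<bar> \<le> 2 * (2 * \<alpha> + 1)"
    by (simp add: algebra_simps abs_if split: if_splits)
  then show False using big[of n] n(3) by linarith
qed

text \<open>At a zero of \<open>b\<close> the quotient \<open>b x / b x\<close> is 0 by the
  convention for division by zero, whereas regular variation with factor 1 makes it tend to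
  1.\<close>

lemma regularly_varying_eventually_pos:
  assumes "regularly_varying b \<alpha>" and "\<And>x. x \<ge> 0 \<Longrightarrow> b x \<ge> 0"
  shows "\<forall>\<^sub>F x in at_top. b x > 0"
proof -
  have "((\<lambda>x. b x / b x) \<longlongrightarrow> 1) at_top"
    using assms(1) by (auto simp: regularly_varying_def dest!: spec[of _ 1])
  from order_tendstoD(1)[OF this, of "1/2"]
  have "\<forall>\<^sub>F x in at_top. b x / b x > 1 / 2" by simp
  with eventually_ge_at_top[of 0] show ?thesis
    by eventually_elim (use assms(2) in \<open>force simp: less_le\<close>)
qed

text \<open>In the logarithmic coordinates \<open>h x = ln (b (exp x))\<close> regular variation
  says that the increments of \<open>h\<close> converge, and a factor \<open>l\<close> in
  \<open>{1..2}\<close> becomes a shift by \<open>ln l\<close>, which is at most 1.\<close>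

lemma regularly_varying_ratio_bounds:
  assumes b_nonneg: "\<And>x. x \<ge> 0 \<Longrightarrow> b x \<ge> 0"
    and b_meas: "b \<in> borel_measurable (restrict_space borel {0..})"
    and b_rv: "regularly_varying b \<alpha>" and \<alpha>: "\<alpha> \<ge> 0"
  shows "\<exists>K\<ge>1. \<forall>\<^sub>F x in at_top. b x > 0 \<and> (\<forall>l\<in>{1..2}. b (l * x) \<le> K * b x \<and> b x \<le> K * b (l * x))"
proof -
  define h where "h x = ln (b (exp x))" for x
  have "(\<lambda>x. b (exp x)) \<in> borel_measurable borel"
    by (rule measurable_compose[OF _ b_meas], rule measurable_restrict_space2) auto
  then have h: "h \<in> borel_measurable borel"
    unfolding h_def by measurable
  obtain x1 where x1: "\<And>x. x \<ge> x1 \<Longrightarrow> b x > 0" "x1 \<ge> 1"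
    using regularly_varying_eventually_pos[OF b_rv b_nonneg] unfolding eventually_at_top_linorder
    by (metis max.bounded_iff max.cobounded1 order_refl)
  have "((\<lambda>x. h (x + u) - h x) \<longlongrightarrow> \<alpha> * u) at_top" for u
  proof -
    have "((\<lambda>x. b (exp u * x) / b x) \<longlongrightarrow> exp u powr \<alpha>) at_top"
      using b_rv by (simp add: regularly_varying_def)
    then have "((\<lambda>x. b (exp u * exp x) / b (exp x)) \<longlongrightarrow> exp (\<alpha> * u)) at_top"
      using filterlim_compose[OF _ exp_at_top] by (force simp: powr_def)
    then have "((\<lambda>x. ln (b (exp u * exp x) / b (exp x))) \<longlongrightarrow> \<alpha> * u) at_top"
      using tendsto_ln by fastforce
    moreover have "\<forall>\<^sub>F x in at_top. ln (b (exp u * exp x) / b (exp x)) = h (x + u) - h x"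
      using eventually_ge_at_top[of "ln x1"] eventually_ge_at_top[of "ln x1 - u"]
    proof eventually_elim
      case (elim x)
      have "exp x \<ge> x1" "exp (x + u) \<ge> x1"
        using elim x1(2) by (smt (verit) exp_le_cancel_iff exp_ln)+
      then show ?case
        using x1(1)[of "exp x"] x1(1)[of "exp (x + u)"] by (simp add: h_def ln_div exp_add mult.commute)
    qed
    ultimately show ?thesis by (rule Lim_transform_eventually)
  qed
  from increments_locally_bounded[OF h this \<alpha>] obtain K x0
    where K: "\<And>x u. x \<ge> x0 \<Longrightarrow> u \<in> {0..1} \<Longrightarrow> \<bar>h (x + u) - h x\<bar> \<le> K" by meson
  have "K \<ge> 0" using K[of x0 0] by simp
  have "\<forall>\<^sub>F x in at_top. b x > 0 \<and> (\<forall>l\<in>{1..2}. b (l * x) \<le> exp K * b x \<and> b x \<le> exp K * b (l * x))"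
    using eventually_ge_at_top[of x1] eventually_ge_at_top[of "exp x0"]
  proof eventually_elim
    case (elim x)
    have "b (l * x) \<le> exp K * b x \<and> b x \<le> exp K * b (l * x)" if l: "l \<in> {1..2}" for l
    proof -
      have "x > 0" using elim(1) x1(2) by simp
      then have "x \<le> l * x" using l by simp
      then have lx: "l * x \<ge> x1" "l * x > 0" using elim(1) \<open>x > 0\<close> by linarith+
      have "ln l \<le> 1"
        using ln_le_minus_one[of l] l by auto
      then have "\<bar>h (ln x + ln l) - h (ln x)\<bar> \<le> K"
        using elim l \<open>x > 0\<close> by (intro K) (auto simp: ln_ge_iff)
      moreover have "exp (ln x + ln l) = l * x" using l \<open>x > 0\<close> by (simp add: exp_add)
      ultimately have "\<bar>ln (b (l * x)) - ln (b x)\<bar> \<le> K"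
        using \<open>x > 0\<close> by (simp add: h_def)
      moreover have "b x > 0" "b (l * x) > 0" using x1(1) lx elim(1) by auto
      ultimately have "ln (b (l * x)) \<le> ln (exp K * b x)" "ln (b x) \<le> ln (exp K * b (l * x))"
        by (auto simp: ln_mult)
      then show ?thesis
        using \<open>b x > 0\<close> \<open>b (l * x) > 0\<close> by simp
    qed
    then show ?case using x1(1) elim(1) by blast
  qed
  then show ?thesis using \<open>K \<ge> 0\<close> by (intro exI[of _ "exp K"]) auto
qed

text \<open>A weak form of Potter's bounds, by induction on the number of doublings between
  \<open>y\<close> and \<open>t\<close>. In the first bound a doubling must cost nothing, and
  \<open>\<alpha> > 0\<close> provides \<open>b x \<le> b (2 * x)\<close> for this; in the second it
  costs \<open>K \<le> 2 ^ k\<close>, for which \<open>(t / y) ^ k\<close> pays.\<close>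

lemma regularly_varying_potter:
  assumes b_nonneg: "\<And>x. x \<ge> 0 \<Longrightarrow> b x \<ge> 0"
    and b_meas: "b \<in> borel_measurable (restrict_space borel {0..})"
    and b_rv: "regularly_varying b \<alpha>" and \<alpha>: "\<alpha> > 0"
  shows "\<exists>K\<ge>1. \<exists>k t0. t0 \<ge> 1 \<and> (\<forall>x\<ge>t0. b x > 0) \<and>
    (\<forall>y t. t0 \<le> y \<longrightarrow> y \<le> t \<longrightarrow> b y \<le> K * b t \<and> b t \<le> K * (t / y) ^ k * b y)"
proof -
  obtain K where K: "K \<ge> 1" "\<forall>\<^sub>F x in at_top. b x > 0 \<and>
      (\<forall>l\<in>{1..2}. b (l * x) \<le> K * b x \<and> b x \<le> K * b (l * x))"
    using regularly_varying_ratio_bounds[OF b_nonneg b_meas b_rv] \<alpha> by auto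
  have "((\<lambda>x. b (2 * x) / b x) \<longlongrightarrow> 2 powr \<alpha>) at_top"
    using b_rv by (simp add: regularly_varying_def)
  moreover have "2 powr \<alpha> > 1" using \<alpha> by simp
  ultimately have "\<forall>\<^sub>F x in at_top. b (2 * x) / b x > 1"
    by (rule order_tendstoD(1))
  with K(2) have "\<forall>\<^sub>F x in at_top. b x > 0 \<and> b x \<le> b (2 * x) \<and>
      (\<forall>l\<in>{1..2}. b (l * x) \<le> K * b x \<and> b x \<le> K * b (l * x))"
    by eventually_elim (auto simp: less_divide_eq)
  then obtain x1 where x1: "\<And>x. x \<ge> x1 \<Longrightarrow> b x > 0 \<and> b x \<le> b (2 * x) \<and>
      (\<forall>l\<in>{1..2}. b (l * x) \<le> K * b x \<and> b x \<le> K * b (l * x))"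
    by (auto simp: eventually_at_top_linorder)
  define t0 where "t0 = max 1 x1"
  have t0: "t0 \<ge> 1" "\<And>x. x \<ge> t0 \<Longrightarrow> b x > 0" "\<And>x. x \<ge> t0 \<Longrightarrow> b x \<le> b (2 * x)"
    "\<And>x l. x \<ge> t0 \<Longrightarrow> 1 \<le> l \<Longrightarrow> l \<le> 2 \<Longrightarrow> b (l * x) \<le> K * b x \<and> b x \<le> K * b (l * x)"
    using x1 by (auto simp: t0_def)
  obtain k where k: "K \<le> 2 ^ k"
    using real_arch_pow[of 2 K] by (auto intro: that[OF less_imp_le])
  have *: "b y \<le> K * b t \<and> b t \<le> K * (t / y) ^ k * b y"
    if "t0 \<le> y" "y \<le> t" "t \<le> 2 ^ n * y" for n y t
    using that
  proof (induction n arbitrary: t)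
    case 0
    then have "t = y" by simp
    then show ?case using 0 t0(1) t0(2)[of y] K(1) by auto
  next
    case (Suc n)
    have y: "y > 0" "b y > 0" using Suc.prems t0(1) t0(2)[of y] by auto
    show ?case
    proof (cases "t \<le> 2 * y")
      case True
      have "b (t / y * y) \<le> K * b y \<and> b y \<le> K * b (t / y * y)"
        using Suc.prems True y by (intro t0(4)) (auto simp: field_simps)
      moreover have "K * b y * 1 \<le> K * b y * (t / y) ^ k"
        using Suc.prems y K(1) by (intro mult_left_mono one_le_power) auto
      ultimately show ?thesis using y by (simp add: ac_simps)
    next
      case False
      with Suc.prems have IH: "b y \<le> K * b (t / 2)" "b (t / 2) \<le> K * (t / 2 / y) ^ k * b y"
        using Suc.IH[of "t / 2"] by auto
      have t2: "t / 2 \<ge> t0" using False Suc.prems by simp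
      have "b (t / 2) \<le> b t" "b t \<le> K * b (t / 2)"
        using t0(3)[OF t2] t0(4)[OF t2, of 2] by auto
      moreover have "K * b (t / 2) \<le> 2 ^ k * (K * (t / 2 / y) ^ k * b y)"
        using IH(2) k K(1) t0(2)[OF t2] by (intro mult_mono) auto
      moreover have "2 ^ k * (K * (t / 2 / y) ^ k * b y) = K * (t / y) ^ k * b y"
        by (simp add: power_divide)
      ultimately show ?thesis
        using IH(1) K(1) mult_left_mono[of "b (t / 2)" "b t" K] by linarith
    qed
  qed
  have "b y \<le> K * b t \<and> b t \<le> K * (t / y) ^ k * b y" if "t0 \<le> y" "y \<le> t" for y t
  proof -
    have "y > 0" using that t0(1) by simp
    obtain n where "t / y < 2 ^ n"
      using real_arch_pow[of 2 "t / y"] by auto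
    then show ?thesis
      using \<open>y > 0\<close> by (intro *[OF that, of n]) (simp add: field_simps)
  qed
  then show ?thesis
    using K(1) t0(1,2) by blast
qed

text \<open>The smallest majorant of \<open>b\<close> on \<open>{t0..}\<close> that is nondecreasing and grows at most like the
  \<open>k\<close>-th power of \<open>1 + y\<close> turns an arbitrary regularly varying \<open>b\<close> into a continuous comparison
  function.\<close>
lemma regularly_varying_comparison:
  assumes b_nonneg: "\<And>x. x \<ge> 0 \<Longrightarrow> b x \<ge> 0"
    and b_meas: "b \<in> borel_measurable (restrict_space borel {0..})"
    and b_bdd: "locally_bounded_nonneg b"
    and b_rv: "regularly_varying b \<alpha>" and \<alpha>: "\<alpha> > 0"
  obtains g k N y0 C t0 where
    "\<And>y. y \<ge> 0 \<Longrightarrow> g y > (0 :: real)"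
    "\<And>u v. 0 \<le> u \<Longrightarrow> u \<le> v \<Longrightarrow> g u \<le> g v"
    "\<And>u v. 0 \<le> u \<Longrightarrow> u \<le> v \<Longrightarrow> g v \<le> ((1 + v) / (1 + u)) ^ k * g u"
    "N > (1 :: real)" "\<And>y. y \<ge> y0 \<Longrightarrow> 2 * g (y / N) \<le> g y"
    "C > 0" "\<And>y. y \<ge> 0 \<Longrightarrow> b y \<le> C * g y" "\<And>y. y \<ge> t0 \<Longrightarrow> g y \<le> C * b y"
proof -
  obtain K k t0 where K: "K \<ge> 1" and t0: "t0 \<ge> 1" "\<And>x. x \<ge> t0 \<Longrightarrow> b x > 0"
    and b: "\<And>y t. t0 \<le> y \<Longrightarrow> y \<le> t \<Longrightarrow> b y \<le> K * b t"
      "\<And>y t. t0 \<le> y \<Longrightarrow> y \<le> t \<Longrightarrow> b t \<le> K * (t / y) ^ k * b y"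
    using regularly_varying_potter[OF _ b_meas b_rv \<alpha>] b_nonneg by blast
  \<comment> \<open>As a function of \<open>y\<close> the weight is nondecreasing and grows at most
    by the factor \<open>((1 + v) / (1 + u)) ^ k\<close> from \<open>u\<close> to \<open>v\<close>;
    the supremum over \<open>t\<close> inherits both properties.\<close>
  define \<phi> where "\<phi> y t = b t * (min 1 ((1 + y) / (1 + t))) ^ k" for y t
  define g where "g y = (SUP t\<in>{t0..}. \<phi> y t)" for y
  define C where "C = K * 2 ^ k"
  have "C > 0" "C \<ge> K" using K by (auto simp: C_def)
  have upper: "\<phi> y t \<le> C * b y" if "y \<ge> t0" "t \<ge> t0" for y t
  proof (cases "t \<le> y")
    case True
    have "\<phi> y t \<le> b t * 1"
      unfolding \<phi>_def using that t0 by (intro mult_left_mono power_le_one) (auto simp: less_imp_le)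
    also have "\<dots> \<le> K * b y" using b(1)[OF that(2) True] by simp
    also have "\<dots> \<le> C * b y" using \<open>C \<ge> K\<close> t0(2)[OF that(1)] by simp
    finally show ?thesis .
  next
    case False
    have "\<phi> y t = b t * ((1 + y) / (1 + t)) ^ k"
      using False t0 that by (simp add: \<phi>_def min_def)
    also have "\<dots> \<le> K * (t / y) ^ k * b y * ((1 + y) / (1 + t)) ^ k"
      using False t0 that b(2)[of y t] by (intro mult_right_mono) auto
    also have "\<dots> = K * b y * (t / y * ((1 + y) / (1 + t))) ^ k"
      by (simp only: power_mult_distrib ac_simps)
    also have "\<dots> \<le> K * b y * 2 ^ k"
    proof -
      have "t * (1 + y) \<le> (1 + t) * (2 * y)"
        using False t0 that by (intro mult_mono) auto
      then have "t / y * ((1 + y) / (1 + t)) \<le> 2"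
        using False t0 that by (simp add: field_simps)
      then show ?thesis
        using False t0(1) that K t0(2)[OF that(1)]
        by (intro mult_left_mono power_mono) (auto intro!: mult_nonneg_nonneg)
    qed
    finally show ?thesis by (simp add: C_def ac_simps)
  qed
  have mono\<phi>: "\<phi> u t \<le> \<phi> v t" if "0 \<le> u" "u \<le> v" "t \<ge> t0" for u v t
    unfolding \<phi>_def using that t0(1) t0(2)[of t]
    by (intro mult_left_mono power_mono min.mono divide_right_mono) auto
  have bdd: "bdd_above (\<phi> y ` {t0..})" if "y \<ge> 0" for y
  proof (rule bdd_aboveI2)
    fix t assume "t \<in> {t0..}"
    then show "\<phi> y t \<le> C * b (max y t0)"
      using mono\<phi>[of y "max y t0" t] upper[of "max y t0" t] that by auto
  qed
  have g_mono: "g u \<le> g v" if "0 \<le> u" "u \<le> v" for u v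
    unfolding g_def using that by (intro cSUP_mono) (auto intro!: bdd mono\<phi>)
  have \<phi>_le: "\<phi> y t \<le> g y" if "y \<ge> 0" "t \<ge> t0" for y t
    unfolding g_def using that by (intro cSUP_upper bdd) auto
  have g_pos: "g y > 0" if "y \<ge> 0" for y
  proof -
    have "0 < \<phi> y t0" using that t0 by (auto simp: \<phi>_def)
    with \<phi>_le[of y t0] that show ?thesis by simp
  qed
  have g_growth: "g v \<le> ((1 + v) / (1 + u)) ^ k * g u" if "0 \<le> u" "u \<le> v" for u v
    unfolding g_def[of v]
  proof (rule cSUP_least)
    fix t assume t: "t \<in> {t0..}"
    have "min 1 ((1 + v) / (1 + t)) \<le> (1 + v) / (1 + u) * min 1 ((1 + u) / (1 + t))"
    proof -
      have "(1 + v) / (1 + u) * min 1 ((1 + u) / (1 + t)) = min ((1 + v) / (1 + u)) ((1 + v) / (1 + t))"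
        using that t t0(1) by (simp add: min_mult_distrib_left)
      moreover have "min 1 ((1 + v) / (1 + t)) \<le> min ((1 + v) / (1 + u)) ((1 + v) / (1 + t))"
        using that by (intro min.mono) (auto simp: le_divide_eq)
      ultimately show ?thesis by simp
    qed
    then have "\<phi> v t \<le> b t * ((1 + v) / (1 + u) * min 1 ((1 + u) / (1 + t))) ^ k"
      unfolding \<phi>_def using that t t0(1) t0(2)[of t]
      by (intro mult_left_mono power_mono) auto
    also have "\<dots> = ((1 + v) / (1 + u)) ^ k * \<phi> u t"
      by (simp only: \<phi>_def power_mult_distrib ac_simps)
    also have "\<dots> \<le> ((1 + v) / (1 + u)) ^ k * g u"
      using that t \<phi>_le[of u t] by (intro mult_left_mono) auto
    finally show "\<phi> v t \<le> ((1 + v) / (1 + u)) ^ k * g u" .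
  qed auto
  have g_le: "g y \<le> C * b y" if "y \<ge> t0" for y
    unfolding g_def using upper that by (intro cSUP_least) auto
  have le_g: "b y \<le> g y" if "y \<ge> t0" for y
    using \<phi>_le[of y y] that t0 by (simp add: \<phi>_def)
  \<comment> \<open>Now \<open>N powr \<alpha> = 2 * C + 1\<close>, so \<open>b\<close> eventually
    grows by more than \<open>2 * C\<close> over a factor \<open>N\<close>; the part
    \<open>C\<close> of this pays for passing from \<open>g\<close> to \<open>b\<close>.\<close>
  define N where "N = (2 * C + 1) powr (1 / \<alpha>)"
  have "N > 1" using \<open>C > 0\<close> \<alpha> by (simp add: N_def)
  have "((\<lambda>x. b (N * x) / b x) \<longlongrightarrow> N powr \<alpha>) at_top"
    using b_rv \<open>N > 1\<close> by (simp add: regularly_varying_def)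
  moreover have "N powr \<alpha> = 2 * C + 1" using \<open>C > 0\<close> \<alpha> by (simp add: N_def powr_powr)
  ultimately have "((\<lambda>x. b (N * x) / b x) \<longlongrightarrow> 2 * C + 1) at_top" by simp
  then have "\<forall>\<^sub>F x in at_top. b (N * x) / b x > 2 * C"
    by (rule order_tendstoD(1)) simp
  then obtain x1 where x1: "\<And>x. x \<ge> x1 \<Longrightarrow> b (N * x) / b x > 2 * C"
    by (auto simp: eventually_at_top_linorder)
  have g_contract: "2 * g (y / N) \<le> g y" if "y \<ge> N * max x1 t0" for y
  proof -
    have y: "y / N \<ge> x1" "y / N \<ge> t0" "y \<ge> t0"
    proof -
      have "y / N \<ge> max x1 t0" using that \<open>N > 1\<close> by (simp add: le_divide_eq ac_simps)
      then show "y / N \<ge> x1" "y / N \<ge> t0" by auto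
      have "y / N \<le> y" using \<open>y / N \<ge> t0\<close> t0(1) \<open>N > 1\<close>
        by (auto simp: divide_le_eq mult_le_cancel_left1 zero_less_divide_iff dest: order_trans[OF t0(1)])
      then show "y \<ge> t0" using \<open>y / N \<ge> t0\<close> by simp
    qed
    have "2 * g (y / N) \<le> 2 * C * b (y / N)" using g_le y by simp
    also have "\<dots> \<le> b y"
      using x1[OF y(1)] t0(2)[OF y(2)] \<open>N > 1\<close> by (simp add: less_divide_eq)
    also have "\<dots> \<le> g y" using le_g y by simp
    finally show ?thesis .
  qed
  obtain c where c: "\<And>x. x \<in> {0..t0} \<Longrightarrow> \<bar>b x\<bar> \<le> c"
  proof -
    have "bounded (b ` {0..t0})" using b_bdd t0(1) by (simp add: locally_bounded_nonneg_def)
    then obtain c where "\<forall>x\<in>{0..t0}. \<bar>b x\<bar> \<le> c" by (auto simp: bounded_iff)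
    then show ?thesis by (intro that[of c]) blast
  qed
  define C' where "C' = max (max C 1) (c / g 0)"
  have C': "C' \<ge> C" "C' \<ge> 1" "C' > 0" "C' \<ge> c / g 0" by (auto simp: C'_def)
  have "b y \<le> C' * g y" if "y \<ge> 0" for y
  proof (cases "y \<ge> t0")
    case True
    then show ?thesis using le_g[of y] g_pos[of y] that C'
      by (smt (verit) mult_le_cancel_right1)
  next
    case False
    then have "b y \<le> c" using c[of y] that by auto
    also have "\<dots> \<le> C' * g 0" using C'(4) g_pos[of 0] by (simp add: divide_le_eq)
    also have "\<dots> \<le> C' * g y" using g_mono[of 0 y] that C' by simp
    finally show ?thesis .
  qed
  moreover have "g y \<le> C' * b y" if "y \<ge> t0" for y
    using g_le[OF that] t0(2)[OF that] C'(1) by (smt (verit) mult_right_mono)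
  ultimately show thesis
    using \<open>N > 1\<close> C'(3) by (intro that[of g k N "N * max x1 t0" C' t0] g_pos g_mono g_growth g_contract) auto
qed

section \<open>The Lyapunov function\<close>

text \<open>The growth condition, read with \<open>y\<close> as the left and as the right endpoint,
  bounds \<open>f t - f y\<close> on both sides by a multiple of
  \<open>((1 + t) / (1 + y)) ^ k - 1\<close>. It is applied to \<open>g\<close> and, with
  \<open>k = 1\<close>, to the shifted \<open>A\<close>.\<close>

lemma continuous_on_polynomial_growth:
  fixes f :: "real \<Rightarrow> real"
  assumes mono: "\<And>u v. 0 \<le> u \<Longrightarrow> u \<le> v \<Longrightarrow> f u \<le> f v"
    and growth: "\<And>u v. 0 \<le> u \<Longrightarrow> u \<le> v \<Longrightarrow> f v \<le> ((1 + v) / (1 + u)) ^ k * f u"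
  shows "continuous_on {0..} f"
  unfolding continuous_on_def
proof
  fix y :: real assume y: "y \<in> {0..}"
  have bound: "\<bar>f t - f y\<bar> \<le> \<bar>((1 + t) / (1 + y)) ^ k - 1\<bar> * \<bar>f y\<bar>" if t: "t \<in> {0..}" for t
  proof (cases "y \<le> t")
    case True
    have "f t - f y \<le> (((1 + t) / (1 + y)) ^ k - 1) * f y"
      using growth[of y t] True y by (simp add: algebra_simps)
    also have "\<dots> \<le> \<bar>((1 + t) / (1 + y)) ^ k - 1\<bar> * \<bar>f y\<bar>"
      by (metis abs_ge_self abs_mult)
    finally show ?thesis using mono[of y t] True y by simp
  next
    case False
    then have "t \<le> y" by simp
    have "((1 + t) / (1 + y)) ^ k * f y \<le> ((1 + t) / (1 + y)) ^ k * (((1 + y) / (1 + t)) ^ k * f t)"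
      using growth[of t y] False t by (intro mult_left_mono) auto
    also have "\<dots> = f t" using t y by (simp add: power_mult_distrib[symmetric])
    finally have "f y - f t \<le> (1 - ((1 + t) / (1 + y)) ^ k) * f y"
      by (simp add: algebra_simps)
    also have "\<dots> \<le> \<bar>1 - ((1 + t) / (1 + y)) ^ k\<bar> * \<bar>f y\<bar>"
      by (metis abs_ge_self abs_mult)
    finally show ?thesis using mono[of t y] False t by (simp add: abs_minus_commute)
  qed
  have "((\<lambda>t. \<bar>((1 + t) / (1 + y)) ^ k - 1\<bar> * \<bar>f y\<bar>) \<longlongrightarrow> \<bar>((1 + y) / (1 + y)) ^ k - 1\<bar> * \<bar>f y\<bar>)
      (at y within {0..})"
    using y by (intro tendsto_intros) auto
  then have "((\<lambda>t. \<bar>((1 + t) / (1 + y)) ^ k - 1\<bar> * \<bar>f y\<bar>) \<longlongrightarrow> 0) (at y within {0..})"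
    using y by simp
  then have "((\<lambda>t. f t - f y) \<longlongrightarrow> 0) (at y within {0..})"
    by (rule Lim_null_comparison[rotated])
       (auto simp: eventually_at_filter intro!: always_eventually bound)
  then show "(f \<longlongrightarrow> f y) (at y within {0..})"
    by (rule LIM_zero_cancel)
qed

text \<open>\<open>A_scale\<close> says that \<open>A x / x\<close> is nonincreasing, as for a
  concave function vanishing at 0; \<open>g_contract\<close> is the form in which
  \<open>\<alpha> > 0\<close> survives for \<open>g\<close>.\<close>

locale gauge =
  fixes g A :: "real \<Rightarrow> real" and k :: nat and N y0 :: real
  assumes g_pos: "\<And>y. y \<ge> 0 \<Longrightarrow> g y > 0"
    and g_mono: "\<And>u v. 0 \<le> u \<Longrightarrow> u \<le> v \<Longrightarrow> g u \<le> g v"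
    and g_growth: "\<And>u v. 0 \<le> u \<Longrightarrow> u \<le> v \<Longrightarrow> g v \<le> ((1 + v) / (1 + u)) ^ k * g u"
    and N_gt_1: "N > 1"
    and g_contract: "\<And>y. y \<ge> y0 \<Longrightarrow> 2 * g (y / N) \<le> g y"
    and A_pos: "\<And>x. x > 0 \<Longrightarrow> A x > 0"
    and A_mono: "\<And>u v. 0 \<le> u \<Longrightarrow> u \<le> v \<Longrightarrow> A u \<le> A v"
    and A_scale: "\<And>u v. 0 < u \<Longrightarrow> u \<le> v \<Longrightarrow> u * A v \<le> v * A u"
begin

definition J1 :: "real \<Rightarrow> real" where
  "J1 y = (1 + y) / A (1 + y)"

text \<open>Moments of b times J are carried as moments of \<open>F\<close>, which is monotone,
  positive at 0 and of polynomial growth.\<close>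

definition F :: "real \<Rightarrow> real" where
  "F y = g y * J1 y"

text \<open>The shift by 1 in \<open>A (1 + t)\<close> keeps the integrand bounded at 0, where \<open>A\<close> vanishes.\<close>
definition B :: "real \<Rightarrow> real" where
  "B y = integral {0..y} (\<lambda>t. g t / A (1 + t))"

lemma A1_pos: "y \<ge> 0 \<Longrightarrow> A (1 + y) > 0"
  using A_pos by simp

lemma J1_mono: "0 \<le> u \<Longrightarrow> u \<le> v \<Longrightarrow> J1 u \<le> J1 v"
  using A_scale[of "1 + u" "1 + v"] A1_pos[of u] A1_pos[of v]
  by (simp add: J1_def divide_le_eq le_divide_eq ac_simps)

lemma J1_pos: "y \<ge> 0 \<Longrightarrow> J1 y > 0"
  using A1_pos by (simp add: J1_def)

lemma J1_scale: "c \<ge> 1 \<Longrightarrow> y \<ge> 0 \<Longrightarrow> J1 (c * y) \<le> c * J1 y"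
proof -
  assume c: "c \<ge> 1" and y: "y \<ge> 0"
  have "y \<le> c * y" using c y mult_right_mono[of 1 c y] by simp
  then have "A (1 + y) \<le> A (1 + c * y)" using A_mono y by simp
  then have "(1 + c * y) / A (1 + c * y) \<le> (1 + c * y) / A (1 + y)"
    using A1_pos[OF y] c y by (intro divide_left_mono) (auto intro!: mult_pos_pos add_nonneg_nonneg)
  also have "\<dots> \<le> (c * (1 + y)) / A (1 + y)"
    using A1_pos[OF y] c by (intro divide_right_mono) (auto simp: algebra_simps)
  finally show ?thesis by (simp add: J1_def)
qed

lemma g_scale: "c \<ge> 1 \<Longrightarrow> y \<ge> 0 \<Longrightarrow> g (c * y) \<le> c ^ k * g y"
proof -
  assume c: "c \<ge> 1" and y: "y \<ge> 0"
  have "y \<le> c * y" using c y mult_right_mono[of 1 c y] by simp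
  then have "g (c * y) \<le> ((1 + c * y) / (1 + y)) ^ k * g y" using g_growth y by simp
  also have "\<dots> \<le> c ^ k * g y"
    using c y g_pos[OF y] by (intro mult_right_mono power_mono) (auto simp: field_simps)
  finally show ?thesis .
qed

lemma g_shift: "d \<ge> 0 \<Longrightarrow> y \<ge> 0 \<Longrightarrow> g (y + d) \<le> (1 + d) ^ k * g y"
proof -
  assume d: "d \<ge> 0" and y: "y \<ge> 0"
  have "g (y + d) \<le> ((1 + (y + d)) / (1 + y)) ^ k * g y" using g_growth[of y "y + d"] y d by simp
  also have "\<dots> \<le> (1 + d) ^ k * g y"
    using d y g_pos[OF y] by (intro mult_right_mono power_mono) (auto simp: field_simps)
  finally show ?thesis .
qed

lemma F_pos: "y \<ge> 0 \<Longrightarrow> F y > 0"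
  by (simp add: F_def g_pos J1_pos)

lemma F_mono: "0 \<le> u \<Longrightarrow> u \<le> v \<Longrightarrow> F u \<le> F v"
  unfolding F_def using g_mono[of u v] J1_mono[of u v] g_pos[of v] J1_pos[of u]
  by (intro mult_mono) auto

lemma F_scale: "c \<ge> 1 \<Longrightarrow> y \<ge> 0 \<Longrightarrow> F (c * y) \<le> c ^ Suc k * F y"
proof -
  assume c: "c \<ge> 1" and y: "y \<ge> 0"
  then have "F (c * y) \<le> (c ^ k * g y) * (c * J1 y)"
    unfolding F_def using g_pos[of y] J1_pos[of "c * y"]
    by (intro mult_mono g_scale J1_scale) auto
  then show ?thesis by (simp add: F_def ac_simps)
qed

lemma J1_le_F: "y \<ge> 0 \<Longrightarrow> g 0 * J1 y \<le> F y"
  unfolding F_def using g_mono[of 0 y] J1_pos[of y] by (intro mult_right_mono) auto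

lemma F_add: "0 \<le> u \<Longrightarrow> 0 \<le> v \<Longrightarrow> F (u + v) \<le> 2 ^ Suc k * (F u + F v)"
proof -
  assume uv: "0 \<le> u" "0 \<le> v"
  have "F (u + v) \<le> F (2 * max u v)" using uv by (intro F_mono) auto
  also have "\<dots> \<le> 2 ^ Suc k * F (max u v)" using uv by (intro F_scale) auto
  also have "F (max u v) \<le> F u + F v" using uv F_pos[of u] F_pos[of v] by (auto simp: max_def)
  finally show ?thesis by simp
qed

lemma continuous_g: "continuous_on {0..} g"
  by (rule continuous_on_polynomial_growth[OF g_mono g_growth])

lemma continuous_A: "continuous_on {0..} (\<lambda>t. A (1 + t))"
proof (rule continuous_on_polynomial_growth[where k = 1])
  fix u v :: real assume "0 \<le> u" "u \<le> v"
  then show "A (1 + v) \<le> ((1 + v) / (1 + u)) ^ 1 * A (1 + u)"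
    using A_scale[of "1 + u" "1 + v"] by (simp add: field_simps)
qed (use A_mono in auto)

lemma continuous_density: "continuous_on {0..} (\<lambda>t. g t / A (1 + t))"
  using A1_pos by (intro continuous_on_divide continuous_g continuous_A) (force simp: less_imp_neq)

lemma B_0 [simp]: "B 0 = 0"
  by (simp add: B_def)

lemma B_diff:
  assumes "0 \<le> u" "u \<le> v"
  shows "\<exists>t\<in>{u..v}. B v - B u = (v - u) * (g t / A (1 + t))"
proof (cases "u < v")
  case True
  have deriv: "(B has_real_derivative g x / A (1 + x)) (at x within {0..v})" if "x \<in> {0..v}" for x
    unfolding B_def
    using integral_has_real_derivative[OF continuous_on_subset[OF continuous_density, of "{0..v}"] that]
    by simp
  have "\<exists>t\<in>{u<..<v}. B v - B u = (v - u) * (g t / A (1 + t))"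
  proof (rule mvt_simple[OF True, THEN bexE])
    fix x assume x: "u \<le> x" "x \<le> v"
    show "(B has_derivative (\<lambda>h. h * (g x / A (1 + x)))) (at x within {u..v})"
      using DERIV_subset[OF deriv, of x "{u..v}"] x assms
      unfolding has_field_derivative_def mult_commute_abs by auto
  qed auto
  then show ?thesis by force
qed (use assms in auto)

text \<open>The density is a quotient of two nondecreasing functions and need not be monotone, so
  \<open>g\<close> and \<open>A\<close> are estimated at opposite ends of the interval.\<close>

lemma B_diff_le: "0 \<le> u \<Longrightarrow> u \<le> v \<Longrightarrow> B v - B u \<le> (v - u) * (g v / A (1 + u))"
proof -
  assume uv: "0 \<le> u" "u \<le> v"
  obtain t where t: "t \<in> {u..v}" "B v - B u = (v - u) * (g t / A (1 + t))"
    using B_diff[OF uv] by auto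
  have "g t / A (1 + t) \<le> g v / A (1 + u)"
    using t uv g_pos[of v] A1_pos[of u] g_mono[of t v] A_mono[of "1 + u" "1 + t"]
    by (intro frac_le) auto
  then show ?thesis unfolding t(2) using uv by (intro mult_left_mono) auto
qed

lemma B_diff_ge: "0 \<le> u \<Longrightarrow> u \<le> v \<Longrightarrow> (v - u) * (g u / A (1 + v)) \<le> B v - B u"
proof -
  assume uv: "0 \<le> u" "u \<le> v"
  obtain t where t: "t \<in> {u..v}" "B v - B u = (v - u) * (g t / A (1 + t))"
    using B_diff[OF uv] by auto
  have "g u / A (1 + v) \<le> g t / A (1 + t)"
    using t uv g_pos[of t] A1_pos[of t] g_mono[of u t] A_mono[of "1 + t" "1 + v"]
    by (intro frac_le) auto
  then show ?thesis unfolding t(2) using uv by (intro mult_left_mono) auto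
qed

lemma B_mono: "0 \<le> u \<Longrightarrow> u \<le> v \<Longrightarrow> B u \<le> B v"
  using B_diff_ge[of u v] g_pos[of u] A1_pos[of v]
  by (smt (verit) divide_nonneg_pos mult_nonneg_nonneg)

lemma B_nonneg: "y \<ge> 0 \<Longrightarrow> B y \<ge> 0"
  using B_mono[of 0 y] by simp

lemma continuous_B: "continuous_on {0..} B"
  unfolding continuous_on_def
proof
  fix y :: real assume y: "y \<in> {0..}"
  define c where "c = g (y + 1) / A 1"
  have "\<bar>B t - B y\<bar> \<le> \<bar>t - y\<bar> * c" if t: "t \<in> {0..}" "\<bar>t - y\<bar> < 1" for t
  proof -
    have "B (max t y) - B (min t y) \<le> (max t y - min t y) * (g (max t y) / A (1 + min t y))"
      using t y by (intro B_diff_le) auto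
    also have "\<dots> \<le> (max t y - min t y) * c"
      unfolding c_def using t y A_pos[of 1] g_mono[of "max t y" "y + 1"] A_mono[of 1 "1 + min t y"] g_pos[of "y + 1"]
      by (intro mult_left_mono frac_le) auto
    finally have "B (max t y) - B (min t y) \<le> (max t y - min t y) * c" .
    moreover have "B (max t y) - B (min t y) = \<bar>B t - B y\<bar>"
      using B_mono[of t y] B_mono[of y t] t y by (cases "t \<le> y") simp_all
    moreover have "max t y - min t y = \<bar>t - y\<bar>" by simp
    ultimately show ?thesis by simp
  qed
  then have "\<forall>\<^sub>F t in at y within {0..}. norm (B t - B y) \<le> \<bar>t - y\<bar> * c"
    unfolding eventually_at by (intro exI[of _ 1]) (auto simp: dist_real_def)
  moreover have "((\<lambda>t. \<bar>t - y\<bar> * c) \<longlongrightarrow> 0) (at y within {0..})"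
    by (rule tendsto_eq_rhs, rule tendsto_mult, rule tendsto_rabs, rule tendsto_diff,
        rule tendsto_ident_at, rule tendsto_const, rule tendsto_const) simp
  ultimately have "((\<lambda>t. B t - B y) \<longlongrightarrow> 0) (at y within {0..})"
    by (rule Lim_null_comparison)
  then show "(B \<longlongrightarrow> B y) (at y within {0..})" by (rule LIM_zero_cancel)
qed

text \<open>A bound of Karamata type. It can fail when \<open>g\<close> does not grow, as for
  constant \<open>g\<close> and \<open>A x = x\<close>; \<open>g_contract\<close> excludes
  this.\<close>

lemma B_le_F: "\<exists>C>0. \<forall>y\<ge>0. B y \<le> C * F y"
proof -
  define y1 where "y1 = max 1 y0"
  \<comment> \<open>The first entry makes \<open>C / 2 + N \<le> C\<close>, which closes the
    induction step; the second covers the initial stretch up to \<open>y1\<close>.\<close>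
  define C where "C = max (2 * N) (B y1 / F 0)"
  have y1: "y1 \<ge> 1" "y1 \<ge> y0" by (auto simp: y1_def)
  have C: "C \<ge> 2 * N" "C \<ge> B y1 / F 0" "C > 0" using N_gt_1 by (auto simp: C_def)
  have N2: "max 2 N > 1" by simp
  text \<open>Contraction of \<open>g\<close> under division by \<open>N\<close> makes the \<open>N\<close>-adic blocks of the integral
    sum up geometrically.\<close>
  have "B y \<le> C * F y" if "0 \<le> y" "y \<le> N ^ n * y1" for n y
    using that
  proof (induction n arbitrary: y)
    case 0
    have "B y \<le> B y1" using 0 by (intro B_mono) auto
    also have "\<dots> \<le> C * F 0" using C(2) F_pos[of 0] by (simp add: divide_le_eq)
    also have "\<dots> \<le> C * F y" using 0 C(3) F_mono[of 0 y] by simp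
    finally show ?case .
  next
    case (Suc n)
    show ?case
    proof (cases "y \<le> y1")
      case True
      have "B y \<le> B y1" using Suc.prems True by (intro B_mono) auto
      also have "\<dots> \<le> C * F 0" using C(2) F_pos[of 0] by (simp add: divide_le_eq)
      also have "\<dots> \<le> C * F y" using Suc.prems C(3) F_mono[of 0 y] by simp
      finally show ?thesis .
    next
      case False
      define w where "w = y / N"
      have w: "0 \<le> w" "y = N * w" "w \<le> N ^ n * y1"
        using Suc.prems N_gt_1 by (auto simp: w_def divide_le_eq mult.assoc ac_simps)
      have wy: "w \<le> y"
        using mult_right_mono[of 1 N w] w(1,2) N_gt_1 by simp
      have "B w \<le> C * F w" using w(1,3) by (rule Suc.IH)
      also have "C * F w \<le> C / 2 * F y"
      proof -
        have "2 * g w \<le> g y" using g_contract[of y] False y1 by (simp add: w_def)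
        then have "2 * g w * J1 w \<le> g y * J1 y"
          using w(1) wy J1_mono[of w y] J1_pos[of w] g_pos[of w] by (intro mult_mono) auto
        then show ?thesis using C(3) by (simp add: F_def)
      qed
      finally have "B w \<le> C / 2 * F y" .
      moreover have "B y - B w \<le> N * F y"
      proof -
        have "B y - B w \<le> (y - w) * (g y / A (1 + w))" using w(1) wy by (intro B_diff_le)
        also have "\<dots> \<le> (N * (1 + w)) * (g y / A (1 + w))"
          using w g_pos[of y] A1_pos[of w] N_gt_1 by (intro mult_right_mono) (auto simp: algebra_simps intro!: divide_nonneg_nonneg)
        also have "\<dots> = N * (g y * J1 w)" by (simp add: J1_def)
        also have "\<dots> \<le> N * (g y * J1 y)"
          using w(1) wy g_pos[of y] N_gt_1 J1_mono[of w y] by (intro mult_left_mono) auto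
        finally show ?thesis by (simp add: F_def)
      qed
      moreover have "N * F y \<le> C / 2 * F y" using C(1) F_pos[of y] w(1) wy by (intro mult_right_mono) auto
      ultimately show ?thesis by (simp add: field_simps)
    qed
  qed
  moreover have "\<exists>n. y \<le> N ^ n * y1" for y
  proof -
    obtain n where "y < N ^ n" using real_arch_pow[OF N_gt_1] by auto
    moreover have "N ^ n * 1 \<le> N ^ n * y1" using y1 N_gt_1 by (intro mult_left_mono) auto
    ultimately show ?thesis by (intro exI[of _ n]) simp
  qed
  ultimately have "\<forall>y\<ge>0. B y \<le> C * F y" by meson
  then show ?thesis using C(3) by (intro exI[of _ C] conjI)
qed

text \<open>For \<open>y \<ge> 1\<close> the integral over \<open>{y / 2..y}\<close> alone already
  has the size of \<open>F y\<close>, since \<open>g\<close> loses at most the factor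
  \<open>2 ^ k\<close> there.\<close>

lemma F_le_B: "\<exists>C>0. \<forall>y\<ge>0. F y \<le> C * (B y + 1)"
proof (intro exI conjI allI impI)
  define C where "C = 2 ^ Suc k * 3 + F 1"
  show "C > 0" using F_pos[of 1] by (auto simp: C_def intro!: add_pos_pos)
  fix y :: real assume y: "y \<ge> 0"
  show "F y \<le> C * (B y + 1)"
  proof (cases "y \<ge> 1")
    case True
    have "F y \<le> 2 ^ k * g (y / 2) * J1 y"
      using g_scale[of 2 "y / 2"] J1_pos[OF y] y by (simp add: F_def)
    also have "\<dots> = (2 ^ k * (1 + y)) * (g (y / 2) / A (1 + y))"
      by (simp add: J1_def)
    also have "\<dots> \<le> (2 ^ Suc k * 3 * (y - y / 2)) * (g (y / 2) / A (1 + y))"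
      using True A1_pos[of y] g_pos[of "y / 2"] by (intro mult_right_mono) auto
    also have "\<dots> \<le> 2 ^ Suc k * 3 * B y"
      using B_diff_ge[of "y / 2" y] B_nonneg[of "y / 2"] True
      by (simp only: mult.assoc) (intro mult_left_mono, auto)
    also have "\<dots> \<le> C * (B y + 1)"
      using B_nonneg[OF y] F_pos[of 1] by (intro mult_mono) (auto simp: C_def)
    finally show ?thesis .
  next
    case False
    then have "F y \<le> F 1" using y by (intro F_mono) auto
    also have "\<dots> \<le> C" by (simp add: C_def)
    also have "\<dots> = C * 1" by simp
    also have "\<dots> \<le> C * (B y + 1)"
      using \<open>C > 0\<close> B_nonneg[OF y] by (intro mult_left_mono) auto
    finally show ?thesis .
  qed
qed

lemma B_scale: "c \<ge> 1 \<Longrightarrow> \<exists>C>0. \<forall>y\<ge>0. B (c * y) \<le> C * (B y + 1)"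
proof -
  assume c: "c \<ge> 1"
  obtain C1 where C1: "C1 > 0" "\<And>y. y \<ge> 0 \<Longrightarrow> B y \<le> C1 * F y" using B_le_F by auto
  obtain C2 where C2: "C2 > 0" "\<And>y. y \<ge> 0 \<Longrightarrow> F y \<le> C2 * (B y + 1)" using F_le_B by auto
  have "B (c * y) \<le> C1 * c ^ Suc k * C2 * (B y + 1)" if y: "y \<ge> 0" for y
  proof -
    have "B (c * y) \<le> C1 * F (c * y)" using c y by (intro C1) auto
    also have "\<dots> \<le> C1 * (c ^ Suc k * F y)" using c y C1(1) by (intro mult_left_mono F_scale) auto
    also have "\<dots> \<le> C1 * (c ^ Suc k * (C2 * (B y + 1)))"
      using c y C1(1) by (intro mult_left_mono C2) auto
    finally show ?thesis by (simp add: ac_simps)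
  qed
  moreover have "C1 * c ^ Suc k * C2 > 0" using C1(1) C2(1) c by simp
  ultimately show ?thesis by blast
qed

text \<open>Far out, each factor \<open>N\<close> doubles \<open>g\<close>. In (i) this turns a
  bound on \<open>g\<close> along the partial sums into a bound on the sums themselves.\<close>

lemma g_unbounded: "filterlim g at_top at_top"
proof -
  have "\<exists>y\<ge>0. g y \<ge> 2 ^ n * g 0" for n
  proof (induction n)
    case (Suc n)
    then obtain y where y: "y \<ge> 0" "g y \<ge> 2 ^ n * g 0" by auto
    define w where "w = max y0 (N * y)"
    have "2 * g y \<le> 2 * g (w / N)"
      using y(1) N_gt_1 by (auto simp: w_def le_divide_eq mult.commute intro!: g_mono)
    also have "\<dots> \<le> g w" by (rule g_contract) (simp add: w_def)
    finally have "g w \<ge> 2 ^ Suc n * g 0" using y(2) by simp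
    moreover have "w \<ge> 0" using y(1) N_gt_1 by (simp add: w_def le_max_iff_disj)
    ultimately show ?case by blast
  qed (auto intro: exI[of _ 0])
  note powers = this
  have "\<exists>y\<ge>0. g y \<ge> Z" for Z
  proof -
    obtain n where "Z / g 0 < 2 ^ n" using real_arch_pow[of 2] by auto
    then have "Z \<le> 2 ^ n * g 0" using g_pos[of 0] by (simp add: divide_less_eq)
    then show ?thesis using powers[of n] by (meson order_trans)
  qed
  show ?thesis
    unfolding filterlim_at_top eventually_at_top_linorder
  proof
    fix Z
    obtain y where y: "y \<ge> 0" "g y \<ge> Z" using \<open>\<And>Z. \<exists>y\<ge>0. g y \<ge> Z\<close>[of Z] by auto
    have "Z \<le> g x" if "x \<ge> y" for x using y g_mono[of y x] that by simp
    then show "\<exists>y. \<forall>x\<ge>y. Z \<le> g x" by blast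
  qed
qed

end

section \<open>One step of the recursion\<close>

text \<open>It differs from \<open>log_plus\<close> by at most 1 but, unlike it, determines the
  absolute value of its argument, so that the recursion for absolute values can be written in this
  variable.\<close>

definition log1p :: "real \<Rightarrow> real" where
  "log1p z = ln (1 + \<bar>z\<bar>)"

definition neg_log :: "real \<Rightarrow> real" where
  "neg_log m = max 0 (- ln \<bar>m\<bar>)"

definition trunc_mean :: "(real \<times> real) measure \<Rightarrow> real \<Rightarrow> real" where
  "trunc_mean \<mu> x = (\<integral>p. min (neg_log (fst p)) x \<partial>\<mu>)"

lemma log1p_nonneg [simp]: "log1p z \<ge> 0"
  by (simp add: log1p_def)

lemma neg_log_nonneg [simp]: "neg_log m \<ge> 0"
  by (simp add: neg_log_def)

lemma measurable_log1p [measurable]: "log1p \<in> borel_measurable borel"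
  unfolding log1p_def by measurable

lemma measurable_neg_log [measurable]: "neg_log \<in> borel_measurable borel"
  unfolding neg_log_def by measurable

text \<open>\<open>log_step y p = log1p (\<bar>snd p\<bar> + \<bar>fst p\<bar> * z)\<close> for the point \<open>z \<ge> 0\<close> with \<open>log1p z = y\<close>.\<close>
definition log_step :: "real \<Rightarrow> real \<times> real \<Rightarrow> real" where
  "log_step y p = ln (1 + \<bar>snd p\<bar> + \<bar>fst p\<bar> * (exp y - 1))"

lemma measurable_log_step [measurable]: "log_step y \<in> borel_measurable (borel \<Otimes>\<^sub>M borel)"
  unfolding log_step_def by measurable

lemma log_step_log1p: "z \<ge> 0 \<Longrightarrow> log_step (log1p z) p = log1p (\<bar>snd p\<bar> + \<bar>fst p\<bar> * z)"
  by (simp add: log_step_def log1p_def add_ac)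

lemma log_step_nonneg: "y \<ge> 0 \<Longrightarrow> log_step y p \<ge> 0"
  by (simp add: log_step_def)

lemma log_step_le: assumes "y \<ge> 0" shows "log_step y p \<le> y + (log1p (fst p) + log1p (snd p))"
proof -
  have "1 + \<bar>snd p\<bar> + \<bar>fst p\<bar> * (exp y - 1) \<le> exp y * (1 + \<bar>fst p\<bar>) * (1 + \<bar>snd p\<bar>)"
  proof -
    have "\<bar>snd p\<bar> * 1 \<le> \<bar>snd p\<bar> * exp y"
      using assms by (intro mult_left_mono) auto
    moreover have "exp y * (1 + \<bar>fst p\<bar>) * (1 + \<bar>snd p\<bar>) - (1 + \<bar>snd p\<bar> + \<bar>fst p\<bar> * (exp y - 1)) =
        (exp y - 1) + \<bar>fst p\<bar> + (\<bar>snd p\<bar> * exp y - \<bar>snd p\<bar> * 1) + exp y * \<bar>fst p\<bar> * \<bar>snd p\<bar>"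
      by (simp add: algebra_simps)
    moreover have "exp y \<ge> 1" "\<bar>fst p\<bar> \<ge> 0" "exp y * \<bar>fst p\<bar> * \<bar>snd p\<bar> \<ge> 0" using assms by auto
    ultimately show ?thesis by linarith
  qed
  then have "log_step y p \<le> ln (exp y * (1 + \<bar>fst p\<bar>) * (1 + \<bar>snd p\<bar>))"
    unfolding log_step_def using assms by (intro ln_mono) (auto intro!: add_pos_nonneg)
  also have "\<dots> = y + (log1p (fst p) + log1p (snd p))"
  proof -
    have "0 < 1 + \<bar>fst p\<bar>" "0 < 1 + \<bar>snd p\<bar>" by (auto intro: add_pos_nonneg)
    then show ?thesis by (simp add: log1p_def ln_mult_pos)
  qed
  finally show ?thesis .
qed

text \<open>With \<open>exp y\<close> pulled out of the logarithm, the remaining argument visibly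
  tends to \<open>\<bar>fst p\<bar>\<close> as \<open>y\<close> grows.\<close>

lemma log_step_minus: "log_step y p - y = ln (\<bar>fst p\<bar> + (1 + \<bar>snd p\<bar> - \<bar>fst p\<bar>) * exp (- y))" if "y \<ge> 0"
proof -
  have pos: "0 < 1 + \<bar>snd p\<bar> + \<bar>fst p\<bar> * (exp y - 1)"
    using that by (auto intro!: add_pos_nonneg)
  have "log_step y p - y = ln (1 + \<bar>snd p\<bar> + \<bar>fst p\<bar> * (exp y - 1)) + ln (exp (- y))"
    by (simp add: log_step_def)
  also have "\<dots> = ln ((1 + \<bar>snd p\<bar> + \<bar>fst p\<bar> * (exp y - 1)) * exp (- y))"
    using pos by (intro ln_mult_pos[symmetric]) auto
  also have "(1 + \<bar>snd p\<bar> + \<bar>fst p\<bar> * (exp y - 1)) * exp (- y) =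
      \<bar>fst p\<bar> + (1 + \<bar>snd p\<bar> - \<bar>fst p\<bar>) * exp (- y)"
    by (simp add: algebra_simps exp_minus)
  finally show ?thesis .
qed

lemma log_step_minus_tendsto:
  assumes "fst p \<noteq> 0"
  shows "((\<lambda>y. log_step y p - y) \<longlongrightarrow> ln \<bar>fst p\<bar>) at_top"
proof -
  have "((\<lambda>y. exp (- y)) \<longlongrightarrow> (0::real)) at_top"
    by (intro filterlim_compose[OF exp_at_bot] filterlim_uminus_at_bot_at_top)
  then have "((\<lambda>y. ln (\<bar>fst p\<bar> + (1 + \<bar>snd p\<bar> - \<bar>fst p\<bar>) * exp (- y)))
      \<longlongrightarrow> ln (\<bar>fst p\<bar> + (1 + \<bar>snd p\<bar> - \<bar>fst p\<bar>) * 0)) at_top"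
    using assms by (intro tendsto_intros) auto
  then have "((\<lambda>y. ln (\<bar>fst p\<bar> + (1 + \<bar>snd p\<bar> - \<bar>fst p\<bar>) * exp (- y))) \<longlongrightarrow> ln \<bar>fst p\<bar>) at_top"
    by simp
  then show ?thesis
    by (rule Lim_transform_eventually)
       (use eventually_ge_at_top[of 0] in eventually_elim, simp add: log_step_minus)
qed

text \<open>The error that \<open>snd p\<close> and the added 1 cause in a descent of at most
  \<open>e * y\<close>: relative to the height \<open>(1 - e) * y\<close> that is left,
  \<open>1 + \<bar>snd p\<bar>\<close> has the size
  \<open>(1 + \<bar>snd p\<bar>) * exp (- ((1 - e) * y))\<close>.\<close>

definition overshoot :: "real \<Rightarrow> real \<Rightarrow> real \<times> real \<Rightarrow> real" where
  "overshoot e y p = ln (1 + (1 + \<bar>snd p\<bar>) * exp (- ((1 - e) * y)))"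

lemma measurable_overshoot [measurable]: "overshoot e y \<in> borel_measurable (borel \<Otimes>\<^sub>M borel)"
  unfolding overshoot_def by measurable

lemma overshoot_nonneg: "overshoot e y p \<ge> 0"
  by (simp add: overshoot_def)

lemma overshoot_le:
  assumes "e \<le> 1" "y \<ge> 0" shows "overshoot e y p \<le> 1 + log1p (snd p)"
proof -
  have "exp (- ((1 - e) * y)) \<le> 1" using assms by simp
  then have "(1 + \<bar>snd p\<bar>) * exp (- ((1 - e) * y)) \<le> (1 + \<bar>snd p\<bar>) * 1"
    by (intro mult_left_mono) auto
  then have "1 + (1 + \<bar>snd p\<bar>) * exp (- ((1 - e) * y)) \<le> 2 * (1 + \<bar>snd p\<bar>)"
    by simp
  then have "overshoot e y p \<le> ln (2 * (1 + \<bar>snd p\<bar>))"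
    unfolding overshoot_def by (intro ln_mono) (auto intro!: add_pos_nonneg)
  also have "\<dots> = ln 2 + log1p (snd p)"
    unfolding log1p_def by (intro ln_mult_pos) auto
  also have "\<dots> \<le> 1 + log1p (snd p)"
    using ln_2_less_1 by simp
  finally show ?thesis .
qed

lemma overshoot_tendsto:
  assumes "e < 1" shows "((\<lambda>y. overshoot e y p) \<longlongrightarrow> 0) at_top"
proof -
  have "filterlim (\<lambda>y. (1 - e) * y) at_top at_top"
    using assms by (intro filterlim_tendsto_pos_mult_at_top[OF tendsto_const _ filterlim_ident]) auto
  then have "((\<lambda>y. exp (- ((1 - e) * y))) \<longlongrightarrow> (0::real)) at_top"
    by (intro filterlim_compose[OF exp_at_bot] filterlim_compose[OF filterlim_uminus_at_bot_at_top])
  then have "((\<lambda>y. overshoot e y p) \<longlongrightarrow> ln (1 + (1 + \<bar>snd p\<bar>) * 0)) at_top"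
    unfolding overshoot_def by (intro tendsto_intros) auto
  then show ?thesis by simp
qed

text \<open>For a descent \<open>s \<le> e * y\<close> one has
  \<open>exp (- y) \<le> exp (- s) * exp (- ((1 - e) * y))\<close>, so that \<open>exp (- s)\<close>
  can be factored out of the multiplier and of the remainder alike.\<close>

lemma descent_ge:
  assumes y: "y \<ge> 0" and e: "0 \<le> e" "e \<le> 1" and nz: "fst p \<noteq> 0"
  shows "min (neg_log (fst p)) (e * y) - overshoot e y p \<le> max 0 (y - log_step y p)"
proof (cases "\<bar>fst p\<bar> \<ge> 1")
  case True
  then have "neg_log (fst p) = 0" by (simp add: neg_log_def)
  then show ?thesis using e y overshoot_nonneg[of e y p] by (auto simp: max_def)
next
  case False
  define s where "s = min (neg_log (fst p)) (e * y)"
  have "neg_log (fst p) = - ln \<bar>fst p\<bar>"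
    using False nz by (simp add: neg_log_def max_def)
  then have "s \<le> - ln \<bar>fst p\<bar>" "s \<le> e * y" by (auto simp: s_def)
  then have m: "\<bar>fst p\<bar> \<le> exp (- s)" 
    using nz by (metis abs_ge_zero exp_le_cancel_iff exp_ln le_minus_iff less_le zero_less_abs_iff)
  have "exp (- y) \<le> exp (- s) * exp (- ((1 - e) * y))"
    using \<open>s \<le> e * y\<close> by (simp add: algebra_simps flip: exp_add)
  then have "\<bar>fst p\<bar> + (1 + \<bar>snd p\<bar>) * exp (- y) \<le>
      exp (- s) + (1 + \<bar>snd p\<bar>) * (exp (- s) * exp (- ((1 - e) * y)))"
    using m by (intro add_mono mult_left_mono) auto
  then have le: "\<bar>fst p\<bar> + (1 + \<bar>snd p\<bar> - \<bar>fst p\<bar>) * exp (- y) \<le>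
      exp (- s) * (1 + (1 + \<bar>snd p\<bar>) * exp (- ((1 - e) * y)))"
    by (simp add: algebra_simps)
       (smt (verit) abs_ge_zero exp_ge_zero mult_nonneg_nonneg)
  have "exp (- y) \<le> 1" using y by simp
  then have "0 < \<bar>fst p\<bar> * (1 - exp (- y)) + (1 + \<bar>snd p\<bar>) * exp (- y)"
    by (intro add_nonneg_pos[OF mult_nonneg_nonneg mult_pos_pos]) auto
  then have "0 < \<bar>fst p\<bar> + (1 + \<bar>snd p\<bar> - \<bar>fst p\<bar>) * exp (- y)"
    by (simp add: algebra_simps)
  then have "log_step y p - y \<le> ln (exp (- s) * (1 + (1 + \<bar>snd p\<bar>) * exp (- ((1 - e) * y))))"
    unfolding log_step_minus[OF y] using le by (intro ln_mono) auto
  also have "\<dots> = - s + overshoot e y p"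
  proof -
    have "0 < 1 + (1 + \<bar>snd p\<bar>) * exp (- ((1 - e) * y))"
      by (intro add_pos_nonneg) auto
    then show ?thesis by (simp add: overshoot_def ln_mult_pos)
  qed
  finally show ?thesis by (simp add: s_def)
qed

locale perpetuity = prob_space \<mu> + gauge g "trunc_mean \<mu>" k N y0
  for \<mu> :: "(real \<times> real) measure" and g :: "real \<Rightarrow> real" and k N y0 +
  assumes sets_mu [measurable_cong]: "sets \<mu> = sets (borel \<Otimes>\<^sub>M borel)"
    and M_nonzero: "AE p in \<mu>. fst p \<noteq> 0"
begin

abbreviation A :: "real \<Rightarrow> real" where "A \<equiv> trunc_mean \<mu>"

lemma B_neg: "y \<le> 0 \<Longrightarrow> B y = 0"
  by (cases "y = 0") (auto simp: B_def)

lemma measurable_B [measurable]: "B \<in> borel_measurable borel"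
proof -
  have "continuous_on UNIV (\<lambda>y. B (max 0 y))"
    by (intro continuous_on_compose2[OF continuous_B]) (auto intro!: continuous_intros)
  also have "(\<lambda>y. B (max 0 y)) = B"
    using B_neg by (auto simp: max_def fun_eq_iff)
  finally show ?thesis by (rule borel_measurable_continuous_onI)
qed

lemma measurable_g:
  assumes [measurable]: "f \<in> borel_measurable K" and "\<And>x. f x \<ge> 0"
  shows "(\<lambda>x. g (f x)) \<in> borel_measurable K"
proof -
  have "continuous_on UNIV (\<lambda>y. g (max 0 y))"
    by (intro continuous_on_compose2[OF continuous_g]) (auto intro!: continuous_intros)
  then have "(\<lambda>y. g (max 0 y)) \<in> borel_measurable borel"
    by (rule borel_measurable_continuous_onI)
  from measurable_compose[OF assms(1) this] show ?thesis
    using assms(2) by (simp add: max_absorb2)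
qed

lemma measurable_F:
  assumes f: "f \<in> borel_measurable K" and nn: "\<And>x. f x \<ge> 0"
  shows "(\<lambda>x. F (f x)) \<in> borel_measurable K"
proof -
  have "continuous_on UNIV (\<lambda>y. A (1 + max 0 y))"
    by (intro continuous_on_compose2[OF continuous_A]) (auto intro!: continuous_intros)
  then have "(\<lambda>y. A (1 + max 0 y)) \<in> borel_measurable borel"
    by (rule borel_measurable_continuous_onI)
  from measurable_compose[OF f this] have "(\<lambda>x. A (1 + f x)) \<in> borel_measurable K"
    using nn by (simp add: max_absorb2)
  then show ?thesis
    unfolding F_def J1_def using f measurable_g[OF f nn] by measurable
qed

text \<open>The drift to be proved is a negative multiple of \<open>g y\<close>, hence the division
  by \<open>g y\<close>; on this scale the upward part has a limit and an integrable
  majorant.\<close>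

definition pos_part :: "real \<Rightarrow> real \<times> real \<Rightarrow> real" where
  "pos_part y p = (B (max y (log_step y p)) - B y) / g y"

definition neg_part :: "real \<Rightarrow> real \<times> real \<Rightarrow> real" where
  "neg_part y p = (B y - B (min y (log_step y p))) / g y"

lemma B_log_step: "y \<ge> 0 \<Longrightarrow> B (log_step y p) = B y + g y * (pos_part y p - neg_part y p)"
  using g_pos[of y] by (auto simp: pos_part_def neg_part_def max_def min_def field_simps)

text \<open>The majorant for dominated convergence. With \<open>d\<close> the argument of
  \<open>F\<close> on the right: for \<open>d \<le> y\<close> the density just above
  \<open>y\<close> is of order \<open>g y / A (1 + d)\<close> at most, and
  \<open>d / A (1 + d)\<close> is below \<open>J1 d\<close>; for \<open>d > y\<close> even all of
  \<open>B (2 * d)\<close> is of order \<open>F d\<close>.\<close>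

lemma pos_part_bounds:
  "\<exists>C. \<forall>y\<ge>0. \<forall>p. 0 \<le> pos_part y p \<and> pos_part y p \<le> C * F (log1p (fst p) + log1p (snd p))"
proof -
  obtain C1 where C1: "C1 > 0" "\<And>y. y \<ge> 0 \<Longrightarrow> B y \<le> C1 * F y" using B_le_F by auto
  define C where "C = (2 ^ k + C1 * 2 ^ Suc k) / g 0"
  have "0 \<le> pos_part y p \<and> pos_part y p \<le> C * F (log1p (fst p) + log1p (snd p))" if y: "y \<ge> 0" for y p
  proof
    show "0 \<le> pos_part y p"
      using B_mono[of y "max y (log_step y p)"] g_pos[OF y] y by (simp add: pos_part_def)
    define d where "d = log1p (fst p) + log1p (snd p)"
    have d: "d \<ge> 0" by (simp add: d_def)
    have Fd: "F d > 0" using F_pos[OF d] .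
    have "B (max y (log_step y p)) \<le> B (y + d)"
      using y log_step_le[OF y, of p] d by (intro B_mono) (auto simp: d_def)
    moreover have "B (y + d) - B y \<le> g y * (C * F d)"
    proof (cases "d \<le> y")
      case True
      have "B (y + d) - B y \<le> (y + d - y) * (g (y + d) / A (1 + y))"
        using y d by (intro B_diff_le) auto
      also have "\<dots> \<le> d * ((2 ^ k * g y) / A (1 + d))"
        using True y d A1_pos[of d] A_mono[of "1 + d" "1 + y"] g_mono[of "y + d" "2 * y"] g_scale[of 2 y] g_pos[of y]
        by (auto intro!: mult_left_mono frac_le)
      also have "\<dots> = 2 ^ k * g y * (d / A (1 + d))" by simp
      also have "\<dots> \<le> 2 ^ k * g y * J1 d"
        unfolding J1_def using g_pos[OF y] A1_pos[OF d]
        by (intro mult_left_mono divide_right_mono) auto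
      also have "\<dots> \<le> 2 ^ k * g y * (F d / g 0)"
        using J1_le_F[OF d] g_pos[OF y] g_pos[of 0]
        by (intro mult_left_mono) (auto simp: le_divide_eq mult.commute)
      also have "\<dots> = g y * (2 ^ k / g 0 * F d)" by simp
      also have "\<dots> \<le> g y * (C * F d)"
        unfolding C_def using g_pos[OF y] g_pos[of 0] Fd C1(1)
        by (intro mult_left_mono mult_right_mono divide_right_mono) auto
      finally show ?thesis .
    next
      case False
      have "B (y + d) - B y \<le> B (2 * d)"
        using False y d B_nonneg[OF y] B_mono[of "y + d" "2 * d"] by auto
      also have "\<dots> \<le> C1 * F (2 * d)" using d by (intro C1) auto
      also have "\<dots> \<le> C1 * (2 ^ Suc k * F d)" using d C1(1) by (intro mult_left_mono F_scale) auto
      also have "\<dots> = g 0 * (C1 * 2 ^ Suc k / g 0 * F d)" using g_pos[of 0] by simp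
      also have "\<dots> \<le> g y * (C * F d)"
        unfolding C_def using g_pos[OF y] g_pos[of 0] g_mono[of 0 y] y Fd C1(1)
        by (intro mult_mono mult_right_mono divide_right_mono) auto
      finally show ?thesis .
    qed
    ultimately show "pos_part y p \<le> C * F (log1p (fst p) + log1p (snd p))"
      using g_pos[OF y] unfolding pos_part_def d_def[symmetric] by (simp add: divide_le_eq ac_simps)
  qed
  then show ?thesis by blast
qed

text \<open>The upward step \<open>d y\<close> converges, so it is short compared with
  \<open>y\<close>, and \<open>g_growth\<close> lets \<open>g\<close> change over it only by a
  factor tending to 1.\<close>

lemma pos_part_tendsto:
  assumes r: "((\<lambda>y. 1 / A (1 + y)) \<longlongrightarrow> r) at_top" and nz: "fst p \<noteq> 0"
  shows "((\<lambda>y. pos_part y p) \<longlongrightarrow> max 0 (ln \<bar>fst p\<bar>) * r) at_top"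
proof -
  define d where "d y = max 0 (log_step y p - y)" for y
  define l where "l = max 0 (ln \<bar>fst p\<bar>)"
  have d: "(d \<longlongrightarrow> l) at_top"
    unfolding d_def l_def by (intro tendsto_max tendsto_const log_step_minus_tendsto nz)
  have eq: "max y (log_step y p) = y + d y" and dnn: "d y \<ge> 0" for y
    by (auto simp: d_def)
  have "filterlim (\<lambda>y. y + d y) at_top at_top"
    by (rule filterlim_at_top_mono[OF filterlim_ident]) (simp add: dnn)
  from filterlim_compose[OF r this] have lower_lim: "((\<lambda>y. d y * (1 / A (1 + (y + d y)))) \<longlongrightarrow> l * r) at_top"
    by (intro tendsto_mult d)
  have "((\<lambda>y. d y * (1 / A (1 + y)) * (1 + d y / (1 + y)) ^ k) \<longlongrightarrow> l * r * (1 + 0) ^ k) at_top"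
    by (intro tendsto_mult d r tendsto_power tendsto_add tendsto_const tendsto_divide_0[OF d]
        filterlim_at_top_imp_at_infinity filterlim_tendsto_add_at_top[OF tendsto_const] filterlim_ident)
  then have upper_lim: "((\<lambda>y. d y * (1 / A (1 + y)) * (1 + d y / (1 + y)) ^ k) \<longlongrightarrow> l * r) at_top"
    by simp
  have lower: "\<forall>\<^sub>F y in at_top. d y * (1 / A (1 + (y + d y))) \<le> pos_part y p"
    using eventually_ge_at_top[of 0]
  proof eventually_elim
    case (elim y)
    have "d y * (g y / A (1 + (y + d y))) \<le> B (y + d y) - B y"
      using B_diff_ge[of y "y + d y"] elim dnn by simp
    then show ?case
      using g_pos[OF elim] by (simp add: pos_part_def eq le_divide_eq ac_simps)
  qed
  have upper: "\<forall>\<^sub>F y in at_top. pos_part y p \<le> d y * (1 / A (1 + y)) * (1 + d y / (1 + y)) ^ k"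
    using eventually_ge_at_top[of 0]
  proof eventually_elim
    case (elim y)
    have "g (y + d y) \<le> ((1 + (y + d y)) / (1 + y)) ^ k * g y"
      using g_growth[of y "y + d y"] elim dnn by simp
    also have "(1 + (y + d y)) / (1 + y) = 1 + d y / (1 + y)"
      using elim by (simp add: field_simps)
    finally have g: "g (y + d y) \<le> (1 + d y / (1 + y)) ^ k * g y" .
    have "B (y + d y) - B y \<le> (y + d y - y) * (g (y + d y) / A (1 + y))"
      using B_diff_le[of y "y + d y"] elim dnn by simp
    also have "\<dots> \<le> d y * (((1 + d y / (1 + y)) ^ k * g y) / A (1 + y))"
      using g dnn A1_pos[OF elim] by (auto intro!: mult_left_mono divide_right_mono)
    finally show ?case
      using g_pos[OF elim] by (simp add: pos_part_def eq divide_le_eq ac_simps)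
  qed
  show ?thesis
    unfolding l_def[symmetric] by (rule tendsto_sandwich[OF lower upper lower_lim upper_lim])
qed

text \<open>\<open>(1 - e) ^ k\<close> bounds what \<open>g\<close> can lose between
  \<open>y\<close> and \<open>(1 - e) * y\<close>; it tends to 1 as \<open>e\<close> decreases to 0,
  which the case of bounded \<open>A\<close> requires.\<close>

lemma neg_part_ge:
  assumes y: "y \<ge> 0" and e: "0 < e" "e < 1" and nz: "fst p \<noteq> 0"
  shows "(1 - e) ^ k * (min (neg_log (fst p)) (e * y) - min (overshoot e y p) (e * y)) / A (1 + y)
    \<le> neg_part y p"
proof -
  define t where "t = min (max 0 (y - log_step y p)) (e * y)"
  have t: "0 \<le> t" "t \<le> e * y" "y - t \<ge> min y (log_step y p)" using y e by (auto simp: t_def)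
  have ey0: "0 \<le> e * y" using y e by simp
  have ey: "e * y \<le> y" using y e mult_right_mono[of e 1 y] by simp
  have arith: "min a w - min v w \<le> min (max 0 x) w"
    if "min a w - v \<le> max 0 x" "0 \<le> w" "0 \<le> a" "0 \<le> v" for a v w x :: real
    using that by (auto simp: min_def max_def)
  have t_ge: "min (neg_log (fst p)) (e * y) - min (overshoot e y p) (e * y) \<le> t"
    unfolding t_def using e by (intro arith descent_ge y nz ey0 overshoot_nonneg) auto
  have "g y = g (1 / (1 - e) * ((1 - e) * y))" using e by simp
  also have "\<dots> \<le> (1 / (1 - e)) ^ k * g ((1 - e) * y)"
    using e y by (intro g_scale) auto
  also have "\<dots> \<le> (1 / (1 - e)) ^ k * g (y - t)"
    using e y t ey by (intro mult_left_mono g_mono) (auto simp: algebra_simps)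
  finally have g: "(1 - e) ^ k * g y \<le> g (y - t)"
    using e by (simp add: field_simps power_divide)
  have "(1 - e) ^ k * (min (neg_log (fst p)) (e * y) - min (overshoot e y p) (e * y)) / A (1 + y)
      \<le> (1 - e) ^ k * t / A (1 + y)"
    using t_ge e A1_pos[OF y] by (intro divide_right_mono mult_left_mono) auto
  also have "\<dots> = t * (((1 - e) ^ k * g y) / A (1 + y)) / g y"
    using g_pos[OF y] by simp
  also have "\<dots> \<le> t * (g (y - t) / A (1 + y)) / g y"
    using g t A1_pos[OF y] g_pos[OF y] by (intro divide_right_mono mult_left_mono) auto
  also have "\<dots> \<le> (B y - B (y - t)) / g y"
    using B_diff_ge[of "y - t" y] t ey g_pos[OF y] y by (intro divide_right_mono) auto
  also have "\<dots> \<le> neg_part y p"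
    unfolding neg_part_def using t ey g_pos[OF y] log_step_nonneg[OF y, of p] y
    by (intro divide_right_mono diff_left_mono B_mono) auto
  finally show ?thesis .
qed

end

section \<open>Negative drift\<close>

context perpetuity
begin

lemma integrable_F_log1p:
  assumes "integrable \<mu> (\<lambda>p. F (log1p (fst p)))" "integrable \<mu> (\<lambda>p. F (log1p (snd p)))"
  shows "integrable \<mu> (\<lambda>p. F (log1p (fst p) + log1p (snd p)))"
proof (rule Bochner_Integration.integrable_bound)
  show "integrable \<mu> (\<lambda>p. 2 ^ Suc k * (F (log1p (fst p)) + F (log1p (snd p))))"
    using assms by (intro integrable_mult_right Bochner_Integration.integrable_add)
  show "(\<lambda>p. F (log1p (fst p) + log1p (snd p))) \<in> borel_measurable \<mu>"
    by (rule measurable_F) auto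
  show "AE p in \<mu>. norm (F (log1p (fst p) + log1p (snd p))) \<le> norm (2 ^ Suc k * (F (log1p (fst p)) + F (log1p (snd p))))"
    using F_add F_pos by (auto simp: abs_of_pos intro!: AE_I2 order_trans[OF _ abs_ge_self])
qed

lemma measurable_pos_part [measurable]: "pos_part y \<in> borel_measurable \<mu>"
  unfolding pos_part_def by measurable

lemma measurable_neg_part [measurable]: "neg_part y \<in> borel_measurable \<mu>"
  unfolding neg_part_def by measurable

lemma integrable_pos_part:
  assumes F: "integrable \<mu> (\<lambda>p. F (log1p (fst p) + log1p (snd p)))" and y: "y \<ge> 0"
  shows "integrable \<mu> (pos_part y)"
proof -
  obtain C where C: "\<And>y p. y \<ge> 0 \<Longrightarrow> 0 \<le> pos_part y p \<and> pos_part y p \<le> C * F (log1p (fst p) + log1p (snd p))"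
    using pos_part_bounds by blast
  show ?thesis
  proof (rule Bochner_Integration.integrable_bound)
    show "integrable \<mu> (\<lambda>p. C * F (log1p (fst p) + log1p (snd p)))" using F by simp
    show "AE p in \<mu>. norm (pos_part y p) \<le> norm (C * F (log1p (fst p) + log1p (snd p)))"
      using C[OF y] by (intro AE_I2) (auto intro: order_trans[OF _ abs_ge_self])
  qed measurable
qed

lemma integrable_neg_part:
  assumes y: "y \<ge> 0" shows "integrable \<mu> (neg_part y)"
proof (rule integrable_const_bound[where B = "B y / g y"])
  have "0 \<le> B y - B (min y (log_step y p))" "B y - B (min y (log_step y p)) \<le> B y" for p
    using B_mono[of "min y (log_step y p)" y] B_nonneg[of "min y (log_step y p)"] log_step_nonneg[OF y, of p] y by auto
  then show "AE p in \<mu>. norm (neg_part y p) \<le> B y / g y"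
    using g_pos[OF y] by (intro AE_I2) (auto simp: neg_part_def intro!: divide_right_mono)
qed measurable

lemma integrable_B_log_step:
  assumes F: "integrable \<mu> (\<lambda>p. F (log1p (fst p) + log1p (snd p)))" and y: "y \<ge> 0"
  shows "integrable \<mu> (\<lambda>p. B (log_step y p))"
    and "(\<integral>p. B (log_step y p) \<partial>\<mu>) = B y + g y * ((\<integral>p. pos_part y p \<partial>\<mu>) - (\<integral>p. neg_part y p \<partial>\<mu>))"
  using integrable_pos_part[OF F y] integrable_neg_part[OF y] y
  by (simp_all add: B_log_step prob_space)

text \<open>A positive \<open>r\<close> is the reciprocal of the mean of \<open>neg_log\<close>, and
  \<open>r = 0\<close> means that this mean is infinite. The drift is estimated differently in the
  two cases.\<close>

lemma inverse_A_tendsto: "\<exists>r\<ge>0. ((\<lambda>y. 1 / A (1 + y)) \<longlongrightarrow> r) at_top"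
proof -
  let ?f = "\<lambda>y. 1 / A (1 + y)"
  have bdd: "bdd_below (?f ` {0..})"
    by (rule bdd_belowI2[of _ 0]) (use A1_pos in \<open>auto simp: less_imp_le\<close>)
  have anti: "?f v \<le> ?f u" if "0 \<le> u" "u \<le> v" for u v
    using that A_mono[of "1 + u" "1 + v"] A1_pos[of u] by (intro divide_left_mono mult_pos_pos) auto
  define r where "r = (INF y\<in>{0..}. ?f y)"
  have "(?f \<longlongrightarrow> r) at_top"
  proof (rule decreasing_tendsto)
    show "\<forall>\<^sub>F y in at_top. r \<le> ?f y"
      using eventually_ge_at_top[of 0] by eventually_elim (auto simp: r_def intro!: cINF_lower bdd)
    fix x assume "r < x"
    then obtain u where u: "u \<ge> 0" "?f u < x"
      unfolding r_def by (subst (asm) cINF_less_iff) (auto intro!: bdd)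
    show "\<forall>\<^sub>F y in at_top. ?f y < x"
      using eventually_ge_at_top[of u] by eventually_elim (use anti u in \<open>auto intro: le_less_trans\<close>)
  qed
  moreover have "r \<ge> 0"
    unfolding r_def using A1_pos by (intro cINF_greatest) (auto simp: less_imp_le)
  ultimately show ?thesis by blast
qed

lemma integral_pos_part_tendsto:
  assumes F: "integrable \<mu> (\<lambda>p. F (log1p (fst p) + log1p (snd p)))"
    and r: "((\<lambda>y. 1 / A (1 + y)) \<longlongrightarrow> r) at_top"
  shows "integrable \<mu> (\<lambda>p. max 0 (ln \<bar>fst p\<bar>) * r)"
    and "((\<lambda>y. \<integral>p. pos_part y p \<partial>\<mu>) \<longlongrightarrow> (\<integral>p. max 0 (ln \<bar>fst p\<bar>) * r \<partial>\<mu>)) at_top"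
proof -
  obtain C where C: "\<And>y p. y \<ge> 0 \<Longrightarrow> 0 \<le> pos_part y p \<and> pos_part y p \<le> C * F (log1p (fst p) + log1p (snd p))"
    using pos_part_bounds by blast
  have 1: "integrable \<mu> (\<lambda>p. C * F (log1p (fst p) + log1p (snd p)))" using F by simp
  have 2: "\<forall>\<^sub>F y in at_top. AE p in \<mu>. norm (pos_part y p) \<le> C * F (log1p (fst p) + log1p (snd p))"
    using eventually_ge_at_top[of 0] by eventually_elim (use C in auto)
  have 3: "AE p in \<mu>. ((\<lambda>y. pos_part y p) \<longlongrightarrow> max 0 (ln \<bar>fst p\<bar>) * r) at_top"
    using M_nonzero by eventually_elim (rule pos_part_tendsto[OF r])
  show "integrable \<mu> (\<lambda>p. max 0 (ln \<bar>fst p\<bar>) * r)"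
    by (rule integrable_dominated_convergence_at_top[OF _ _ 1 3 2]) measurable
  show "((\<lambda>y. \<integral>p. pos_part y p \<partial>\<mu>) \<longlongrightarrow> (\<integral>p. max 0 (ln \<bar>fst p\<bar>) * r \<partial>\<mu>)) at_top"
    by (rule integral_dominated_convergence_at_top[OF _ _ 1 3 2]) measurable
qed

text \<open>The cap \<open>e * y\<close> keeps the majorant within the given moment: it brings in
  \<open>(1 + min l y) / A (1 + min l y)\<close>, which is at most \<open>J1 l\<close> and so of
  order \<open>F l\<close>, whereas \<open>log1p (snd p)\<close> itself need not be
  integrable.\<close>

lemma integral_overshoot_tendsto:
  assumes F: "integrable \<mu> (\<lambda>p. F (log1p (snd p)))" and e: "0 < e" "e < 1"
  shows "((\<lambda>y. \<integral>p. min (overshoot e y p) (e * y) / A (1 + y) \<partial>\<mu>) \<longlongrightarrow> 0) at_top"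
proof -
  define w where "w p = 2 ^ Suc k * (F 1 + F (log1p (snd p))) / g 0" for p :: "real \<times> real"
  have 1: "integrable \<mu> w"
    unfolding w_def using F by auto
  have bound: "\<bar>min (overshoot e y p) (e * y) / A (1 + y)\<bar> \<le> w p" if y: "y \<ge> 0" for y p
  proof -
    define l where "l = 1 + log1p (snd p)"
    have l: "l \<ge> 0" by (auto simp: l_def intro: add_nonneg_nonneg)
    have o: "0 \<le> overshoot e y p" "overshoot e y p \<le> l"
      using overshoot_nonneg overshoot_le[of e y p] e y by (auto simp: l_def)
    have ey: "0 \<le> e * y" "e * y \<le> y" using y e mult_right_mono[of e 1 y] by auto
    have "\<bar>min (overshoot e y p) (e * y) / A (1 + y)\<bar> = min (overshoot e y p) (e * y) / A (1 + y)"
      using o ey A1_pos[OF y] by (intro abs_of_nonneg divide_nonneg_pos) auto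
    also have "\<dots> \<le> (1 + min l y) / A (1 + y)"
      using o ey A1_pos[OF y] by (intro divide_right_mono) (auto simp: min_def)
    also have "\<dots> \<le> (1 + min l y) / A (1 + min l y)"
      using l y A1_pos[of "min l y"] A_mono[of "1 + min l y" "1 + y"]
      by (intro divide_left_mono) auto
    also have "\<dots> \<le> J1 l"
      using J1_mono[of "min l y" l] l y by (simp add: J1_def)
    also have "\<dots> \<le> F l / g 0"
      using J1_le_F[OF l] g_pos[of 0] by (simp add: le_divide_eq mult.commute)
    also have "\<dots> \<le> w p"
      unfolding w_def l_def using F_add[of 1 "log1p (snd p)"] g_pos[of 0]
      by (intro divide_right_mono) auto
    finally show ?thesis .
  qed
  have 2: "\<forall>\<^sub>F y in at_top. AE p in \<mu>. norm (min (overshoot e y p) (e * y) / A (1 + y)) \<le> w p"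
    using eventually_ge_at_top[of 0] by eventually_elim (use bound in \<open>simp only: real_norm_def, simp\<close>)
  have 3: "((\<lambda>y. min (overshoot e y p) (e * y) / A (1 + y)) \<longlongrightarrow> 0) at_top" for p
  proof (rule Lim_null_comparison)
    have "((\<lambda>y. overshoot e y p / A 1) \<longlongrightarrow> 0 / A 1) at_top"
      using e A_pos[of 1] by (intro tendsto_divide overshoot_tendsto tendsto_const) auto
    then show "((\<lambda>y. overshoot e y p / A 1) \<longlongrightarrow> 0) at_top" by simp
    show "\<forall>\<^sub>F y in at_top. norm (min (overshoot e y p) (e * y) / A (1 + y)) \<le> overshoot e y p / A 1"
      using eventually_ge_at_top[of 0]
    proof eventually_elim
      case (elim y)
      have "0 \<le> e * y" using e elim by simp
      then have "norm (min (overshoot e y p) (e * y) / A (1 + y)) = min (overshoot e y p) (e * y) / A (1 + y)"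
        using overshoot_nonneg[of e y p] A1_pos[OF elim]
        by (auto intro!: divide_nonneg_pos simp: min_def)
      also have "\<dots> \<le> overshoot e y p / A 1"
        using overshoot_nonneg[of e y p] A_pos[of 1] A_mono[of 1 "1 + y"] elim
        by (intro frac_le) auto
      finally show ?case .
    qed
  qed
  have "((\<lambda>y. \<integral>p. min (overshoot e y p) (e * y) / A (1 + y) \<partial>\<mu>) \<longlongrightarrow> (\<integral>p. 0 \<partial>\<mu>)) at_top"
    by (rule integral_dominated_convergence_at_top[OF _ _ 1 _ 2]) (use 3 in auto)
  then show ?thesis by simp
qed

lemma integral_neg_part_ge:
  assumes y: "y \<ge> 0" and e: "0 < e" "e < 1"
  shows "(1 - e) ^ k * (A (e * y) / A (1 + y)) -
      (1 - e) ^ k * (\<integral>p. min (overshoot e y p) (e * y) / A (1 + y) \<partial>\<mu>) \<le> (\<integral>p. neg_part y p \<partial>\<mu>)"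
proof -
  have ey: "0 \<le> e * y" using e y by simp
  have int1: "integrable \<mu> (\<lambda>p. min (neg_log (fst p)) (e * y))"
    by (rule integrable_const_bound[where B = "e * y"]) (use ey in \<open>auto simp: min_def\<close>)
  have int2: "integrable \<mu> (\<lambda>p. min (overshoot e y p) (e * y))"
    by (rule integrable_const_bound[where B = "e * y"]) (use ey overshoot_nonneg[of e y] in \<open>auto simp: min_def\<close>)
  let ?f = "\<lambda>p. (1 - e) ^ k * (min (neg_log (fst p)) (e * y) - min (overshoot e y p) (e * y)) / A (1 + y)"
  have "(\<integral>p. ?f p \<partial>\<mu>) \<le> (\<integral>p. neg_part y p \<partial>\<mu>)"
  proof (rule integral_mono_AE)
    show "AE p in \<mu>. ?f p \<le> neg_part y p"
      using M_nonzero by eventually_elim (rule neg_part_ge[OF y e])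
  qed (use int1 int2 integrable_neg_part[OF y] in auto)
  also have "(\<integral>p. ?f p \<partial>\<mu>) = (1 - e) ^ k * (A (e * y) - (\<integral>p. min (overshoot e y p) (e * y) \<partial>\<mu>)) / A (1 + y)"
    using int1 int2 by (simp add: trunc_mean_def)
  finally show ?thesis by (simp add: algebra_simps diff_divide_distrib)
qed

text \<open>Upward jumps contribute \<open>\<rho>\<close> in the limit, so \<open>e\<close> is
  sought for which the downward contribution eventually exceeds some \<open>s > \<rho>\<close>. If
  \<open>neg_log\<close> has infinite mean, then \<open>\<rho> = 0\<close> and any positive lower
  bound will do. Otherwise \<open>A (e * y) / A (1 + y)\<close> tends to 1, and
  \<open>\<rho> < 1\<close> is the negativity of the mean of the logarithm, so a small
  \<open>e\<close> suffices.\<close>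

lemma drift_eventually:
  assumes FM: "integrable \<mu> (\<lambda>p. F (log1p (fst p)))" and FQ: "integrable \<mu> (\<lambda>p. F (log1p (snd p)))"
    and mean: "integrable \<mu> (\<lambda>p. neg_log (fst p)) \<Longrightarrow> integrable \<mu> (\<lambda>p. ln \<bar>fst p\<bar>) \<Longrightarrow>
      (\<integral>p. ln \<bar>fst p\<bar> \<partial>\<mu>) < 0"
  shows "\<exists>c>0. \<forall>\<^sub>F y in at_top. (\<integral>p. pos_part y p \<partial>\<mu>) - (\<integral>p. neg_part y p \<partial>\<mu>) \<le> - c"
proof -
  note F = integrable_F_log1p[OF FM FQ]
  obtain r where r: "r \<ge> 0" "((\<lambda>y. 1 / A (1 + y)) \<longlongrightarrow> r) at_top" using inverse_A_tendsto by auto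
  note pos = integral_pos_part_tendsto[OF F r(2)]
  define \<rho> where "\<rho> = (\<integral>p. max 0 (ln \<bar>fst p\<bar>) * r \<partial>\<mu>)"
  have "\<exists>e s. 0 < e \<and> e < 1 \<and> \<rho> < s \<and>
    (\<forall>\<^sub>F y in at_top. s \<le> (1 - e) ^ k * (A (e * y) / A (1 + y)))"
  proof (cases "r = 0")
    case True
    \<comment> \<open>By \<open>A_scale\<close>, passing from \<open>1 + y\<close> to
      \<open>y / 2\<close> costs the factor \<open>2 * (1 + y) / y\<close>, at most 4 for
      \<open>y \<ge> 1\<close>.\<close>
    have "(1 / 2) ^ k / 4 \<le> (1 - 1 / 2) ^ k * (A (1 / 2 * y) / A (1 + y))" if "y \<ge> 1" for y
    proof -
      have "y / 2 * A (1 + y) \<le> (1 + y) * A (y / 2)" using that A_scale[of "y / 2" "1 + y"] by simp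
      moreover have "(1 + y) * A (y / 2) \<le> 2 * y * A (y / 2)"
        using that A_pos[of "y / 2"] by (intro mult_right_mono) auto
      ultimately have "y * A (1 + y) \<le> y * (4 * A (y / 2))" by simp
      then have "A (1 + y) \<le> 4 * A (y / 2)" using that by simp
      then have "1 / 4 \<le> A (1 / 2 * y) / A (1 + y)" using A1_pos[of y] that by (simp add: le_divide_eq)
      then have "(1 / 2) ^ k * (1 / 4) \<le> (1 / 2) ^ k * (A (1 / 2 * y) / A (1 + y))"
        by (intro mult_left_mono) auto
      then show ?thesis by simp
    qed
    then have "\<forall>\<^sub>F y in at_top. (1 / 2) ^ k / 4 \<le> (1 - 1 / 2) ^ k * (A (1 / 2 * y) / A (1 + y))"
      by (intro eventually_mono[OF eventually_ge_at_top[of 1]])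
    moreover have "\<rho> = 0" using True by (simp add: \<rho>_def)
    ultimately show ?thesis by (intro exI[of _ "1/2"] exI[of _ "(1 / 2) ^ k / 4"]) auto
  next
    case False
    with r have r0: "r > 0" by simp
    have "((\<lambda>y. inverse (1 / A (1 + y))) \<longlongrightarrow> inverse r) at_top"
      using r(2) r0 by (intro tendsto_inverse) auto
    then have A1: "((\<lambda>y. A (1 + y)) \<longlongrightarrow> 1 / r) at_top" by (simp add: inverse_eq_divide)
    have "filterlim (\<lambda>x. x + (- 1)) at_top (at_top :: real filter)"
      by (rule filterlim_tendsto_add_at_top[OF tendsto_const filterlim_ident, of "-1", simplified add.commute])
    from filterlim_compose[OF A1 this] have A2: "(A \<longlongrightarrow> 1 / r) at_top" by simp
    \<comment> \<open>The truncated means converge to \<open>1 / r\<close>; monotone convergence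
      makes \<open>neg_log\<close> integrable with this mean.\<close>
    have "integrable \<mu> (\<lambda>p. neg_log (fst p)) \<and> (\<integral>p. neg_log (fst p) \<partial>\<mu>) = 1 / r"
    proof -
      have lim: "(\<lambda>n. \<integral>p. min (neg_log (fst p)) (real n) \<partial>\<mu>) \<longlonglongrightarrow> 1 / r"
        using filterlim_compose[OF A2 filterlim_real_sequentially] by (simp add: trunc_mean_def)
      have ptw: "(\<lambda>n. min (neg_log (fst p)) (real n)) \<longlonglongrightarrow> neg_log (fst p)" for p :: "real \<times> real"
      proof (rule tendsto_eventually)
        show "\<forall>\<^sub>F n in sequentially. min (neg_log (fst p)) (real n) = neg_log (fst p)"
          using filterlim_real_sequentially[unfolded filterlim_at_top, rule_format, of "neg_log (fst p)"]
          by eventually_elim simp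
      qed
      have int: "integrable \<mu> (\<lambda>p. min (neg_log (fst p)) (real n))" for n
        by (rule integrable_const_bound[where B = "real n"]) (auto simp: min_def)
      have mono: "mono (\<lambda>n. min (neg_log (fst p)) (real n))" for p :: "real \<times> real"
        by (auto simp: mono_def)
      show ?thesis
        using integral_monotone_convergence_nonneg[OF int _ _ _ lim, of "\<lambda>p. neg_log (fst p)"] ptw mono
        by simp
    qed
    moreover have intp: "integrable \<mu> (\<lambda>p. max 0 (ln \<bar>fst p\<bar>))"
      using integrable_mult_left[OF pos(1), of "1 / r"] r0 by simp
    moreover have "ln \<bar>fst p\<bar> = max 0 (ln \<bar>fst p\<bar>) - neg_log (fst p)" for p :: "real \<times> real"
      by (auto simp: neg_log_def max_def)
    ultimately have "(\<integral>p. max 0 (ln \<bar>fst p\<bar>) \<partial>\<mu>) - 1 / r < 0"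
      using mean by (metis (no_types, lifting) Bochner_Integration.integrable_cong
        Bochner_Integration.integrable_diff Bochner_Integration.integral_cong Bochner_Integration.integral_diff)
    then have "\<rho> < 1" using r0 by (simp add: \<rho>_def field_simps)
    have "\<rho> \<ge> 0" unfolding \<rho>_def using r(1) by (intro Bochner_Integration.integral_nonneg) auto
    \<comment> \<open>Chosen so that \<open>k * e \<le> (1 - \<rho>) / 2\<close>; Bernoulli's
      inequality then gives \<open>(1 - e) ^ k \<ge> (1 + \<rho>) / 2 > \<rho>\<close>.\<close>
    define e where "e = (1 - \<rho>) / (2 * (real k + 1))"
    have e: "0 < e" "e < 1" using \<open>\<rho> < 1\<close> \<open>\<rho> \<ge> 0\<close> by (auto simp: e_def divide_less_eq)
    have "\<rho> < (1 - e) ^ k"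
    proof -
      have "real k * e \<le> (1 - \<rho>) / 2" using \<open>\<rho> < 1\<close> by (simp add: e_def field_simps)
      moreover have "1 + real k * (- e) \<le> (1 + (- e)) ^ k" using e by (intro Bernoulli_inequality) auto
      ultimately show ?thesis using \<open>\<rho> < 1\<close> by (simp add: field_simps)
    qed
    then obtain s where s: "\<rho> < s" "s < (1 - e) ^ k" using dense by blast
    have "filterlim (\<lambda>y. e * y) at_top at_top"
      using e by (intro filterlim_tendsto_pos_mult_at_top[OF tendsto_const _ filterlim_ident]) auto
    from filterlim_compose[OF A2 this]
    have "((\<lambda>y. (1 - e) ^ k * (A (e * y) * (1 / A (1 + y)))) \<longlongrightarrow> (1 - e) ^ k * (1 / r * r)) at_top"
      by (intro tendsto_mult tendsto_const r(2))
    then have "((\<lambda>y. (1 - e) ^ k * (A (e * y) / A (1 + y))) \<longlongrightarrow> (1 - e) ^ k) at_top"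
      using r0 by simp
    from order_tendstoD(1)[OF this s(2)]
    have "\<forall>\<^sub>F y in at_top. s \<le> (1 - e) ^ k * (A (e * y) / A (1 + y))"
      by (auto elim: eventually_mono)
    then show ?thesis using e s by blast
  qed
  then obtain e s where e: "0 < e" "e < 1" and s: "\<rho> < s"
    and ev: "\<forall>\<^sub>F y in at_top. s \<le> (1 - e) ^ k * (A (e * y) / A (1 + y))" by blast
  \<comment> \<open>One half of the gap absorbs the vanishing overshoot term, the other remains as
    the drift.\<close>
  define c where "c = (s - \<rho>) / 2"
  have "((\<lambda>y. (\<integral>p. pos_part y p \<partial>\<mu>) + (1 - e) ^ k * (\<integral>p. min (overshoot e y p) (e * y) / A (1 + y) \<partial>\<mu>))
      \<longlongrightarrow> \<rho> + (1 - e) ^ k * 0) at_top"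
    unfolding \<rho>_def by (intro tendsto_add tendsto_mult tendsto_const pos(2) integral_overshoot_tendsto FQ e)
  then have "\<forall>\<^sub>F y in at_top. (\<integral>p. pos_part y p \<partial>\<mu>) +
      (1 - e) ^ k * (\<integral>p. min (overshoot e y p) (e * y) / A (1 + y) \<partial>\<mu>) < \<rho> + c"
    by (rule order_tendstoD(2)) (use s in \<open>simp add: c_def\<close>)
  with ev eventually_ge_at_top[of 0]
  have "\<forall>\<^sub>F y in at_top. (\<integral>p. pos_part y p \<partial>\<mu>) - (\<integral>p. neg_part y p \<partial>\<mu>) \<le> - c"
  proof eventually_elim
    case (elim y)
    then show ?case using integral_neg_part_ge[OF elim(2) e] by (simp add: c_def field_simps)
  qed
  moreover have "c > 0" using s by (simp add: c_def)
  ultimately show ?thesis by blast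
qed

lemma log_step_mono: "0 \<le> y \<Longrightarrow> y \<le> y' \<Longrightarrow> log_step y p \<le> log_step y' p"
  unfolding log_step_def by (intro ln_mono add_left_mono mult_left_mono) (auto intro!: add_pos_nonneg)

lemma drift:
  assumes FM: "integrable \<mu> (\<lambda>p. F (log1p (fst p)))" and FQ: "integrable \<mu> (\<lambda>p. F (log1p (snd p)))"
    and mean: "integrable \<mu> (\<lambda>p. neg_log (fst p)) \<Longrightarrow> integrable \<mu> (\<lambda>p. ln \<bar>fst p\<bar>) \<Longrightarrow>
      (\<integral>p. ln \<bar>fst p\<bar> \<partial>\<mu>) < 0"
  shows "\<exists>c>0. \<exists>C. \<forall>y\<ge>0. integrable \<mu> (\<lambda>p. B (log_step y p)) \<and> (\<integral>p. B (log_step y p) \<partial>\<mu>) + c * g y \<le> B y + C"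
proof -
  note F = integrable_F_log1p[OF FM FQ]
  obtain c where c: "c > 0"
    "\<forall>\<^sub>F y in at_top. (\<integral>p. pos_part y p \<partial>\<mu>) - (\<integral>p. neg_part y p \<partial>\<mu>) \<le> - c"
    using drift_eventually[OF assms] by auto
  obtain y1 where y1: "\<And>y. y \<ge> y1 \<Longrightarrow> (\<integral>p. pos_part y p \<partial>\<mu>) - (\<integral>p. neg_part y p \<partial>\<mu>) \<le> - c"
    using c(2) by (auto simp: eventually_at_top_linorder)
  define y2 where "y2 = max 0 y1"
  \<comment> \<open>A step from a lower height ends no higher, so the mean at \<open>y2\<close>
    bounds the means at all heights below \<open>y2\<close>.\<close>
  define C where "C = (\<integral>p. B (log_step y2 p) \<partial>\<mu>) + c * g y2"
  have "C \<ge> 0"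
    unfolding C_def using c(1) g_pos[of y2] log_step_nonneg[of y2] B_nonneg
    by (intro add_nonneg_nonneg Bochner_Integration.integral_nonneg) (auto simp: y2_def)
  have "(\<integral>p. B (log_step y p) \<partial>\<mu>) + c * g y \<le> B y + C" if y: "y \<ge> 0" for y
  proof (cases "y \<ge> y2")
    case True
    then have "g y * ((\<integral>p. pos_part y p \<partial>\<mu>) - (\<integral>p. neg_part y p \<partial>\<mu>)) \<le> g y * (- c)"
      using g_pos[OF y] by (intro mult_left_mono y1) (auto simp: y2_def)
    then show ?thesis using integrable_B_log_step(2)[OF F y] \<open>C \<ge> 0\<close> by (simp add: mult.commute)
  next
    case False
    have "(\<integral>p. B (log_step y p) \<partial>\<mu>) \<le> (\<integral>p. B (log_step y2 p) \<partial>\<mu>)"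
      using False y by (intro Bochner_Integration.integral_mono integrable_B_log_step F B_mono log_step_mono log_step_nonneg) auto
    moreover have "c * g y \<le> c * g y2" using False y c(1) g_mono by simp
    ultimately show ?thesis using B_nonneg[OF y] by (simp add: C_def)
  qed
  then show ?thesis using c(1) integrable_B_log_step(1)[OF F] by blast
qed

end

section \<open>Independent copies and the associated random walk\<close>

locale pair_sequence = prob_space \<mu> for \<mu> :: "(real \<times> real) measure" +
  assumes sets_pair [measurable_cong]: "sets \<mu> = sets (borel \<Otimes>\<^sub>M borel)"
begin

sublocale seq: sequence_space \<mu> ..

abbreviation S where "S \<equiv> seq.S"

sublocale pS: pair_prob_space \<mu> S ..

lemma space_mu [simp]: "space \<mu> = UNIV"
  using sets_eq_imp_space_eq[OF sets_pair] by (simp add: space_pair_measure)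

lemma space_S [simp]: "space S = UNIV"
  by (simp add: space_PiM)

lemma measurable_cons [measurable]: "(\<lambda>(p, X). case_nat p X) \<in> \<mu> \<Otimes>\<^sub>M S \<rightarrow>\<^sub>M S"
  by measurable

text \<open>Prepending an independent pair does not change the law \<open>S\<close>. Every recursion
  in law is this fact combined with a pointwise formula for \<open>case_nat p X\<close>.\<close>

lemma nn_integral_cons:
  assumes [measurable]: "f \<in> borel_measurable S"
  shows "(\<integral>\<^sup>+X. f X \<partial>S) = (\<integral>\<^sup>+z. f (case_nat (fst z) (snd z)) \<partial>(\<mu> \<Otimes>\<^sub>M S))"
proof -
  have "(\<integral>\<^sup>+X. f X \<partial>S) = (\<integral>\<^sup>+X. f X \<partial>distr (\<mu> \<Otimes>\<^sub>M S) S (\<lambda>(p, X). case_nat p X))"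
    by (simp add: seq.PiM_iter)
  also have "\<dots> = (\<integral>\<^sup>+z. f (case z of (p, X) \<Rightarrow> case_nat p X) \<partial>(\<mu> \<Otimes>\<^sub>M S))"
    by (rule nn_integral_distr) measurable
  finally show ?thesis by (simp add: case_prod_beta)
qed

lemma integral_cons:
  fixes f :: "(nat \<Rightarrow> real \<times> real) \<Rightarrow> real"
  assumes [measurable]: "f \<in> borel_measurable S"
  shows "(\<integral>X. f X \<partial>S) = (\<integral>z. f (case_nat (fst z) (snd z)) \<partial>(\<mu> \<Otimes>\<^sub>M S))"
proof -
  have "(\<integral>X. f X \<partial>S) = (\<integral>X. f X \<partial>distr (\<mu> \<Otimes>\<^sub>M S) S (\<lambda>(p, X). case_nat p X))"
    by (simp add: seq.PiM_iter)
  also have "\<dots> = (\<integral>z. f (case z of (p, X) \<Rightarrow> case_nat p X) \<partial>(\<mu> \<Otimes>\<^sub>M S))"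
    by (rule integral_distr) measurable
  finally show ?thesis by (simp add: case_prod_beta)
qed

lemma AE_cons:
  assumes [measurable]: "Measurable.pred S P"
  shows "(AE X in S. P X) \<longleftrightarrow> (AE z in \<mu> \<Otimes>\<^sub>M S. P (case_nat (fst z) (snd z)))"
proof -
  have "(AE X in S. P X) \<longleftrightarrow> (AE X in distr (\<mu> \<Otimes>\<^sub>M S) S (\<lambda>(p, X). case_nat p X). P X)"
    by (simp only: seq.PiM_iter)
  also have "\<dots> \<longleftrightarrow> (AE z in \<mu> \<Otimes>\<^sub>M S. P (case z of (p, X) \<Rightarrow> case_nat p X))"
    by (rule AE_distr_iff) measurable
  finally show ?thesis by (simp add: case_prod_beta)
qed

lemma distr_snd: "distr (\<mu> \<Otimes>\<^sub>M S) S snd = S"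
proof (rule measure_eqI)
  fix E assume "E \<in> sets (distr (\<mu> \<Otimes>\<^sub>M S) S snd)"
  then have E: "E \<in> sets S" by simp
  have "snd -` E \<inter> space (\<mu> \<Otimes>\<^sub>M S) = space \<mu> \<times> E"
    by (auto simp: space_pair_measure)
  then show "emeasure (distr (\<mu> \<Otimes>\<^sub>M S) S snd) E = emeasure S E"
    using E emeasure_space_1 by (simp add: emeasure_distr seq.P.emeasure_pair_measure_Times del: space_mu)
qed simp

lemma distr_fst: "distr (\<mu> \<Otimes>\<^sub>M S) \<mu> fst = \<mu>"
proof (rule measure_eqI)
  fix E assume "E \<in> sets (distr (\<mu> \<Otimes>\<^sub>M S) \<mu> fst)"
  then have E: "E \<in> sets \<mu>" by simp
  have "fst -` E \<inter> space (\<mu> \<Otimes>\<^sub>M S) = E \<times> space S"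
    by (auto simp: space_pair_measure)
  then show "emeasure (distr (\<mu> \<Otimes>\<^sub>M S) \<mu> fst) E = emeasure \<mu> E"
    using E seq.P.emeasure_space_1 by (simp add: emeasure_distr seq.P.emeasure_pair_measure_Times del: space_S)
qed simp

lemma AE_snd:
  assumes "AE X in S. P X" shows "AE z in \<mu> \<Otimes>\<^sub>M S. P (snd z)"
proof -
  have "AE X in distr (\<mu> \<Otimes>\<^sub>M S) S snd. P X" using assms by (simp only: distr_snd)
  then show ?thesis by (rule AE_distrD[rotated]) measurable
qed

lemma AE_fst:
  assumes "AE p in \<mu>. P p" shows "AE z in \<mu> \<Otimes>\<^sub>M S. P (fst z)"
proof -
  have "AE X in distr (\<mu> \<Otimes>\<^sub>M S) \<mu> fst. P X" using assms by (simp only: distr_fst)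
  then show ?thesis by (rule AE_distrD[rotated]) measurable
qed

lemma measurable_shift [measurable]: "(\<lambda>X n. X (n + k)) \<in> S \<rightarrow>\<^sub>M S"
  by (rule measurable_PiM_single') auto

lemma AE_shift:
  assumes "AE X in S. P X" and [measurable]: "Measurable.pred S P"
  shows "AE X in S. \<forall>k. P (\<lambda>n. X (n + k))"
proof -
  have "AE X in S. P (\<lambda>n. X (n + k))" for k
  proof (induction k)
    case (Suc k)
    then have "AE z in \<mu> \<Otimes>\<^sub>M S. P (\<lambda>n. snd z (n + k))" by (rule AE_snd)
    then have "AE z in \<mu> \<Otimes>\<^sub>M S. P (\<lambda>n. case_nat (fst z) (snd z) (n + Suc k))" by simp
    moreover have "Measurable.pred S (\<lambda>X. P (\<lambda>n. X (n + Suc k)))"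
      by (rule measurable_compose[OF measurable_shift assms(2)])
    ultimately show ?case by (subst AE_cons)
  qed (use assms in simp)
  then show ?thesis by (simp add: AE_all_countable)
qed

lemma AE_all:
  assumes "AE p in \<mu>. P p" and [measurable]: "Measurable.pred \<mu> P"
  shows "AE X in S. \<forall>k. P (X k)"
proof -
  have "AE z in \<mu> \<Otimes>\<^sub>M S. P (case_nat (fst z) (snd z) 0)" using AE_fst[OF assms(1)] by simp
  then have "AE X in S. P (X 0)" by (subst AE_cons) (simp_all, measurable)
  from AE_shift[OF this] show ?thesis by simp
qed

section \<open>The random walk of the log multipliers and its supremum\<close>

definition walk :: "(nat \<Rightarrow> real \<times> real) \<Rightarrow> nat \<Rightarrow> real" where
  "walk X n = (\<Sum>k<n. ln \<bar>fst (X k)\<bar>)"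

text \<open>Taken in \<open>ennreal\<close>, the supremum is measurable without any boundedness.
  Cutting at 0 loses nothing, since the walk starts at 0; an infinite supremum becomes 0, so
  comparisons with the walk assume it bounded above.\<close>

definition sup_walk :: "(nat \<Rightarrow> real \<times> real) \<Rightarrow> real" where
  "sup_walk X = enn2real (SUP n. ennreal (walk X n))"

lemma walk_0 [simp]: "walk X 0 = 0"
  by (simp add: walk_def)

lemma walk_cons: "walk (case_nat p X) (Suc n) = ln \<bar>fst p\<bar> + walk X n"
  unfolding walk_def by (subst sum.lessThan_Suc_shift) simp

lemma walk_shift: "walk (\<lambda>n. X (n + k)) n = walk X (n + k) - walk X k"
  by (induction n) (simp_all add: walk_def)

lemma measurable_walk [measurable]: "(\<lambda>X. walk X n) \<in> borel_measurable S"
  unfolding walk_def by measurable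

lemma measurable_sup_walk [measurable]: "sup_walk \<in> borel_measurable S"
  unfolding sup_walk_def by measurable

lemma sup_walk_nonneg: "sup_walk X \<ge> 0"
  by (simp add: sup_walk_def)

lemma walk_le_sup_walk:
  assumes "bdd_above (range (walk X))" shows "walk X n \<le> sup_walk X"
proof -
  obtain c where c: "\<And>n. walk X n \<le> c" using assms by (auto simp: bdd_above_def)
  have "(SUP n. ennreal (walk X n)) \<le> ennreal c" by (rule SUP_least) (rule ennreal_leI[OF c])
  then have "(SUP n. ennreal (walk X n)) < \<infinity>" by (rule le_less_trans) simp
  then have "ennreal (walk X n) \<le> ennreal (sup_walk X)"
    unfolding sup_walk_def by (subst ennreal_enn2real) (auto intro: SUP_upper)
  then show ?thesis by (simp add: ennreal_le_iff[OF sup_walk_nonneg])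
qed

lemma sup_walk_le:
  assumes "\<And>n. walk X n \<le> c" shows "sup_walk X \<le> c"
proof -
  have "c \<ge> 0" using assms[of 0] by simp
  have "(SUP n. ennreal (walk X n)) \<le> ennreal c" by (rule SUP_least) (rule ennreal_leI[OF assms])
  then show ?thesis unfolding sup_walk_def using \<open>c \<ge> 0\<close> by (rule enn2real_leI[rotated])
qed

text \<open>Lindley's recursion: the extended walk consists of its starting value 0 and of the old
  walk shifted by the new first step.\<close>

lemma sup_walk_cons:
  assumes "bdd_above (range (walk X))"
  shows "sup_walk (case_nat p X) = max 0 (ln \<bar>fst p\<bar> + sup_walk X)"
proof (rule antisym)
  show le: "sup_walk (case_nat p X) \<le> max 0 (ln \<bar>fst p\<bar> + sup_walk X)"
  proof (rule sup_walk_le)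
    fix n show "walk (case_nat p X) n \<le> max 0 (ln \<bar>fst p\<bar> + sup_walk X)"
      using walk_le_sup_walk[OF assms] by (cases n) (auto simp: walk_cons le_max_iff_disj)
  qed
  have "bdd_above (range (walk (case_nat p X)))"
  proof (rule bdd_aboveI2)
    fix n show "walk (case_nat p X) n \<le> max 0 (ln \<bar>fst p\<bar> + sup_walk X)"
      using walk_le_sup_walk[OF assms] by (cases n) (auto simp: walk_cons le_max_iff_disj)
  qed
  from walk_le_sup_walk[OF this, of "Suc n" for n]
  have "walk X n \<le> sup_walk (case_nat p X) - ln \<bar>fst p\<bar>" for n
    by (simp add: walk_cons algebra_simps)
  then have "sup_walk X \<le> sup_walk (case_nat p X) - ln \<bar>fst p\<bar>" by (rule sup_walk_le)
  then show "max 0 (ln \<bar>fst p\<bar> + sup_walk X) \<le> sup_walk (case_nat p X)"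
    using sup_walk_nonneg by simp
qed

text \<open>That the supremum is attained matters in \<open>negative_mean\<close>, where a first
  step of at least minus the supremum has to yield an actual return time.\<close>

lemma walk_attains_max:
  assumes "filterlim (walk X) at_bot sequentially"
  shows "\<exists>m. \<forall>n. walk X n \<le> walk X m"
proof -
  obtain N where N: "\<And>n. n \<ge> N \<Longrightarrow> walk X n \<le> 0"
    using assms by (auto simp: filterlim_at_bot eventually_sequentially)
  have "Max (walk X ` {..N}) \<in> walk X ` {..N}" by (rule Max_in) auto
  then obtain m where m: "Max (walk X ` {..N}) = walk X m" by blast
  have le: "walk X n \<le> walk X m" if "n \<le> N" for n
    unfolding m[symmetric] using that by (intro Max_ge) auto
  have "walk X n \<le> walk X m" for n
    using le[of n] le[of 0] N[of n] by (cases "n \<le> N") auto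
  then show ?thesis by blast
qed

text \<open>The supremum \<open>W\<close> of the walk satisfies \<open>W = max 0 (\<xi> + W')\<close> in law, hence
  \<open>max \<xi> (-W')\<close> has mean zero. A nonnegative mean of \<open>\<xi>\<close> would force \<open>\<xi> \<ge> -W'\<close>, so that the walk
  would return above its current position infinitely often.\<close>
lemma negative_mean:
  assumes int: "integrable \<mu> (\<lambda>p. ln \<bar>fst p\<bar>)"
    and lim: "AE X in S. filterlim (walk X) at_bot sequentially"
  shows "(\<integral>p. ln \<bar>fst p\<bar> \<partial>\<mu>) < 0"
proof (rule ccontr)
  assume nonneg: "\<not> ?thesis"
  define \<xi> :: "(real \<times> real) \<times> (nat \<Rightarrow> real \<times> real) \<Rightarrow> real" where "\<xi> z = ln \<bar>fst (fst z)\<bar>" for z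
  have [measurable]: "\<xi> \<in> borel_measurable (\<mu> \<Otimes>\<^sub>M S)" unfolding \<xi>_def by measurable
  have int\<xi>: "integrable (\<mu> \<Otimes>\<^sub>M S) \<xi>" and E\<xi>: "(\<integral>z. \<xi> z \<partial>(\<mu> \<Otimes>\<^sub>M S)) = (\<integral>p. ln \<bar>fst p\<bar> \<partial>\<mu>)"
  proof -
    show "integrable (\<mu> \<Otimes>\<^sub>M S) \<xi>"
      using int unfolding \<xi>_def by (subst (asm) distr_fst[symmetric]) (auto simp: integrable_distr_eq)
    have "(\<integral>p. ln \<bar>fst p\<bar> \<partial>\<mu>) = (\<integral>p. ln \<bar>fst p\<bar> \<partial>distr (\<mu> \<Otimes>\<^sub>M S) \<mu> fst)" by (simp add: distr_fst)
    also have "\<dots> = (\<integral>z. \<xi> z \<partial>(\<mu> \<Otimes>\<^sub>M S))"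
      unfolding \<xi>_def by (subst integral_distr) auto
    finally show "(\<integral>z. \<xi> z \<partial>(\<mu> \<Otimes>\<^sub>M S)) = (\<integral>p. ln \<bar>fst p\<bar> \<partial>\<mu>)" by simp
  qed
  have limz: "AE z in \<mu> \<Otimes>\<^sub>M S. filterlim (walk (snd z)) at_bot sequentially"
    by (rule AE_snd[OF lim])
  \<comment> \<open>The supremum may have infinite mean, so its invariance in law is used after
    truncation at \<open>K\<close>: the differences then have mean exactly 0 and are dominated by
    \<open>\<bar>\<xi> z\<bar>\<close>.\<close>
  define D where "D K z = min (sup_walk (case_nat (fst z) (snd z))) K - min (sup_walk (snd z)) K"
    for K :: real and z
  have [measurable]: "D K \<in> borel_measurable (\<mu> \<Otimes>\<^sub>M S)" for K
    unfolding D_def by measurable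
  have recur: "AE z in \<mu> \<Otimes>\<^sub>M S. sup_walk (case_nat (fst z) (snd z)) = max 0 (\<xi> z + sup_walk (snd z))"
    using limz
  proof eventually_elim
    case (elim z)
    from walk_attains_max[OF this] show ?case
      unfolding \<xi>_def by (intro sup_walk_cons) (auto simp: bdd_above_def)
  qed
  have int_min: "integrable M (\<lambda>z. min (sup_walk (f z)) K)"
    if "prob_space M" "K \<ge> 0" and [measurable]: "f \<in> M \<rightarrow>\<^sub>M S" for M :: "'b measure" and f and K :: real
  proof -
    interpret M: prob_space M by fact
    show ?thesis
      by (rule M.integrable_const_bound[where B = K])
         (use sup_walk_nonneg \<open>K \<ge> 0\<close> in \<open>auto simp: min_def\<close>)
  qed
  have ED: "(\<integral>z. D K z \<partial>(\<mu> \<Otimes>\<^sub>M S)) = 0" if K: "K \<ge> 0" for K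
  proof -
    have "(\<integral>z. D K z \<partial>(\<mu> \<Otimes>\<^sub>M S)) =
        (\<integral>z. min (sup_walk (case_nat (fst z) (snd z))) K \<partial>(\<mu> \<Otimes>\<^sub>M S)) -
        (\<integral>z. min (sup_walk (snd z)) K \<partial>(\<mu> \<Otimes>\<^sub>M S))"
      unfolding D_def by (intro Bochner_Integration.integral_diff int_min K pS.prob_space_axioms) measurable
    also have "(\<integral>z. min (sup_walk (case_nat (fst z) (snd z))) K \<partial>(\<mu> \<Otimes>\<^sub>M S)) = (\<integral>X. min (sup_walk X) K \<partial>S)"
      by (rule integral_cons[symmetric]) measurable
    also have "(\<integral>z. min (sup_walk (snd z)) K \<partial>(\<mu> \<Otimes>\<^sub>M S)) =
        (\<integral>X. min (sup_walk X) K \<partial>distr (\<mu> \<Otimes>\<^sub>M S) S snd)"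
      by (rule integral_distr[symmetric]) measurable
    finally show ?thesis by (simp add: distr_snd)
  qed
  define \<zeta> where "\<zeta> z = max (\<xi> z) (- sup_walk (snd z))" for z
  have [measurable]: "\<zeta> \<in> borel_measurable (\<mu> \<Otimes>\<^sub>M S)" unfolding \<zeta>_def by measurable
  have ptw: "AE z in \<mu> \<Otimes>\<^sub>M S. (\<lambda>n. D (real n) z) \<longlonglongrightarrow> \<zeta> z"
    using recur
  proof eventually_elim
    case (elim z)
    have "\<forall>\<^sub>F n in sequentially. D (real n) z = \<zeta> z"
      using filterlim_real_sequentially[unfolded filterlim_at_top, rule_format,
          of "max (sup_walk (snd z)) (sup_walk (case_nat (fst z) (snd z)))"]
      by eventually_elim (use elim in \<open>auto simp: D_def \<zeta>_def max_def min_def split: if_splits\<close>)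
    then show ?case by (rule tendsto_eventually)
  qed
  have bound: "AE z in \<mu> \<Otimes>\<^sub>M S. norm (D (real n) z) \<le> \<bar>\<xi> z\<bar>" for n
    using recur
  proof eventually_elim
    case (elim z)
    have "\<bar>min (max 0 (x + w)) c - min w c\<bar> \<le> \<bar>x\<bar>" if "w \<ge> 0" for x w c :: real
      using that by (auto simp: min_def max_def)
    then show ?case using elim sup_walk_nonneg by (simp add: D_def)
  qed
  have "(\<lambda>n. \<integral>z. D (real n) z \<partial>(\<mu> \<Otimes>\<^sub>M S)) \<longlonglongrightarrow> (\<integral>z. \<zeta> z \<partial>(\<mu> \<Otimes>\<^sub>M S))"
    using int\<xi> by (intro integral_dominated_convergence[OF _ _ _ ptw bound]) auto
  then have E\<zeta>: "(\<integral>z. \<zeta> z \<partial>(\<mu> \<Otimes>\<^sub>M S)) = 0"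
    by (simp add: ED LIMSEQ_const_iff)
  have int\<zeta>: "integrable (\<mu> \<Otimes>\<^sub>M S) \<zeta>"
    using int\<xi> by (intro integrable_dominated_convergence[OF _ _ _ ptw bound]) auto
  have int_diff: "integrable (\<mu> \<Otimes>\<^sub>M S) (\<lambda>z. \<zeta> z - \<xi> z)" using int\<zeta> int\<xi> by simp
  moreover have nn: "AE z in \<mu> \<Otimes>\<^sub>M S. 0 \<le> \<zeta> z - \<xi> z" by (simp add: \<zeta>_def)
  moreover have "(\<integral>z. \<zeta> z - \<xi> z \<partial>(\<mu> \<Otimes>\<^sub>M S)) = 0"
  proof (rule antisym)
    show "(\<integral>z. \<zeta> z - \<xi> z \<partial>(\<mu> \<Otimes>\<^sub>M S)) \<le> 0"
      using int\<zeta> int\<xi> nonneg by (simp add: E\<zeta> E\<xi>)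
  qed (rule integral_nonneg_AE[OF nn])
  ultimately have "AE z in \<mu> \<Otimes>\<^sub>M S. \<zeta> z - \<xi> z = 0"
    by (simp add: integral_nonneg_eq_0_iff_AE)
  with limz have "AE z in \<mu> \<Otimes>\<^sub>M S. \<exists>n. 0 \<le> walk (case_nat (fst z) (snd z)) (Suc n)"
  proof eventually_elim
    case (elim z)
    obtain m where m: "\<And>n. walk (snd z) n \<le> walk (snd z) m" using walk_attains_max[OF elim(1)] by auto
    have "sup_walk (snd z) \<le> walk (snd z) m" by (rule sup_walk_le[OF m])
    then have "0 \<le> walk (case_nat (fst z) (snd z)) (Suc m)"
      using elim(2) by (simp add: walk_cons \<zeta>_def \<xi>_def max_def split: if_splits)
    then show ?case by blast
  qed
  then have "AE X in S. \<exists>n. 0 \<le> walk X (Suc n)"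
    by (subst AE_cons) (simp_all, measurable)
  then have "AE X in S. \<forall>k. \<exists>n. 0 \<le> walk (\<lambda>i. X (i + k)) (Suc n)"
    by (rule AE_shift) measurable
  with lim have "AE X in S. False"
  proof eventually_elim
    case (elim X)
    \<comment> \<open>There is a last time at which the walk is nonnegative; the return statement
      for the tail from that time on gives a later one.\<close>
    have "finite {n. 0 \<le> walk X n}"
    proof -
      obtain N where "\<And>n. n \<ge> N \<Longrightarrow> walk X n \<le> -1"
        using elim(1) by (auto simp: filterlim_at_bot eventually_sequentially)
      then have "{n. 0 \<le> walk X n} \<subseteq> {..<N}" by (force simp: not_le[symmetric])
      then show ?thesis by (rule finite_subset) simp
    qed
    moreover have "{n. 0 \<le> walk X n} \<noteq> {}" by (auto intro: exI[of _ 0])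
    ultimately have "Max {n. 0 \<le> walk X n} \<in> {n. 0 \<le> walk X n}" by (rule Max_in)
    then obtain m where m: "m = Max {n. 0 \<le> walk X n}" "0 \<le> walk X m" by blast
    obtain n where "0 \<le> walk (\<lambda>i. X (i + m)) (Suc n)" using elim(2) by blast
    then have "0 \<le> walk X (Suc n + m)" using m(2) by (simp add: walk_shift)
    then have "Suc n + m \<le> m"
      using Max_ge[OF \<open>finite {n. 0 \<le> walk X n}\<close>, of "Suc n + m"] m(1) by simp
    then show False by simp
  qed
  then show False by simp
qed

end

section \<open>Moments under an invariant law\<close>

context perpetuity
begin

text \<open>\<open>B (log1p z)\<close> drops by a lot only if \<open>fst p\<close> is small, or if \<open>snd p\<close> is so large that it may
  cancel against \<open>fst p * z\<close>.\<close>
lemma descent_by_cancellation: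
  assumes nz: "fst p \<noteq> 0" and y: "y \<le> log1p z"
    and h: "neg_log (fst p) + 1 < y / 2" and q: "log1p (snd p) < y / 2"
  shows "log1p z - (neg_log (fst p) + 1) \<le> log1p (snd p + fst p * z)"
proof -
  define m where "m = min 1 \<bar>fst p\<bar>"
  have m: "m > 0" "m \<le> 1" "m \<le> \<bar>fst p\<bar>" using nz by (auto simp: m_def)
  have ln_m: "ln m = - neg_log (fst p)"
    using nz by (auto simp: m_def neg_log_def min_def max_def)
  have "\<not> \<bar>fst p\<bar> * \<bar>z\<bar> < 2 * \<bar>snd p\<bar>"
  proof
    assume "\<bar>fst p\<bar> * \<bar>z\<bar> < 2 * \<bar>snd p\<bar>"
    then have "m * \<bar>z\<bar> \<le> 2 * \<bar>snd p\<bar>" using m by (smt (verit) abs_ge_zero mult_right_mono)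
    then have "m * (1 + \<bar>z\<bar>) \<le> 2 * (1 + \<bar>snd p\<bar>)" using m by (simp add: distrib_left)
    then have "ln (m * (1 + \<bar>z\<bar>)) \<le> ln (2 * (1 + \<bar>snd p\<bar>))"
      using m by (intro ln_mono) (auto intro!: mult_pos_pos add_pos_nonneg)
    moreover have "ln (m * (1 + \<bar>z\<bar>)) = ln m + log1p z"
      unfolding log1p_def using m by (intro ln_mult_pos) (auto intro: add_pos_nonneg)
    moreover have "ln (2 * (1 + \<bar>snd p\<bar>)) = ln 2 + log1p (snd p)"
      unfolding log1p_def by (intro ln_mult_pos) (auto intro: add_pos_nonneg)
    ultimately show False using ln_m h q y ln_2_less_1 by linarith
  qed
  moreover have "\<bar>fst p\<bar> * \<bar>z\<bar> \<le> \<bar>snd p + fst p * z\<bar> + \<bar>snd p\<bar>"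
    by (simp flip: abs_mult)
  ultimately have "\<bar>fst p\<bar> * \<bar>z\<bar> \<le> 2 * \<bar>snd p + fst p * z\<bar>" by linarith
  then have "m * \<bar>z\<bar> \<le> 2 * \<bar>snd p + fst p * z\<bar>" using m by (smt (verit) abs_ge_zero mult_right_mono)
  then have "m * (1 + \<bar>z\<bar>) \<le> 2 * (1 + \<bar>snd p + fst p * z\<bar>)" using m by (simp add: distrib_left)
  then have "ln (m * (1 + \<bar>z\<bar>)) \<le> ln (2 * (1 + \<bar>snd p + fst p * z\<bar>))"
    using m by (intro ln_mono) (auto intro!: mult_pos_pos add_pos_nonneg)
  moreover have "ln (m * (1 + \<bar>z\<bar>)) = ln m + log1p z"
    unfolding log1p_def using m by (intro ln_mult_pos) (auto intro: add_pos_nonneg)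
  moreover have "ln (2 * (1 + \<bar>snd p + fst p * z\<bar>)) = ln 2 + log1p (snd p + fst p * z)"
    unfolding log1p_def by (intro ln_mult_pos) (auto intro: add_pos_nonneg)
  ultimately show ?thesis using ln_m ln_2_less_1 by linarith
qed

text \<open>Bounded, hence integrable under every law, so that invariance applies. The cap is on the
  argument, and \<open>min (log1p z) T\<close> remains a height at which \<open>g\<close> and
  \<open>A\<close> can be evaluated.\<close>

definition B_trunc :: "real \<Rightarrow> real \<Rightarrow> real" where
  "B_trunc T z = B (min (log1p z) T)"

lemma measurable_B_trunc [measurable]: "B_trunc T \<in> borel_measurable borel"
  unfolding B_trunc_def by measurable

lemma B_trunc_nonneg: "T \<ge> 0 \<Longrightarrow> B_trunc T z \<ge> 0"
  unfolding B_trunc_def by (intro B_nonneg) auto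

lemma B_trunc_le: "T \<ge> 0 \<Longrightarrow> B_trunc T z \<le> B T"
  unfolding B_trunc_def by (intro B_mono) auto

lemma B_trunc_le_B: "T \<ge> 0 \<Longrightarrow> B_trunc T z \<le> B (log1p z)"
  unfolding B_trunc_def by (intro B_mono) auto

definition loss :: "real \<Rightarrow> real \<times> real \<Rightarrow> real \<Rightarrow> real" where
  "loss T p z = max 0 (B_trunc T z - B_trunc T (snd p + fst p * z))"

definition gain :: "real \<Rightarrow> real \<times> real \<Rightarrow> real \<Rightarrow> real" where
  "gain T p z = max 0 (B_trunc T (snd p + fst p * z) - B_trunc T z)"

text \<open>Let \<open>y\<close> be the capped height and \<open>h = neg_log (fst p) + 1\<close>. If
  \<open>h \<ge> y / 2\<close>, the largest possible loss \<open>B y\<close>, of order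
  \<open>F y\<close>, fits into the first term because \<open>3 * h \<ge> 1 + y\<close>. If
  \<open>log1p (snd p) \<ge> y / 2\<close>, it is the second term. Otherwise the height drops by at
  most \<open>h < y / 2\<close>, a range over which \<open>A\<close> changes at most by a factor
  2.\<close>

lemma loss_pointwise:
  "\<exists>C>0. \<forall>T\<ge>0. \<forall>p z. fst p \<noteq> 0 \<longrightarrow> loss T p z \<le>
     C * g (min (log1p z) T) * (min (neg_log (fst p) + 1) (1 + min (log1p z) T) / A (1 + min (log1p z) T)) +
     B (min (log1p z) T) * (if log1p (snd p) \<ge> min (log1p z) T / 2 then 1 else 0)"
proof -
  obtain C1 where C1: "C1 > 0" "\<And>y. y \<ge> 0 \<Longrightarrow> B y \<le> C1 * F y" using B_le_F by auto
  define C where "C = 3 * C1 + 2"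
  have "C > 0" using C1 by (simp add: C_def)
  have "loss T p z \<le> C * g y * (min h (1 + y) / A (1 + y)) +
     B y * (if log1p (snd p) \<ge> y / 2 then 1 else 0)"
    if T: "T \<ge> 0" and nz: "fst p \<noteq> 0" and y_def: "y = min (log1p z) T" and h_def: "h = neg_log (fst p) + 1"
    for T p z y h
  proof -
    have y: "y \<ge> 0" "y \<le> log1p z" "y \<le> T" using T by (auto simp: y_def)
    have h: "h \<ge> 1" by (simp add: h_def)
    have nn1: "C * g y * (min h (1 + y) / A (1 + y)) \<ge> 0"
      using \<open>C > 0\<close> g_pos[OF y(1)] A1_pos[OF y(1)] h y
      by (intro mult_nonneg_nonneg divide_nonneg_pos) auto
    have nn2: "B y * (if log1p (snd p) \<ge> y / 2 then 1 else 0) \<ge> 0" using B_nonneg[OF y(1)] by simp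
    have loss_le: "loss T p z \<le> B y"
      using B_trunc_nonneg[OF T, of "snd p + fst p * z"] B_nonneg[OF y(1)]
      by (simp add: loss_def B_trunc_def y_def)
    consider "h \<ge> y / 2" | "log1p (snd p) \<ge> y / 2" | "h < y / 2" "log1p (snd p) < y / 2" by linarith
    then show ?thesis
    proof cases
      case 1
      have "B y \<le> C1 * F y" using C1 y by simp
      also have "\<dots> = C1 * g y * ((1 + y) / A (1 + y))" by (simp add: F_def J1_def)
      also have "\<dots> \<le> C1 * g y * ((3 * min h (1 + y)) / A (1 + y))"
        using 1 h y C1 g_pos[OF y(1)] A1_pos[OF y(1)]
        by (intro mult_left_mono divide_right_mono) (auto simp: min_def)
      also have "\<dots> = 3 * C1 * g y * (min h (1 + y) / A (1 + y))" by simp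
      also have "\<dots> \<le> C * g y * (min h (1 + y) / A (1 + y))"
        using y h g_pos[OF y(1)] A1_pos[OF y(1)]
        by (intro mult_right_mono divide_nonneg_pos) (auto simp: C_def)
      finally show ?thesis using loss_le nn2 by linarith
    next
      case 2
      then show ?thesis using loss_le nn1 by simp
    next
      case 3
      have "y - h \<ge> 0" using 3 h y by simp
      have "log1p z - h \<le> log1p (snd p + fst p * z)"
        using descent_by_cancellation[OF nz y(2)] 3 by (simp add: h_def)
      then have "y - h \<le> min (log1p (snd p + fst p * z)) T" using y h by auto
      then have "B (y - h) \<le> B_trunc T (snd p + fst p * z)"
        unfolding B_trunc_def using \<open>y - h \<ge> 0\<close> by (intro B_mono)
      moreover have "B_trunc T z = B y" by (simp add: B_trunc_def y_def)
      ultimately have "loss T p z \<le> max 0 (B y - B (y - h))" by (auto simp: loss_def)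
      also have "\<dots> = B y - B (y - h)" using B_mono[of "y - h" y] \<open>y - h \<ge> 0\<close> h by simp
      also have "\<dots> \<le> (y - (y - h)) * (g y / A (1 + (y - h)))"
        using \<open>y - h \<ge> 0\<close> h by (intro B_diff_le) auto
      also have "\<dots> \<le> h * (2 * g y / A (1 + y))"
      proof -
        have "(1 + (y - h)) * A (1 + y) \<le> (1 + y) * A (1 + (y - h))"
          using A_scale[of "1 + (y - h)" "1 + y"] h \<open>y - h \<ge> 0\<close> by simp
        also have "\<dots> \<le> (1 + (y - h)) * (2 * A (1 + (y - h)))"
          using A1_pos[OF \<open>y - h \<ge> 0\<close>] 3 by (subst mult.left_commute) (simp add: mult.assoc[symmetric])
        finally have "A (1 + y) \<le> 2 * A (1 + (y - h))" using \<open>y - h \<ge> 0\<close> by simp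
        then have "g y / A (1 + (y - h)) \<le> 2 * g y / A (1 + y)"
          using A1_pos[OF y(1)] A1_pos[OF \<open>y - h \<ge> 0\<close>] g_pos[OF y(1)]
          by (simp add: divide_le_eq le_divide_eq mult.commute mult_left_mono)
        then have "h * (g y / A (1 + (y - h))) \<le> h * (2 * g y / A (1 + y))"
          using h by (intro mult_left_mono) auto
        then show ?thesis by simp
      qed
      also have "\<dots> = 2 * g y * (min h (1 + y) / A (1 + y))" using 3 h y by (simp add: min_def)
      also have "\<dots> \<le> C * g y * (min h (1 + y) / A (1 + y))"
        using y h g_pos[OF y(1)] A1_pos[OF y(1)] C1
        by (intro mult_right_mono divide_nonneg_pos) (auto simp: C_def)
      finally show ?thesis using nn2 by linarith
    qed
  qed
  then show ?thesis using \<open>C > 0\<close> by blast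
qed

lemma integrable_B_trunc:
  assumes "prob_space M" "T \<ge> 0" and [measurable]: "f \<in> borel_measurable M"
  shows "integrable M (\<lambda>x. B_trunc T (f x))"
proof -
  interpret M: prob_space M by fact
  show ?thesis
    by (rule M.integrable_const_bound[where B = "B T"])
       (use B_trunc_nonneg B_trunc_le assms(2) in auto)
qed

lemma measurable_loss [measurable (raw)]:
  assumes [measurable]: "f \<in> K \<rightarrow>\<^sub>M borel \<Otimes>\<^sub>M borel" "h \<in> borel_measurable K"
  shows "(\<lambda>x. loss T (f x) (h x)) \<in> borel_measurable K"
  unfolding loss_def by measurable

lemma measurable_gain [measurable (raw)]:
  assumes [measurable]: "f \<in> K \<rightarrow>\<^sub>M borel \<Otimes>\<^sub>M borel" "h \<in> borel_measurable K"
  shows "(\<lambda>x. gain T (f x) (h x)) \<in> borel_measurable K"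
  unfolding gain_def by measurable

lemma loss_bounds: "T \<ge> 0 \<Longrightarrow> 0 \<le> loss T p z \<and> loss T p z \<le> B T"
  using B_trunc_nonneg[of T] B_trunc_le[of T] by (smt (verit) loss_def)

lemma gain_bounds: "T \<ge> 0 \<Longrightarrow> 0 \<le> gain T p z \<and> gain T p z \<le> B T"
  using B_trunc_nonneg[of T] B_trunc_le[of T] by (smt (verit) gain_def)

text \<open>The mean of the truncated \<open>neg_log\<close> cancels \<open>A (1 + y)\<close> and
  leaves \<open>g\<close>. The rest is \<open>B y\<close> times the probability that
  \<open>log1p (snd p) \<ge> y / 2\<close>, at most \<open>B K\<close> for \<open>y \<le> K\<close>
  and otherwise, as in Markov's inequality, of the order of the truncated moment of
  \<open>snd p\<close>. That moment is thus charged only to points beyond \<open>K\<close>, which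
  are rare for large \<open>K\<close>.\<close>

lemma expected_loss:
  "\<exists>C\<ge>0. \<forall>T\<ge>0. \<forall>K\<ge>0. \<forall>z. (\<integral>p. loss T p z \<partial>\<mu>) \<le>
     C * g (log1p z) + B K + C * ((\<integral>p. B_trunc T (snd p) \<partial>\<mu>) + 1) * (if log1p z > K then 1 else 0)"
proof -
  obtain C1 where C1: "C1 > 0" and loss: "\<And>T p z. T \<ge> 0 \<Longrightarrow> fst p \<noteq> 0 \<Longrightarrow> loss T p z \<le>
     C1 * g (min (log1p z) T) * (min (neg_log (fst p) + 1) (1 + min (log1p z) T) / A (1 + min (log1p z) T)) +
     B (min (log1p z) T) * (if log1p (snd p) \<ge> min (log1p z) T / 2 then 1 else 0)"
    using loss_pointwise by blast
  obtain C2 where C2: "C2 > 0" "\<And>y. y \<ge> 0 \<Longrightarrow> B (2 * y) \<le> C2 * (B y + 1)"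
    using B_scale[of 2] by auto
  define C where "C = max (C1 * (1 / A 1 + 1)) C2"
  have C: "C \<ge> C1 * (1 / A 1 + 1)" "C \<ge> C2" by (auto simp: C_def)
  have "(\<integral>p. loss T p z \<partial>\<mu>) \<le>
     C * g (log1p z) + B K + C * ((\<integral>p. B_trunc T (snd p) \<partial>\<mu>) + 1) * (if log1p z > K then 1 else 0)"
    if T: "T \<ge> 0" and K: "K \<ge> 0" for T K z
  proof -
    define y where "y = min (log1p z) T"
    have y: "y \<ge> 0" "y \<le> log1p z" "y \<le> T" using T by (auto simp: y_def)
    define I where "I p = (if log1p (snd p) \<ge> y / 2 then 1 else 0 :: real)" for p :: "real \<times> real"
    have [measurable]: "I \<in> borel_measurable \<mu>" unfolding I_def by measurable
    have intI: "integrable \<mu> I"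
      by (rule integrable_const_bound[where B = 1]) (auto simp: I_def)
    have intn: "integrable \<mu> (\<lambda>p. min (neg_log (fst p)) (1 + y))"
      by (rule integrable_const_bound[where B = "1 + y"]) (use y in \<open>auto simp: min_def\<close>)
    have inth: "integrable \<mu> (\<lambda>p. min (neg_log (fst p) + 1) (1 + y))"
      by (rule integrable_const_bound[where B = "1 + y"]) (use y in \<open>auto simp: min_def add_nonneg_nonneg\<close>)
    have "(\<integral>p. loss T p z \<partial>\<mu>) \<le>
        (\<integral>p. C1 * g y * (min (neg_log (fst p) + 1) (1 + y) / A (1 + y)) + B y * I p \<partial>\<mu>)"
    proof (rule integral_mono_AE)
      show "integrable \<mu> (\<lambda>p. loss T p z)"
        by (rule integrable_const_bound[where B = "B T"]) (use loss_bounds[OF T] in auto)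
      show "AE p in \<mu>. loss T p z \<le> C1 * g y * (min (neg_log (fst p) + 1) (1 + y) / A (1 + y)) + B y * I p"
        using M_nonzero by eventually_elim (use loss[OF T] in \<open>simp add: y_def I_def\<close>)
    qed (use intI inth in auto)
    also have "\<dots> = C1 * g y * ((\<integral>p. min (neg_log (fst p) + 1) (1 + y) \<partial>\<mu>) / A (1 + y)) + B y * (\<integral>p. I p \<partial>\<mu>)"
      using intI inth by simp
    also have "\<dots> \<le> C * g (log1p z) + (B K + C * ((\<integral>p. B_trunc T (snd p) \<partial>\<mu>) + 1) * (if log1p z > K then 1 else 0))"
    proof (rule add_mono)
      have "(\<integral>p. min (neg_log (fst p) + 1) (1 + y) \<partial>\<mu>) \<le> (\<integral>p. min (neg_log (fst p)) (1 + y) + 1 \<partial>\<mu>)"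
        using inth intn by (intro Bochner_Integration.integral_mono) auto
      also have "\<dots> = A (1 + y) + 1" using intn by (simp add: trunc_mean_def prob_space)
      finally have "(\<integral>p. min (neg_log (fst p) + 1) (1 + y) \<partial>\<mu>) / A (1 + y) \<le> (A (1 + y) + 1) / A (1 + y)"
        using A1_pos[OF y(1)] by (intro divide_right_mono) auto
      also have "\<dots> = 1 + 1 / A (1 + y)" using A1_pos[OF y(1)] by (simp add: add_divide_distrib)
      also have "\<dots> \<le> 1 / A 1 + 1"
        using A_pos[of 1] A_mono[of 1 "1 + y"] y by (simp add: frac_le)
      finally have "C1 * g y * ((\<integral>p. min (neg_log (fst p) + 1) (1 + y) \<partial>\<mu>) / A (1 + y)) \<le> C1 * g y * (1 / A 1 + 1)"
        using C1 g_pos[OF y(1)] by (intro mult_left_mono) auto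
      also have "\<dots> = C1 * (1 / A 1 + 1) * g y" by simp
      also have "\<dots> \<le> C * g (log1p z)"
        using C C1 C2 A_pos[of 1] g_pos[OF y(1)] g_mono[OF y(1,2)] by (intro mult_mono) linarith+
      finally show "C1 * g y * ((\<integral>p. min (neg_log (fst p) + 1) (1 + y) \<partial>\<mu>) / A (1 + y)) \<le> C * g (log1p z)" .
    next
      have \<beta>: "(\<integral>p. B_trunc T (snd p) \<partial>\<mu>) \<ge> 0"
        using B_trunc_nonneg[OF T] by (intro Bochner_Integration.integral_nonneg)
      have I01: "0 \<le> I p" "I p \<le> 1" for p by (auto simp: I_def)
      have I: "0 \<le> (\<integral>p. I p \<partial>\<mu>)" "(\<integral>p. I p \<partial>\<mu>) \<le> 1"
        using I01 by (auto intro!: Bochner_Integration.integral_nonneg integral_le_const[OF intI] AE_I2)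
      show "B y * (\<integral>p. I p \<partial>\<mu>) \<le> B K + C * ((\<integral>p. B_trunc T (snd p) \<partial>\<mu>) + 1) * (if log1p z > K then 1 else 0)"
      proof (cases "y \<le> K")
        case True
        have "B y * (\<integral>p. I p \<partial>\<mu>) \<le> B y * 1" using I B_nonneg[OF y(1)] by (intro mult_left_mono) auto
        also have "\<dots> \<le> B K" using True y by (simp add: B_mono)
        finally have "B y * (\<integral>p. I p \<partial>\<mu>) \<le> B K" .
        moreover have "0 \<le> C * ((\<integral>p. B_trunc T (snd p) \<partial>\<mu>) + 1) * (if log1p z > K then 1 else 0)"
          using \<beta> C(2) C2(1) by (intro mult_nonneg_nonneg) auto
        ultimately show ?thesis by linarith
      next
        case False
        have "B y * (\<integral>p. I p \<partial>\<mu>) \<le> C2 * (B (y / 2) + 1) * (\<integral>p. I p \<partial>\<mu>)"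
          using I C2(2)[of "y / 2"] y by (intro mult_right_mono) auto
        also have "\<dots> = C2 * (\<integral>p. (B (y / 2) + 1) * I p \<partial>\<mu>)" using intI by simp
        also have "\<dots> \<le> C2 * (\<integral>p. B_trunc T (snd p) + 1 \<partial>\<mu>)"
        proof (intro mult_left_mono Bochner_Integration.integral_mono)
          fix p
          show "(B (y / 2) + 1) * I p \<le> B_trunc T (snd p) + 1"
            using B_trunc_nonneg[OF T, of "snd p"] B_mono[of "y / 2" "min (log1p (snd p)) T"] y
            by (auto simp: I_def B_trunc_def)
        qed (use intI C2 integrable_B_trunc[OF prob_space_axioms T] in auto)
        also have "\<dots> = C2 * ((\<integral>p. B_trunc T (snd p) \<partial>\<mu>) + 1)"
          using integrable_B_trunc[OF prob_space_axioms T, of snd] by (simp add: prob_space)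
        also have "\<dots> \<le> C * ((\<integral>p. B_trunc T (snd p) \<partial>\<mu>) + 1)"
          using C(2) \<beta> by (intro mult_right_mono) auto
        finally show ?thesis using False y B_nonneg[OF K] by auto
      qed
    qed
    finally show ?thesis by simp
  qed
  moreover have "C \<ge> 0" using C2 C by simp
  ultimately show ?thesis by blast
qed

text \<open>The images \<open>snd p + fst p * zi\<close> of two distinct points \<open>z1\<close>, \<open>z2\<close> determine \<open>p\<close>.\<close>
lemma two_point_bound:
  "\<exists>C\<ge>0. \<forall>T\<ge>0. \<forall>p z1 z2 a. \<bar>z1 - z2\<bar> \<ge> 1 / real (Suc n) \<longrightarrow> \<bar>z1\<bar> \<le> real (Suc n) \<longrightarrow>
     \<bar>z2\<bar> \<le> real (Suc n) \<longrightarrow> a \<in> {fst p, snd p} \<longrightarrow> B_trunc T a \<le> C * (gain T p z1 + gain T p z2 + 1)"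
proof -
  define N' where "N' = real (Suc n)"
  define \<kappa> where "\<kappa> = ln (2 + N' * N')"
  have N': "N' \<ge> 1" by (simp add: N'_def)
  have \<kappa>: "\<kappa> \<ge> 0" using N' by (auto simp: \<kappa>_def intro!: ln_ge_zero)
  obtain C1 where C1: "C1 > 0" "\<And>y. y \<ge> 0 \<Longrightarrow> B (3 * y) \<le> C1 * (B y + 1)"
    using B_scale[of 3] by auto
  define R where "R = B (log1p N')"
  have R: "R \<ge> 0" by (simp add: R_def B_nonneg)
  define C where "C = C1 * (B \<kappa> + 2 * R + 3)"
  have "B_trunc T a \<le> C * (gain T p z1 + gain T p z2 + 1)"
    if T: "T \<ge> 0" and sep: "\<bar>z1 - z2\<bar> \<ge> 1 / N'" and z: "\<bar>z1\<bar> \<le> N'" "\<bar>z2\<bar> \<le> N'"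
      and a: "a \<in> {fst p, snd p}" for T p z1 z2 a
  proof -
    define u1 u2 where "u1 = snd p + fst p * z1" and "u2 = snd p + fst p * z2"
    have "\<bar>fst p\<bar> * (1 / N') \<le> \<bar>fst p\<bar> * \<bar>z1 - z2\<bar>" using sep by (intro mult_left_mono) auto
    also have "\<dots> = \<bar>u1 - u2\<bar>" by (simp add: u1_def u2_def abs_mult[symmetric] algebra_simps)
    finally have "\<bar>fst p\<bar> * (1 / N') \<le> \<bar>u1 - u2\<bar>" .
    then have m: "\<bar>fst p\<bar> \<le> N' * (\<bar>u1\<bar> + \<bar>u2\<bar>)"
    proof -
      have "\<bar>fst p\<bar> \<le> N' * \<bar>u1 - u2\<bar>"
        using \<open>\<bar>fst p\<bar> * (1 / N') \<le> \<bar>u1 - u2\<bar>\<close> N' by (simp add: divide_le_eq mult.commute)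
      also have "\<dots> \<le> N' * (\<bar>u1\<bar> + \<bar>u2\<bar>)"
        using N' by (intro mult_left_mono abs_triangle_ineq4) auto
      finally show ?thesis .
    qed
    have "\<bar>snd p\<bar> \<le> \<bar>u1\<bar> + \<bar>fst p\<bar> * \<bar>z1\<bar>" by (simp add: u1_def flip: abs_mult)
    also have "\<bar>fst p\<bar> * \<bar>z1\<bar> \<le> (N' * (\<bar>u1\<bar> + \<bar>u2\<bar>)) * N'"
      using m z N' by (intro mult_mono) auto
    finally have q: "\<bar>snd p\<bar> \<le> (1 + N' * N') * (\<bar>u1\<bar> + \<bar>u2\<bar>)" by (simp add: algebra_simps)
    have "N' \<le> 1 + N' * N'" using N' mult_left_mono[of 1 N' N'] by linarith
    then have "N' * (\<bar>u1\<bar> + \<bar>u2\<bar>) \<le> (1 + N' * N') * (\<bar>u1\<bar> + \<bar>u2\<bar>)" by (intro mult_right_mono) auto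
    with m q a have a': "\<bar>a\<bar> \<le> (1 + N' * N') * (\<bar>u1\<bar> + \<bar>u2\<bar>)" by auto
    have "1 + \<bar>a\<bar> \<le> (2 + N' * N') * ((1 + \<bar>u1\<bar>) * (1 + \<bar>u2\<bar>))"
    proof -
      have "1 + (1 + N' * N') * (\<bar>u1\<bar> + \<bar>u2\<bar>) \<le> (2 + N' * N') * (1 + (\<bar>u1\<bar> + \<bar>u2\<bar>))"
        using N' by (simp add: algebra_simps)
      also have "\<dots> \<le> (2 + N' * N') * ((1 + \<bar>u1\<bar>) * (1 + \<bar>u2\<bar>))"
        using N' by (intro mult_left_mono) (auto simp: algebra_simps)
      finally show ?thesis using a' by linarith
    qed
    then have "log1p a \<le> ln ((2 + N' * N') * ((1 + \<bar>u1\<bar>) * (1 + \<bar>u2\<bar>)))"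
      unfolding log1p_def by (intro ln_mono) (auto intro: add_pos_nonneg)
    also have "\<dots> = \<kappa> + (log1p u1 + log1p u2)"
    proof -
      have "0 < 1 + \<bar>u1\<bar>" "0 < 1 + \<bar>u2\<bar>" "0 < 2 + N' * N'" using N' by (auto intro: add_pos_nonneg)
      then show ?thesis by (simp add: log1p_def \<kappa>_def ln_mult_pos)
    qed
    finally have La: "min (log1p a) T \<le> \<kappa> + min (log1p u1) T + min (log1p u2) T"
      using \<kappa> T log1p_nonneg[of u1] log1p_nonneg[of u2] by linarith
    \<comment> \<open>The capped height of \<open>a\<close> is at most a sum of three terms, each at
      most \<open>w\<close>; hence the factor 3.\<close>
    define w where "w = max \<kappa> (max (min (log1p u1) T) (min (log1p u2) T))"
    have w: "w \<ge> 0" using \<kappa> by (simp add: w_def le_max_iff_disj)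
    have "B_trunc T a \<le> B (3 * w)"
      unfolding B_trunc_def using La T by (intro B_mono) (auto simp: w_def)
    also have "\<dots> \<le> C1 * (B w + 1)" using w by (rule C1)
    also have "B w \<le> B \<kappa> + B_trunc T u1 + B_trunc T u2"
      using B_nonneg[OF \<kappa>] B_trunc_nonneg[OF T, of u1] B_trunc_nonneg[OF T, of u2]
      by (auto simp: w_def max_def B_trunc_def)
    \<comment> \<open>The starting point \<open>z1\<close> is bounded, so the value at its image is
      the gain up to the constant \<open>R\<close>.\<close>
    also have "B_trunc T u1 \<le> gain T p z1 + R"
    proof -
      have "B_trunc T z1 \<le> R"
        unfolding R_def using z N' B_trunc_le_B[OF T, of z1] B_mono[of "log1p z1" "log1p N'"]
        by (auto simp: log1p_def intro: ln_mono add_pos_nonneg)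
      then show ?thesis by (auto simp: gain_def u1_def)
    qed
    also have "B_trunc T u2 \<le> gain T p z2 + R"
    proof -
      have "B_trunc T z2 \<le> R"
        unfolding R_def using z N' B_trunc_le_B[OF T, of z2] B_mono[of "log1p z2" "log1p N'"]
        by (auto simp: log1p_def intro: ln_mono add_pos_nonneg)
      then show ?thesis by (auto simp: gain_def u2_def)
    qed
    finally have "B_trunc T a \<le> C1 * (B \<kappa> + (gain T p z1 + R) + (gain T p z2 + R) + 1)"
      using C1 by simp
    also have "\<dots> \<le> C1 * ((B \<kappa> + 2 * R + 3) * (gain T p z1 + gain T p z2 + 1))"
    proof -
      define s where "s = gain T p z1 + gain T p z2"
      have s: "s \<ge> 0" using gain_bounds[OF T] by (auto simp: s_def intro: add_nonneg_nonneg)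
      have "(B \<kappa> + 2 * R) * 1 + 3 * s \<le> (B \<kappa> + 2 * R) * (s + 1) + 3 * s"
        using s R B_nonneg[OF \<kappa>] by (intro add_right_mono mult_left_mono) auto
      then have "B \<kappa> + 2 * R + s + 1 \<le> (B \<kappa> + 2 * R + 3) * (s + 1)"
        using s by (simp add: algebra_simps)
      then show ?thesis using C1(1) by (intro mult_left_mono) (auto simp: s_def algebra_simps)
    qed
    finally show ?thesis by (simp add: C_def)
  qed
  moreover have "C \<ge> 0" using C1 R B_nonneg[OF \<kappa>] by (simp add: C_def)
  ultimately show ?thesis unfolding N'_def by blast
qed

end

text \<open>If two independent copies were almost never separated at any scale, they would coincide
  almost surely, and by Fubini the law would be a point mass. The bounds on both values are there
  for \<open>two_point_bound\<close>.\<close>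

lemma nondegenerate_separated:
  fixes \<nu> :: "real measure"
  assumes "prob_space \<nu>" and [measurable_cong]: "sets \<nu> = sets borel"
    and nondeg: "\<not> (\<exists>c. AE z in \<nu>. z = c)"
  shows "\<exists>n. measure (\<nu> \<Otimes>\<^sub>M \<nu>) {w \<in> space (\<nu> \<Otimes>\<^sub>M \<nu>). \<bar>fst w - snd w\<bar> \<ge> 1 / real (Suc n) \<and>
    \<bar>fst w\<bar> \<le> real (Suc n) \<and> \<bar>snd w\<bar> \<le> real (Suc n)} > 0"
proof (rule ccontr)
  interpret \<nu>: prob_space \<nu> by fact
  interpret pair_prob_space \<nu> \<nu> ..
  define R where "R n w \<longleftrightarrow> \<bar>fst w - snd w\<bar> \<ge> 1 / real (Suc n) \<and>
    \<bar>fst w\<bar> \<le> real (Suc n) \<and> \<bar>snd w\<bar> \<le> real (Suc n)" for n and w :: "real \<times> real"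
  assume "\<not> ?thesis"
  then have "measure (\<nu> \<Otimes>\<^sub>M \<nu>) {w \<in> space (\<nu> \<Otimes>\<^sub>M \<nu>). R n w} = 0" for n
    unfolding R_def by (meson measure_nonneg not_less order_antisym)
  moreover have "{w \<in> space (\<nu> \<Otimes>\<^sub>M \<nu>). R n w} \<in> sets (\<nu> \<Otimes>\<^sub>M \<nu>)" for n
    unfolding R_def by measurable
  ultimately have "AE w in \<nu> \<Otimes>\<^sub>M \<nu>. \<not> R n w" for n
    by (intro AE_I[of _ _ "{w \<in> space (\<nu> \<Otimes>\<^sub>M \<nu>). R n w}"]) (auto simp: P.emeasure_eq_measure)
  then have "AE w in \<nu> \<Otimes>\<^sub>M \<nu>. \<forall>n. \<not> R n w"
    by (simp add: AE_all_countable)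
  then have "AE w in \<nu> \<Otimes>\<^sub>M \<nu>. fst w = snd w"
  proof eventually_elim
    case (elim w)
    show ?case
    proof (rule ccontr)
      assume "fst w \<noteq> snd w"
      then have "\<bar>fst w - snd w\<bar> > 0" by simp
      then obtain m where m: "1 / real (Suc m) < \<bar>fst w - snd w\<bar>" using nat_approx_posE by metis
      obtain k where k: "max \<bar>fst w\<bar> \<bar>snd w\<bar> \<le> real k" using real_arch_simple by blast
      define n where "n = max m k"
      have "1 / real (Suc n) \<le> 1 / real (Suc m)" by (intro divide_left_mono) (auto simp: n_def)
      moreover have "real k \<le> real (Suc n)" by (simp add: n_def)
      ultimately show False using elim[rule_format, of n] m k by (auto simp: R_def)
    qed
  qed
  then have "AE z1 in \<nu>. AE z2 in \<nu>. z1 = z2" by (auto dest: AE_pair)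
  then have "\<exists>z1. AE z2 in \<nu>. z1 = z2"
    using \<nu>.AE_False eventually_mono[of _ "ae_filter \<nu>"] by (metis (no_types, lifting) eventually_mono)
  then obtain c where "AE z2 in \<nu>. c = z2" ..
  then have "AE z2 in \<nu>. z2 = c" by eventually_elim simp
  then show False using nondeg by blast
qed

context perpetuity
begin

lemma invariant_law_moment:
  fixes \<nu> :: "real measure"
  assumes prob: "prob_space \<nu>" and sets_nu [measurable_cong]: "sets \<nu> = sets borel"
    and inv: "distr (\<mu> \<Otimes>\<^sub>M \<nu>) borel (\<lambda>w. snd (fst w) + fst (fst w) * snd w) = \<nu>"
    and nondeg: "\<not> (\<exists>c. AE z in \<nu>. z = c)"
    and moment: "(\<integral>\<^sup>+z. ennreal (g (log1p z)) \<partial>\<nu>) < \<infinity>"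
  shows "integrable \<mu> (\<lambda>p. F (log1p (fst p)))" and "integrable \<mu> (\<lambda>p. F (log1p (snd p)))"
proof -
  interpret \<nu>: prob_space \<nu> by fact
  interpret pn: pair_prob_space \<mu> \<nu> ..
  interpret nn: pair_prob_space \<nu> \<nu> ..
  define \<gamma> where "\<gamma> T z = (\<integral>p. gain T p z \<partial>\<mu>)" for T z
  define \<Gamma> where "\<Gamma> T = (\<integral>z. \<gamma> T z \<partial>\<nu>)" for T
  define \<beta> where "\<beta> T f = (\<integral>p. B_trunc T (f p) \<partial>\<mu>)" for T and f :: "real \<times> real \<Rightarrow> real"
  define G where "G = (\<integral>z. g (log1p z) \<partial>\<nu>)"
  have g_meas [measurable]: "(\<lambda>z. g (log1p z)) \<in> borel_measurable borel" by (rule measurable_g) auto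
  have intG: "integrable \<nu> (\<lambda>z. g (log1p z))"
    using moment g_pos by (intro integrableI_nonneg) (auto simp: less_imp_le)
  have int_gain: "integrable (\<mu> \<Otimes>\<^sub>M \<nu>) (\<lambda>w. gain T (fst w) (snd w))" if "T \<ge> 0" for T
    by (rule pn.P.integrable_const_bound[where B = "B T"]) (use gain_bounds[OF that] in auto)
  have int_loss: "integrable (\<mu> \<Otimes>\<^sub>M \<nu>) (\<lambda>w. loss T (fst w) (snd w))" if "T \<ge> 0" for T
    by (rule pn.P.integrable_const_bound[where B = "B T"]) (use loss_bounds[OF that] in auto)
  have int_\<gamma>: "integrable \<nu> (\<gamma> T)" and int_l: "integrable \<nu> (\<lambda>z. \<integral>p. loss T p z \<partial>\<mu>)"
    and \<Gamma>_eq: "\<Gamma> T = (\<integral>z. \<integral>p. loss T p z \<partial>\<mu> \<partial>\<nu>)" if T: "T \<ge> 0" for T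
  proof -
    have ig: "integrable (\<mu> \<Otimes>\<^sub>M \<nu>) (case_prod (gain T))" and il: "integrable (\<mu> \<Otimes>\<^sub>M \<nu>) (case_prod (loss T))"
      using int_gain[OF T] int_loss[OF T] by (simp_all add: case_prod_beta')
    show "integrable \<nu> (\<gamma> T)" unfolding \<gamma>_def by (rule pn.integrable_snd[OF ig])
    show "integrable \<nu> (\<lambda>z. \<integral>p. loss T p z \<partial>\<mu>)" by (rule pn.integrable_snd[OF il])
    \<comment> \<open>Gain minus loss is the increment of \<open>B_trunc T\<close>, whose mean
      vanishes by invariance.\<close>
    have "(\<integral>w. gain T (fst w) (snd w) - loss T (fst w) (snd w) \<partial>(\<mu> \<Otimes>\<^sub>M \<nu>)) =
        (\<integral>w. B_trunc T (snd (fst w) + fst (fst w) * snd w) - B_trunc T (snd w) \<partial>(\<mu> \<Otimes>\<^sub>M \<nu>))"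
      by (intro Bochner_Integration.integral_cong) (auto simp: gain_def loss_def max_def)
    also have "\<dots> = (\<integral>w. B_trunc T (snd (fst w) + fst (fst w) * snd w) \<partial>(\<mu> \<Otimes>\<^sub>M \<nu>)) - (\<integral>w. B_trunc T (snd w) \<partial>(\<mu> \<Otimes>\<^sub>M \<nu>))"
      by (intro Bochner_Integration.integral_diff integrable_B_trunc pn.prob_space_axioms T) measurable
    also have "(\<integral>w. B_trunc T (snd (fst w) + fst (fst w) * snd w) \<partial>(\<mu> \<Otimes>\<^sub>M \<nu>)) =
        (\<integral>z. B_trunc T z \<partial>distr (\<mu> \<Otimes>\<^sub>M \<nu>) borel (\<lambda>w. snd (fst w) + fst (fst w) * snd w))"
      by (rule integral_distr[symmetric]) measurable
    also have "\<dots> = (\<integral>z. B_trunc T z \<partial>\<nu>)" by (simp add: inv)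
    also have "(\<integral>w. B_trunc T (snd w) \<partial>(\<mu> \<Otimes>\<^sub>M \<nu>)) = (\<integral>z. \<integral>p. B_trunc T z \<partial>\<mu> \<partial>\<nu>)"
      using pn.integral_snd[of "\<lambda>p z. B_trunc T z"] integrable_B_trunc[OF pn.prob_space_axioms T, of snd]
      by (simp add: case_prod_beta')
    also have "\<dots> = (\<integral>z. B_trunc T z \<partial>\<nu>)" using prob_space by simp
    finally have "(\<integral>w. gain T (fst w) (snd w) \<partial>(\<mu> \<Otimes>\<^sub>M \<nu>)) = (\<integral>w. loss T (fst w) (snd w) \<partial>(\<mu> \<Otimes>\<^sub>M \<nu>))"
      using int_gain[OF T] int_loss[OF T] by simp
    then show "\<Gamma> T = (\<integral>z. \<integral>p. loss T p z \<partial>\<mu> \<partial>\<nu>)"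
      unfolding \<Gamma>_def \<gamma>_def using pn.integral_snd[OF ig] pn.integral_snd[OF il]
      by (simp add: case_prod_beta')
  qed
  obtain n where n: "measure (\<nu> \<Otimes>\<^sub>M \<nu>) {w \<in> space (\<nu> \<Otimes>\<^sub>M \<nu>). \<bar>fst w - snd w\<bar> \<ge> 1 / real (Suc n) \<and>
    \<bar>fst w\<bar> \<le> real (Suc n) \<and> \<bar>snd w\<bar> \<le> real (Suc n)} > 0"
    using nondegenerate_separated[OF prob sets_nu nondeg] by blast
  define W where "W = {w \<in> space (\<nu> \<Otimes>\<^sub>M \<nu>). \<bar>fst w - snd w\<bar> \<ge> 1 / real (Suc n) \<and>
    \<bar>fst w\<bar> \<le> real (Suc n) \<and> \<bar>snd w\<bar> \<le> real (Suc n)}"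
  define \<pi> where "\<pi> = measure (\<nu> \<Otimes>\<^sub>M \<nu>) W"
  have \<pi>: "\<pi> > 0" using n by (simp add: \<pi>_def W_def)
  have [measurable]: "W \<in> sets (\<nu> \<Otimes>\<^sub>M \<nu>)" unfolding W_def by measurable
  obtain C3 where C3: "C3 \<ge> 0" and two: "\<And>T p z1 z2 a. T \<ge> 0 \<Longrightarrow> \<bar>z1 - z2\<bar> \<ge> 1 / real (Suc n) \<Longrightarrow>
     \<bar>z1\<bar> \<le> real (Suc n) \<Longrightarrow> \<bar>z2\<bar> \<le> real (Suc n) \<Longrightarrow> a \<in> {fst p, snd p} \<Longrightarrow>
     B_trunc T a \<le> C3 * (gain T p z1 + gain T p z2 + 1)"
    using two_point_bound[of n] by blast
  \<comment> \<open>The two-point bound is averaged over two independent points of law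
    \<open>\<nu>\<close>, which are suitably separated with probability \<open>\<pi>\<close>; off
    \<open>W\<close> the right side is merely nonnegative.\<close>
  have \<beta>_le: "\<beta> T f * \<pi> \<le> C3 * (2 * \<Gamma> T + 1)" if T: "T \<ge> 0" and f: "f = fst \<or> f = snd" for T f
  proof -
    have [measurable]: "f \<in> borel_measurable \<mu>" using f by auto
    have intz: "integrable \<mu> (\<lambda>p. gain T p z)" for z
      by (rule integrable_const_bound[where B = "B T"]) (use gain_bounds[OF T] in auto)
    have "\<beta> T f * indicator W w \<le> C3 * (\<gamma> T (fst w) + \<gamma> T (snd w) + 1)" for w
    proof (cases "w \<in> W")
      case True
      have "\<beta> T f \<le> (\<integral>p. C3 * (gain T p (fst w) + gain T p (snd w) + 1) \<partial>\<mu>)"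
        unfolding \<beta>_def
      proof (rule Bochner_Integration.integral_mono)
        show "B_trunc T (f p) \<le> C3 * (gain T p (fst w) + gain T p (snd w) + 1)" for p
          using True f by (intro two[OF T]) (auto simp: W_def)
      qed (use intz integrable_B_trunc[OF prob_space_axioms T] in auto)
      also have "\<dots> = C3 * (\<gamma> T (fst w) + \<gamma> T (snd w) + 1)"
        using intz prob_space by (simp add: \<gamma>_def)
      finally show ?thesis using True by simp
    next
      case False
      have "\<gamma> T z \<ge> 0" for z
        unfolding \<gamma>_def using gain_bounds[OF T] by (intro Bochner_Integration.integral_nonneg) auto
      then have "0 \<le> C3 * (\<gamma> T (fst w) + \<gamma> T (snd w) + 1)" using C3 by (intro mult_nonneg_nonneg add_nonneg_nonneg) auto
      then show ?thesis using False by simp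
    qed
    note le = this
    have i1: "integrable (\<nu> \<Otimes>\<^sub>M \<nu>) (\<lambda>w. \<gamma> T (fst w))" and e1: "(\<integral>w. \<gamma> T (fst w) \<partial>(\<nu> \<Otimes>\<^sub>M \<nu>)) = \<Gamma> T"
      and i2: "integrable (\<nu> \<Otimes>\<^sub>M \<nu>) (\<lambda>w. \<gamma> T (snd w))" and e2: "(\<integral>w. \<gamma> T (snd w) \<partial>(\<nu> \<Otimes>\<^sub>M \<nu>)) = \<Gamma> T"
    proof -
      have "\<bar>\<gamma> T z\<bar> \<le> B T" for z
        unfolding \<gamma>_def using gain_bounds[OF T] intz[of z]
        by (auto intro!: integral_le_const Bochner_Integration.integral_nonneg simp: abs_of_nonneg)
      then have bd: "\<bar>\<gamma> T z\<bar> \<le> B T" for z .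
      have [measurable]: "\<gamma> T \<in> borel_measurable \<nu>" using int_\<gamma>[OF T] by simp
      show i1: "integrable (\<nu> \<Otimes>\<^sub>M \<nu>) (\<lambda>w. \<gamma> T (fst w))"
        by (rule nn.P.integrable_const_bound[where B = "B T"]) (use bd in auto)
      show i2: "integrable (\<nu> \<Otimes>\<^sub>M \<nu>) (\<lambda>w. \<gamma> T (snd w))"
        by (rule nn.P.integrable_const_bound[where B = "B T"]) (use bd in auto)
      show "(\<integral>w. \<gamma> T (fst w) \<partial>(\<nu> \<Otimes>\<^sub>M \<nu>)) = \<Gamma> T"
        using nn.integral_fst[of "\<lambda>x y. \<gamma> T x"] i1 by (simp add: case_prod_beta' \<Gamma>_def \<nu>.prob_space)
      show "(\<integral>w. \<gamma> T (snd w) \<partial>(\<nu> \<Otimes>\<^sub>M \<nu>)) = \<Gamma> T"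
        using nn.integral_snd[of "\<lambda>x y. \<gamma> T y"] i2 by (simp add: case_prod_beta' \<Gamma>_def \<nu>.prob_space)
    qed
    have "\<beta> T f * \<pi> = (\<integral>w. \<beta> T f * indicator W w \<partial>(\<nu> \<Otimes>\<^sub>M \<nu>))"
      by (simp add: \<pi>_def)
    also have "\<dots> \<le> (\<integral>w. C3 * (\<gamma> T (fst w) + \<gamma> T (snd w) + 1) \<partial>(\<nu> \<Otimes>\<^sub>M \<nu>))"
      by (rule Bochner_Integration.integral_mono) (use i1 i2 le in \<open>auto simp: nn.P.emeasure_eq_measure\<close>)
    also have "\<dots> = C3 * (2 * \<Gamma> T + 1)"
      using i1 i2 by (simp add: e1 e2 nn.P.prob_space)
    finally show ?thesis .
  qed
  obtain C where C: "C \<ge> 0" and loss: "\<And>T K z. T \<ge> 0 \<Longrightarrow> K \<ge> 0 \<Longrightarrow> (\<integral>p. loss T p z \<partial>\<mu>) \<le>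
     C * g (log1p z) + B K + C * ((\<integral>p. B_trunc T (snd p) \<partial>\<mu>) + 1) * (if log1p z > K then 1 else 0)"
    using expected_loss by blast
  define tail where "tail K = measure \<nu> {z \<in> space \<nu>. log1p z > K}" for K
  have \<Gamma>_le: "\<Gamma> T \<le> C * G + B K + C * (\<beta> T snd + 1) * tail K" if T: "T \<ge> 0" and K: "K \<ge> 0" for T K
  proof -
    have inti: "integrable \<nu> (\<lambda>z. indicator {z \<in> space \<nu>. log1p z > K} z :: real)"
      by (rule integrable_real_indicator) (auto simp: \<nu>.emeasure_eq_measure)
    have "\<Gamma> T \<le> (\<integral>z. C * g (log1p z) + B K + C * (\<beta> T snd + 1) * indicator {z \<in> space \<nu>. log1p z > K} z \<partial>\<nu>)"
      unfolding \<Gamma>_eq[OF T]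
    proof (rule Bochner_Integration.integral_mono)
      show "(\<integral>p. loss T p z \<partial>\<mu>) \<le> C * g (log1p z) + B K + C * (\<beta> T snd + 1) * indicator {z \<in> space \<nu>. log1p z > K} z"
        if "z \<in> space \<nu>" for z
        using loss[OF T K, of z] that by (cases "K < log1p z") (simp_all add: \<beta>_def)
    qed (use int_l[OF T] intG inti in auto)
    also have "\<dots> = C * G + B K + C * (\<beta> T snd + 1) * tail K"
      using intG inti by (simp add: G_def tail_def \<nu>.prob_space)
    finally show ?thesis .
  qed
  have "(\<lambda>n. tail (real n)) \<longlonglongrightarrow> measure \<nu> (\<Inter>n. {z \<in> space \<nu>. log1p z > real n})"
    unfolding tail_def by (intro \<nu>.finite_Lim_measure_decseq) (auto simp: decseq_def)
  also have "(\<Inter>n. {z \<in> space \<nu>. log1p z > real n}) = {}"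
  proof -
    have "\<exists>n. \<not> real n < log1p z" for z using reals_Archimedean2[of "log1p z"] by (auto intro: less_imp_le simp: not_less)
    then show ?thesis by blast
  qed
  finally have "(\<lambda>n. 2 * C3 * C * tail (real n)) \<longlonglongrightarrow> 2 * C3 * C * 0"
    by (intro tendsto_mult tendsto_const) simp
  then have "\<forall>\<^sub>F n in sequentially. 2 * C3 * C * tail (real n) < \<pi> / 2"
    by (rule order_tendstoD(2)) (use \<pi> in simp)
  then obtain m where m: "2 * C3 * C * tail (real m) < \<pi> / 2"
    using eventually_happens'[OF sequentially_bot] by blast
  \<comment> \<open>\<open>K\<close> is fixed independently of \<open>T\<close>, which makes the
    bounds uniform in \<open>T\<close>. The term with \<open>\<beta> T snd\<close> can be moved to
    the left because the truncation makes it finite.\<close>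
  define K where "K = real m"
  have K: "K \<ge> 0" "2 * C3 * C * tail K < \<pi> / 2" using m by (auto simp: K_def)
  have tail: "0 \<le> tail K" "tail K \<le> 1" by (auto simp: tail_def)
  have \<beta>_nonneg: "\<beta> T f \<ge> 0" if "T \<ge> 0" for T f
    unfolding \<beta>_def using B_trunc_nonneg[OF that] by (intro Bochner_Integration.integral_nonneg)
  define D where "D = C3 * (2 * (C * G + B K + C) + 1)"
  have \<beta>q: "\<beta> T snd \<le> 2 * D / \<pi>" if T: "T \<ge> 0" for T
  proof -
    have "\<beta> T snd * \<pi> \<le> C3 * (2 * (C * G + B K + C * (\<beta> T snd + 1) * tail K) + 1)"
      using \<beta>_le[OF T, of snd] \<Gamma>_le[OF T K(1)] C3
      by (auto elim!: order_trans intro!: mult_left_mono)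
    also have "\<dots> = C3 * (2 * (C * G + B K + C * tail K) + 1) + \<beta> T snd * (2 * C3 * C * tail K)"
      by (simp add: algebra_simps)
    also have "\<dots> \<le> D + \<beta> T snd * (\<pi> / 2)"
      unfolding D_def using K tail C C3 \<beta>_nonneg[OF T, of snd]
      by (intro add_mono mult_left_mono) (auto simp: mult_left_le)
    finally show ?thesis using \<pi> by (simp add: field_simps)
  qed
  \<comment> \<open>Once the moment of \<open>snd\<close> is bounded, so is the mean gain, and the
    two-point inequality gives the bound for \<open>fst\<close> as well.\<close>
  define b where "b = max (2 * D / \<pi>) (C3 * (2 * (C * G + B K + C * (2 * D / \<pi> + 1)) + 1) / \<pi>)"
  have bound: "\<beta> T f \<le> b" if T: "T \<ge> 0" and f: "f = fst \<or> f = snd" for T f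
  proof -
    have "C * (\<beta> T snd + 1) * tail K \<le> C * (2 * D / \<pi> + 1) * 1"
      using \<beta>q[OF T] C tail \<beta>_nonneg[OF T, of snd] by (intro mult_mono mult_left_mono) auto
    then have "\<Gamma> T \<le> C * G + B K + C * (2 * D / \<pi> + 1)" using \<Gamma>_le[OF T K(1)] by linarith
    then have "C3 * (2 * \<Gamma> T + 1) \<le> C3 * (2 * (C * G + B K + C * (2 * D / \<pi> + 1)) + 1)"
      using C3 by (intro mult_left_mono) auto
    then have "\<beta> T f * \<pi> \<le> C3 * (2 * (C * G + B K + C * (2 * D / \<pi> + 1)) + 1)"
      using \<beta>_le[OF T f] by linarith
    then show ?thesis unfolding b_def using \<pi> by (simp add: le_max_iff_disj le_divide_eq)
  qed
  have "integrable \<mu> (\<lambda>p. F (log1p (f p)))" if f: "f = fst \<or> f = snd" for f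
  proof -
    have [measurable]: "f \<in> borel_measurable \<mu>" using f by auto
    have SUP: "(SUP n. ennreal (B_trunc (real n) z)) = ennreal (B (log1p z))" for z
    proof (rule antisym)
      show "(SUP n. ennreal (B_trunc (real n) z)) \<le> ennreal (B (log1p z))"
        by (intro SUP_least ennreal_leI B_trunc_le_B) simp
      obtain n where "log1p z \<le> real n" using real_arch_simple by blast
      then have "B_trunc (real n) z = B (log1p z)" by (simp add: B_trunc_def)
      then show "ennreal (B (log1p z)) \<le> (SUP n. ennreal (B_trunc (real n) z))" by (metis SUP_upper UNIV_I)
    qed
    have "(\<integral>\<^sup>+p. ennreal (B (log1p (f p))) \<partial>\<mu>) = (\<integral>\<^sup>+p. (SUP n. ennreal (B_trunc (real n) (f p))) \<partial>\<mu>)"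
      by (simp add: SUP)
    also have "\<dots> = (SUP n. \<integral>\<^sup>+p. ennreal (B_trunc (real n) (f p)) \<partial>\<mu>)"
    proof (rule nn_integral_monotone_convergence_SUP)
      show "incseq (\<lambda>n p. ennreal (B_trunc (real n) (f p)))"
        by (auto simp: incseq_def le_fun_def B_trunc_def intro!: ennreal_leI B_mono)
    qed measurable
    also have "\<dots> \<le> ennreal b"
    proof (rule SUP_least)
      fix n
      have "(\<integral>\<^sup>+p. ennreal (B_trunc (real n) (f p)) \<partial>\<mu>) = ennreal (\<beta> (real n) f)"
        unfolding \<beta>_def by (intro nn_integral_eq_integral integrable_B_trunc prob_space_axioms AE_I2 B_trunc_nonneg) auto
      also have "\<dots> \<le> ennreal b" using f by (intro ennreal_leI bound) auto
      finally show "(\<integral>\<^sup>+p. ennreal (B_trunc (real n) (f p)) \<partial>\<mu>) \<le> ennreal b" .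
    qed
    finally have "(\<integral>\<^sup>+p. ennreal (B (log1p (f p))) \<partial>\<mu>) < \<infinity>" by (rule le_less_trans) simp
    then have intB: "integrable \<mu> (\<lambda>p. B (log1p (f p)))"
      using B_nonneg by (intro integrableI_nonneg) auto
    obtain C4 where C4: "C4 > 0" "\<And>y. y \<ge> 0 \<Longrightarrow> F y \<le> C4 * (B y + 1)" using F_le_B by auto
    show ?thesis
    proof (rule Bochner_Integration.integrable_bound)
      show "integrable \<mu> (\<lambda>p. C4 * (B (log1p (f p)) + 1))" using intB by auto
      show "(\<lambda>p. F (log1p (f p))) \<in> borel_measurable \<mu>" by (rule measurable_F) auto
      show "AE p in \<mu>. norm (F (log1p (f p))) \<le> norm (C4 * (B (log1p (f p)) + 1))"
        using C4 F_pos by (intro AE_I2) (auto simp: abs_of_pos intro: order_trans[OF _ abs_ge_self])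
    qed
  qed
  then show "integrable \<mu> (\<lambda>p. F (log1p (fst p)))" "integrable \<mu> (\<lambda>p. F (log1p (snd p)))" by blast+
qed

end

section \<open>Moments of the perpetuity\<close>

context pair_sequence
begin

definition prods :: "nat \<Rightarrow> (nat \<Rightarrow> real \<times> real) \<Rightarrow> real" where
  "prods n X = (\<Prod>k<n. fst (X k))"

definition Zsum :: "nat \<Rightarrow> (nat \<Rightarrow> real \<times> real) \<Rightarrow> real" where
  "Zsum n X = (\<Sum>k<n. prods k X * snd (X k))"

definition Zabs :: "nat \<Rightarrow> (nat \<Rightarrow> real \<times> real) \<Rightarrow> real" where
  "Zabs n X = (\<Sum>k<n. \<bar>prods k X * snd (X k)\<bar>)"

lemma prods_cons: "prods (Suc n) (case_nat p X) = fst p * prods n X"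
  unfolding prods_def by (subst prod.lessThan_Suc_shift) simp

lemma Zsum_cons: "Zsum (Suc n) (case_nat p X) = snd p + fst p * Zsum n X"
  unfolding Zsum_def by (subst sum.lessThan_Suc_shift)
    (simp add: prods_cons sum_distrib_left mult.assoc, simp add: prods_def)

lemma Zabs_cons: "Zabs (Suc n) (case_nat p X) = \<bar>snd p\<bar> + \<bar>fst p\<bar> * Zabs n X"
  unfolding Zabs_def by (subst sum.lessThan_Suc_shift)
    (simp add: prods_cons sum_distrib_left mult.assoc abs_mult, simp add: prods_def)

lemma measurable_prods [measurable]: "prods n \<in> borel_measurable S"
  unfolding prods_def by measurable

lemma measurable_Zsum [measurable]: "Zsum n \<in> borel_measurable S"
  unfolding Zsum_def by measurable

lemma measurable_Zabs [measurable]: "Zabs n \<in> borel_measurable S"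
  unfolding Zabs_def by measurable

lemma Zabs_nonneg: "Zabs n X \<ge> 0"
  unfolding Zabs_def by (intro sum_nonneg) simp

lemma Zabs_mono: "m \<le> n \<Longrightarrow> Zabs m X \<le> Zabs n X"
  unfolding Zabs_def by (intro sum_mono2) auto

lemma Zsum_le_Zabs: "\<bar>Zsum n X\<bar> \<le> Zabs n X"
  unfolding Zsum_def Zabs_def by (rule sum_abs)

end

sublocale perpetuity \<subseteq> pair_sequence \<mu>
  by unfold_locales (rule sets_mu)

lemma log1p_mono: "\<bar>x\<bar> \<le> \<bar>y\<bar> \<Longrightarrow> log1p x \<le> log1p y"
  unfolding log1p_def by (intro ln_mono) (auto intro: add_pos_nonneg)

lemma exp_log1p: "exp (log1p z) = 1 + \<bar>z\<bar>"
  unfolding log1p_def by (intro exp_ln) (auto intro: add_pos_nonneg)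

context perpetuity
begin

lemma measurable_g_log1p [measurable (raw)]:
  "f \<in> borel_measurable K \<Longrightarrow> (\<lambda>x. g (log1p (f x))) \<in> borel_measurable K"
  by (rule measurable_g) auto

text \<open>One step of the recursion shows that \<open>e (Suc n)\<close> plus the mean in question
  is at most \<open>e n + C\<close>. Since \<open>e\<close> is nondecreasing, \<open>e n\<close>
  cancels; for this each \<open>e n\<close> is finite by induction, although the sequence may be
  unbounded in \<open>n\<close>.\<close>

lemma perpetuity_moment_bound:
  assumes c: "c > 0" and C: "\<And>y. y \<ge> 0 \<Longrightarrow>
      integrable \<mu> (\<lambda>p. B (log_step y p)) \<and> (\<integral>p. B (log_step y p) \<partial>\<mu>) + c * g y \<le> B y + C"
  shows "(\<integral>\<^sup>+X. ennreal (c * g (log1p (Zabs n X))) \<partial>S) \<le> ennreal C"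
proof -
  define e where "e n = (\<integral>\<^sup>+X. ennreal (B (log1p (Zabs n X))) \<partial>S)" for n
  have "C \<ge> 0"
  proof -
    have "0 \<le> (\<integral>p. B (log_step 0 p) \<partial>\<mu>)"
      by (intro Bochner_Integration.integral_nonneg B_nonneg log_step_nonneg) auto
    moreover have "0 < c * g 0" using c g_pos[of 0] by simp
    ultimately show ?thesis using C[of 0] by simp
  qed
  have step: "e (Suc n) + (\<integral>\<^sup>+X. ennreal (c * g (log1p (Zabs n X))) \<partial>S) \<le> e n + ennreal C" for n
  proof -
    have "e (Suc n) = (\<integral>\<^sup>+z. ennreal (B (log1p (Zabs (Suc n) (case_nat (fst z) (snd z))))) \<partial>(\<mu> \<Otimes>\<^sub>M S))"
      unfolding e_def by (rule nn_integral_cons) measurable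
    also have "\<dots> = (\<integral>\<^sup>+z. ennreal (B (log_step (log1p (Zabs n (snd z))) (fst z))) \<partial>(\<mu> \<Otimes>\<^sub>M S))"
      by (simp add: Zabs_cons log_step_log1p Zabs_nonneg)
    also have "\<dots> = (\<integral>\<^sup>+X. \<integral>\<^sup>+p. ennreal (B (log_step (log1p (Zabs n X)) p)) \<partial>\<mu> \<partial>S)"
      unfolding log_step_def by (subst pS.nn_integral_snd[symmetric]) (auto simp: case_prod_beta)
    also have "\<dots> = (\<integral>\<^sup>+X. ennreal (\<integral>p. B (log_step (log1p (Zabs n X)) p) \<partial>\<mu>) \<partial>S)"
      using C B_nonneg log_step_nonneg by (intro nn_integral_cong nn_integral_eq_integral) auto
    finally have eq: "e (Suc n) = (\<integral>\<^sup>+X. ennreal (\<integral>p. B (log_step (log1p (Zabs n X)) p) \<partial>\<mu>) \<partial>S)" .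
    have [measurable]: "(\<lambda>X. \<integral>p. B (log_step (log1p (Zabs n X)) p) \<partial>\<mu>) \<in> borel_measurable S"
      unfolding log_step_def by measurable
    have "e (Suc n) + (\<integral>\<^sup>+X. ennreal (c * g (log1p (Zabs n X))) \<partial>S) =
        (\<integral>\<^sup>+X. ennreal (\<integral>p. B (log_step (log1p (Zabs n X)) p) \<partial>\<mu>) + ennreal (c * g (log1p (Zabs n X))) \<partial>S)"
      unfolding eq by (rule nn_integral_add[symmetric]) measurable
    also have "\<dots> \<le> (\<integral>\<^sup>+X. ennreal (B (log1p (Zabs n X))) + ennreal C \<partial>S)"
    proof (rule nn_integral_mono)
      fix X
      have "0 \<le> (\<integral>p. B (log_step (log1p (Zabs n X)) p) \<partial>\<mu>)"
        using B_nonneg log_step_nonneg by (intro Bochner_Integration.integral_nonneg) auto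
      then show "ennreal (\<integral>p. B (log_step (log1p (Zabs n X)) p) \<partial>\<mu>) + ennreal (c * g (log1p (Zabs n X)))
          \<le> ennreal (B (log1p (Zabs n X))) + ennreal C"
        using C[of "log1p (Zabs n X)"] c g_pos[of "log1p (Zabs n X)"] B_nonneg[of "log1p (Zabs n X)"] \<open>C \<ge> 0\<close>
        by (simp flip: ennreal_plus)
    qed
    also have "\<dots> = e n + ennreal C"
      unfolding e_def by (subst nn_integral_add) (auto simp: seq.P.emeasure_space_1 simp del: space_S)
    finally show ?thesis .
  qed
  have fin: "e n < \<infinity>" for n
  proof (induction n)
    case (Suc n)
    have "e (Suc n) \<le> e n + ennreal C" using step[of n] by (meson add_increasing2 order_trans le_iff_add)
    also have "\<dots> < \<infinity>" using Suc by simp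
    finally show ?case .
  qed (simp add: e_def Zabs_def log1p_def)
  have "e n \<le> e (Suc n)"
    unfolding e_def by (intro nn_integral_mono ennreal_leI B_mono log1p_mono)
      (auto simp: Zabs_nonneg intro: Zabs_mono)
  then have "e n + (\<integral>\<^sup>+X. ennreal (c * g (log1p (Zabs n X))) \<partial>S) \<le> e n + ennreal C"
    using step[of n] by (meson add_right_mono order_trans)
  then show ?thesis using fin[of n] by (auto simp: ennreal_add_left_cancel_le)
qed

lemma perpetuity_moment:
  assumes FM: "integrable \<mu> (\<lambda>p. F (log1p (fst p)))" and FQ: "integrable \<mu> (\<lambda>p. F (log1p (snd p)))"
    and lim: "AE X in S. (\<lambda>n. prods n X) \<longlonglongrightarrow> 0"
  shows "AE X in S. convergent (\<lambda>n. Zsum n X)"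
    and "(\<integral>\<^sup>+X. ennreal (g (log1p (lim (\<lambda>n. Zsum n X)))) \<partial>S) < \<infinity>"
proof -
  have nz: "AE X in S. \<forall>k. fst (X k) \<noteq> 0"
    by (rule AE_all[OF M_nonzero]) measurable
  \<comment> \<open>Products tending to 0 mean a walk tending to minus infinity; this is the input
    of \<open>negative_mean\<close>, which \<open>drift\<close> needs.\<close>
  have walk: "AE X in S. filterlim (walk X) at_bot sequentially"
    using lim nz
  proof eventually_elim
    case (elim X)
    have pos: "\<bar>prods n X\<bar> > 0" for n using elim(2) by (simp add: prods_def)
    have "filterlim (\<lambda>n. \<bar>prods n X\<bar>) (at_right 0) sequentially"
      using tendsto_rabs_zero[OF elim(1)] pos by (auto simp: filterlim_at)
    from filterlim_compose[OF ln_at_0 this] have "filterlim (\<lambda>n. ln \<bar>prods n X\<bar>) at_bot sequentially" .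
    moreover have "ln \<bar>prods n X\<bar> = walk X n" for n
      using elim(2) by (simp add: prods_def walk_def abs_prod ln_prod)
    ultimately show ?case by simp
  qed
  obtain c C where c: "c > 0" and C: "\<And>y. y \<ge> 0 \<Longrightarrow>
      integrable \<mu> (\<lambda>p. B (log_step y p)) \<and> (\<integral>p. B (log_step y p) \<partial>\<mu>) + c * g y \<le> B y + C"
    using drift[OF FM FQ] negative_mean[OF _ walk] by meson
  define s where "s X = (SUP n. ennreal (c * g (log1p (Zabs n X))))" for X
  have [measurable]: "s \<in> borel_measurable S" unfolding s_def by measurable
  have "(\<integral>\<^sup>+X. s X \<partial>S) = (SUP n. \<integral>\<^sup>+X. ennreal (c * g (log1p (Zabs n X))) \<partial>S)"
    unfolding s_def
  proof (rule nn_integral_monotone_convergence_SUP)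
    show "incseq (\<lambda>n X. ennreal (c * g (log1p (Zabs n X))))"
      using c by (auto simp: incseq_def le_fun_def Zabs_nonneg intro!: ennreal_leI mult_left_mono g_mono log1p_mono Zabs_mono)
  qed measurable
  also have "\<dots> \<le> ennreal C" by (intro SUP_least perpetuity_moment_bound c C)
  finally have s_le: "(\<integral>\<^sup>+X. s X \<partial>S) \<le> ennreal C" .
  then have "(\<integral>\<^sup>+X. s X \<partial>S) \<noteq> \<infinity>" by (auto simp: top_unique)
  then have fin: "AE X in S. s X \<noteq> \<infinity>" by (intro nn_integral_PInf_AE) auto
  \<comment> \<open>A finite \<open>s X\<close> bounds \<open>g\<close> along the sums of absolute
    values. As \<open>g\<close> is unbounded, these sums are bounded, so the series converges
    absolutely, and continuity of \<open>g\<close> carries the bound to the limit.\<close>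
  have key: "convergent (\<lambda>n. Zsum n X) \<and> ennreal (c * g (log1p (lim (\<lambda>n. Zsum n X)))) \<le> s X" if "s X \<noteq> \<infinity>" for X
  proof -
    have le: "c * g (log1p (Zabs n X)) \<le> enn2real (s X)" for n
    proof -
      have "ennreal (c * g (log1p (Zabs n X))) \<le> s X"
        unfolding s_def by (rule SUP_upper) simp
      also have "\<dots> = ennreal (enn2real (s X))" using that by (simp add: less_top)
      finally show ?thesis by (simp add: ennreal_le_iff)
    qed
    obtain y where y: "\<And>x. x \<ge> y \<Longrightarrow> g x > enn2real (s X) / c"
      using g_unbounded by (auto simp: filterlim_at_top_dense eventually_at_top_linorder)
    have "log1p (Zabs n X) \<le> y" for n
      using le[of n] y[of "log1p (Zabs n X)"] c by (force simp: divide_less_eq mult.commute not_le)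
    then have "exp (log1p (Zabs n X)) \<le> exp y" for n by simp
    then have "1 + \<bar>Zabs n X\<bar> \<le> exp y" for n by (simp add: exp_log1p)
    then have bd: "Zabs n X \<le> exp y" for n by (smt (verit))
    have "summable (\<lambda>k. \<bar>prods k X * snd (X k)\<bar>)"
      by (rule bounded_imp_summable[where B = "exp y"])
         (use bd[of "Suc n" for n] in \<open>auto simp: Zabs_def lessThan_Suc_atMost\<close>)
    then have "summable (\<lambda>k. prods k X * snd (X k))" by (rule summable_rabs_cancel)
    then have conv: "convergent (\<lambda>n. Zsum n X)"
      unfolding Zsum_def by (simp add: summable_iff_convergent)
    then have "(\<lambda>n. Zsum n X) \<longlonglongrightarrow> lim (\<lambda>n. Zsum n X)" by (simp add: convergent_LIMSEQ_iff)
    then have "(\<lambda>n. log1p (Zsum n X)) \<longlonglongrightarrow> log1p (lim (\<lambda>n. Zsum n X))"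
      unfolding log1p_def by (intro tendsto_intros) (auto simp: add_nonneg_eq_0_iff)
    then have "(\<lambda>n. g (log1p (Zsum n X))) \<longlonglongrightarrow> g (log1p (lim (\<lambda>n. Zsum n X)))"
      by (intro continuous_on_tendsto_compose[OF continuous_g]) auto
    then have "(\<lambda>n. c * g (log1p (Zsum n X))) \<longlonglongrightarrow> c * g (log1p (lim (\<lambda>n. Zsum n X)))"
      by (intro tendsto_mult tendsto_const)
    moreover have "c * g (log1p (Zsum n X)) \<le> enn2real (s X)" for n
    proof -
      have "c * g (log1p (Zsum n X)) \<le> c * g (log1p (Zabs n X))"
        using c Zsum_le_Zabs Zabs_nonneg by (intro mult_left_mono g_mono log1p_mono) auto
      with le show ?thesis by (rule order_trans[rotated])
    qed
    ultimately have "c * g (log1p (lim (\<lambda>n. Zsum n X))) \<le> enn2real (s X)"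
      by (intro LIMSEQ_le_const2) auto
    then have "ennreal (c * g (log1p (lim (\<lambda>n. Zsum n X)))) \<le> ennreal (enn2real (s X))" by (rule ennreal_leI)
    also have "\<dots> = s X" using that by (simp add: less_top)
    finally show ?thesis using conv by simp
  qed
  show "AE X in S. convergent (\<lambda>n. Zsum n X)"
    using fin by eventually_elim (use key in blast)
  have "ennreal c * (\<integral>\<^sup>+X. ennreal (g (log1p (lim (\<lambda>n. Zsum n X)))) \<partial>S)
      = (\<integral>\<^sup>+X. ennreal (c * g (log1p (lim (\<lambda>n. Zsum n X)))) \<partial>S)"
  proof -
    have "(\<lambda>X. lim (\<lambda>n. Zsum n X)) \<in> borel_measurable S" by (rule borel_measurable_lim_metric) measurable
    then show ?thesis
      using c g_pos by (subst nn_integral_cmult[symmetric]) (auto simp: ennreal_mult less_imp_le)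
  qed
  also have "\<dots> \<le> (\<integral>\<^sup>+X. s X \<partial>S)"
    by (rule nn_integral_mono_AE) (use fin in eventually_elim, use key in blast)
  also have "\<dots> < \<infinity>" using le_less_trans[OF s_le] by simp
  finally show "(\<integral>\<^sup>+X. ennreal (g (log1p (lim (\<lambda>n. Zsum n X)))) \<partial>S) < \<infinity>"
    using c by (auto simp: ennreal_mult_less_top)
qed

end

section \<open>The law of the perpetuity\<close>

context pair_sequence
begin

section \<open>The truncated mean as a gauge\<close>

lemma integrable_min_neg_log [simp]: "integrable \<mu> (\<lambda>p. min (neg_log (fst p)) x)"
proof (rule integrable_const_bound[where B = "\<bar>x\<bar>"])
  show "AE p in \<mu>. norm (min (neg_log (fst p)) x) \<le> \<bar>x\<bar>"
    by (rule AE_I2) (use neg_log_nonneg in \<open>auto simp: min_def intro: order_trans[OF _ abs_ge_self]\<close>)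
qed measurable

lemma trunc_mean_mono: "u \<le> v \<Longrightarrow> trunc_mean \<mu> u \<le> trunc_mean \<mu> v"
  unfolding trunc_mean_def by (intro Bochner_Integration.integral_mono) auto

lemma measurable_trunc_mean [measurable]: "trunc_mean \<mu> \<in> borel_measurable borel"
  by (intro borel_measurable_mono monoI trunc_mean_mono)

lemma trunc_mean_scale:
  assumes "0 < u" "u \<le> v" shows "u * trunc_mean \<mu> v \<le> v * trunc_mean \<mu> u"
proof -
  have "(\<integral>p. u * min (neg_log (fst p)) v \<partial>\<mu>) \<le> (\<integral>p. v * min (neg_log (fst p)) u \<partial>\<mu>)"
  proof (rule Bochner_Integration.integral_mono)
    fix p :: "real \<times> real"
    have "u * min n v \<le> v * min n u" if "n \<ge> 0" for n
      using assms that mult_right_mono[of u v n] mult_left_mono[of n v u] mult_left_mono[of v n u]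
      by (auto simp: min_def mult.commute)
    then show "u * min (neg_log (fst p)) v \<le> v * min (neg_log (fst p)) u" by simp
  qed auto
  then show ?thesis by (simp add: trunc_mean_def)
qed

lemma trunc_mean_pos:
  assumes "AE p in \<mu>. fst p \<noteq> 0" "\<not> (AE p in \<mu>. \<bar>fst p\<bar> \<ge> 1)" "x > 0"
  shows "trunc_mean \<mu> x > 0"
proof (rule ccontr)
  assume "\<not> ?thesis"
  moreover have "trunc_mean \<mu> x \<ge> 0"
    unfolding trunc_mean_def using assms(3) by (intro Bochner_Integration.integral_nonneg) auto
  ultimately have "(\<integral>p. min (neg_log (fst p)) x \<partial>\<mu>) = 0" by (simp add: trunc_mean_def)
  then have "AE p in \<mu>. min (neg_log (fst p)) x = 0"
    using assms(3) by (subst (asm) integral_nonneg_eq_0_iff_AE) auto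
  with assms(1) have "AE p in \<mu>. \<bar>fst p\<bar> \<ge> 1"
  proof eventually_elim
    case (elim p)
    then have "ln \<bar>fst p\<bar> \<ge> 0" using assms(3) by (auto simp: min_def neg_log_def max_def split: if_splits)
    then show ?case using elim(1) by (simp add: ln_ge_zero_iff)
  qed
  then show False using assms(2) by simp
qed

lemma distr_component: "distr S \<mu> (\<lambda>X. X n) = \<mu>"
  using distr_PiM_component[of UNIV "\<lambda>_. \<mu>" n] prob_space_axioms by simp

section \<open>Multipliers of modulus at least 1\<close>

lemma not_tendsto_zero_if_expanding:
  assumes "AE p in \<mu>. \<bar>fst p\<bar> \<ge> 1"
  shows "\<not> (AE X in S. (\<lambda>n. prods n X) \<longlonglongrightarrow> 0)"
proof
  assume lim: "AE X in S. (\<lambda>n. prods n X) \<longlonglongrightarrow> 0"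
  have "AE X in S. \<forall>k. \<bar>fst (X k)\<bar> \<ge> 1" by (rule AE_all[OF assms]) measurable
  with lim have "AE X in S. False"
  proof eventually_elim
    case (elim X)
    have "\<bar>prods n X\<bar> \<ge> 1" for n using elim(2) by (simp add: prods_def abs_prod prod_ge_1)
    moreover have "\<forall>\<^sub>F n in sequentially. \<bar>prods n X\<bar> < 1"
      using tendsto_rabs_zero[OF elim(1)] by (rule order_tendstoD(2)) simp
    ultimately show False by (simp add: not_less[symmetric])
  qed
  then show False by simp
qed

text \<open>The terms of the convergent series tend to 0, and the products cannot make them small,
  so \<open>snd (X n)\<close> tends to 0; as its law does not depend on \<open>n\<close>, it
  vanishes almost surely. This is where the assumption that Q is not almost surely 0 enters the
  theorem.\<close>

lemma expanding_convergent_imp_zero: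
  assumes exp: "AE p in \<mu>. \<bar>fst p\<bar> \<ge> 1" and conv: "AE X in S. convergent (\<lambda>n. Zsum n X)"
  shows "AE p in \<mu>. snd p = 0"
proof -
  have "AE X in S. \<forall>k. \<bar>fst (X k)\<bar> \<ge> 1" by (rule AE_all[OF exp]) measurable
  with conv have lim: "AE X in S. (\<lambda>n. snd (X n)) \<longlonglongrightarrow> 0"
  proof eventually_elim
    case (elim X)
    have "summable (\<lambda>n. prods n X * snd (X n))"
      using elim(1) by (simp add: summable_iff_convergent Zsum_def)
    then have "(\<lambda>n. prods n X * snd (X n)) \<longlonglongrightarrow> 0" by (rule summable_LIMSEQ_zero)
    then show ?case
    proof (rule Lim_null_comparison[rotated, OF tendsto_rabs_zero])
      have "\<bar>prods n X\<bar> \<ge> 1" for n using elim(2) by (simp add: prods_def abs_prod prod_ge_1)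
      then have "1 * \<bar>snd (X n)\<bar> \<le> \<bar>prods n X\<bar> * \<bar>snd (X n)\<bar>" for n by (intro mult_right_mono) auto
      then show "\<forall>\<^sub>F n in sequentially. norm (snd (X n)) \<le> \<bar>prods n X * snd (X n)\<bar>"
        by (simp add: abs_mult)
    qed
  qed
  \<comment> \<open>A bounded test function, so that dominated convergence works without a moment of
    \<open>snd p\<close>.\<close>
  define f where "f q = min 1 \<bar>q\<bar>" for q :: real
  have [measurable]: "f \<in> borel_measurable borel" unfolding f_def by measurable
  have "(\<lambda>n. \<integral>X. f (snd (X n)) \<partial>S) \<longlonglongrightarrow> (\<integral>X. 0 \<partial>S)"
  proof (rule integral_dominated_convergence[where w = "\<lambda>_. 1"])
    show "AE X in S. (\<lambda>n. f (snd (X n))) \<longlonglongrightarrow> 0"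
      using lim
    proof eventually_elim
      case (elim X)
      from tendsto_min[OF tendsto_const tendsto_rabs_zero[OF this], of 1] show ?case by (simp add: f_def)
    qed
  qed (auto simp: f_def)
  moreover have "(\<integral>X. f (snd (X n)) \<partial>S) = (\<integral>p. f (snd p) \<partial>\<mu>)" for n
  proof -
    have "(\<integral>p. f (snd p) \<partial>\<mu>) = (\<integral>p. f (snd p) \<partial>distr S \<mu> (\<lambda>X. X n))" by (simp only: distr_component)
    also have "\<dots> = (\<integral>X. f (snd (X n)) \<partial>S)" by (rule integral_distr) measurable
    finally show ?thesis by simp
  qed
  ultimately have "(\<integral>p. f (snd p) \<partial>\<mu>) = 0" by (simp add: LIMSEQ_const_iff)
  moreover have "integrable \<mu> (\<lambda>p. f (snd p))"
    by (rule integrable_const_bound[where B = 1]) (auto simp: f_def)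
  ultimately have "AE p in \<mu>. f (snd p) = 0"
    by (subst (asm) integral_nonneg_eq_0_iff_AE) (auto simp: f_def)
  then show ?thesis by eventually_elim (auto simp: f_def min_def split: if_splits)
qed

section \<open>The limit and the invariance of its law\<close>

definition Zlim :: "(nat \<Rightarrow> real \<times> real) \<Rightarrow> real" where
  "Zlim X = lim (\<lambda>n. Zsum n X)"

lemma measurable_Zlim [measurable]: "Zlim \<in> borel_measurable S"
  unfolding Zlim_def by (rule borel_measurable_lim_metric) measurable

lemma Zlim_cons:
  assumes "convergent (\<lambda>n. Zsum n X)"
  shows "Zlim (case_nat p X) = snd p + fst p * Zlim X"
proof -
  have "(\<lambda>n. Zsum n X) \<longlonglongrightarrow> Zlim X" using assms by (simp add: Zlim_def convergent_LIMSEQ_iff)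
  then have "(\<lambda>n. snd p + fst p * Zsum n X) \<longlonglongrightarrow> snd p + fst p * Zlim X" by (intro tendsto_intros)
  then have "(\<lambda>n. Zsum (Suc n) (case_nat p X)) \<longlonglongrightarrow> snd p + fst p * Zlim X" by (simp add: Zsum_cons)
  then have "(\<lambda>n. Zsum n (case_nat p X)) \<longlonglongrightarrow> snd p + fst p * Zlim X" by (rule LIMSEQ_imp_Suc)
  then show ?thesis unfolding Zlim_def by (rule limI)
qed

lemma Zlim_law_invariant:
  assumes conv: "AE X in S. convergent (\<lambda>n. Zsum n X)"
  shows "distr (\<mu> \<Otimes>\<^sub>M distr S borel Zlim) borel (\<lambda>w. snd (fst w) + fst (fst w) * snd w) = distr S borel Zlim"
proof -
  have id: "distr \<mu> \<mu> (\<lambda>p. p) = \<mu>" by (simp add: distr_id)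
  interpret \<nu>: prob_space "distr S borel Zlim" by (rule seq.P.prob_space_distr) measurable
  have "\<mu> \<Otimes>\<^sub>M distr S borel Zlim = distr \<mu> \<mu> (\<lambda>p. p) \<Otimes>\<^sub>M distr S borel Zlim" by (simp add: id)
  also have "\<dots> = distr (\<mu> \<Otimes>\<^sub>M S) (\<mu> \<Otimes>\<^sub>M borel) (\<lambda>(p, X). (p, Zlim X))"
    by (rule pair_measure_distr) (auto intro: \<nu>.sigma_finite_measure_axioms)
  finally have "distr (\<mu> \<Otimes>\<^sub>M distr S borel Zlim) borel (\<lambda>w. snd (fst w) + fst (fst w) * snd w) =
      distr (distr (\<mu> \<Otimes>\<^sub>M S) (\<mu> \<Otimes>\<^sub>M borel) (\<lambda>(p, X). (p, Zlim X))) borel (\<lambda>w. snd (fst w) + fst (fst w) * snd w)"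
    by simp
  also have "\<dots> = distr (\<mu> \<Otimes>\<^sub>M S) borel ((\<lambda>w. snd (fst w) + fst (fst w) * snd w) \<circ> (\<lambda>(p, X). (p, Zlim X)))"
    by (rule distr_distr) measurable
  also have "\<dots> = distr (\<mu> \<Otimes>\<^sub>M S) borel (Zlim \<circ> (\<lambda>(p, X). case_nat p X))"
  proof (rule distr_cong_AE)
    show "AE z in \<mu> \<Otimes>\<^sub>M S. ((\<lambda>w. snd (fst w) + fst (fst w) * snd w) \<circ> (\<lambda>(p, X). (p, Zlim X))) z =
        (Zlim \<circ> (\<lambda>(p, X). case_nat p X)) z"
      using AE_snd[OF conv] by eventually_elim (simp add: case_prod_beta Zlim_cons)
    show "(Zlim \<circ> (\<lambda>(p, X). case_nat p X)) \<in> borel_measurable (\<mu> \<Otimes>\<^sub>M S)"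
      by (rule measurable_comp[OF measurable_cons measurable_Zlim])
  qed (auto simp: comp_def case_prod_beta)
  also have "\<dots> = distr (distr (\<mu> \<Otimes>\<^sub>M S) S (\<lambda>(p, X). case_nat p X)) borel Zlim"
    by (rule distr_distr[symmetric]) measurable
  finally show ?thesis by (simp only: seq.PiM_iter)
qed

end

section \<open>Translation from the given variables to the law of one pair\<close>

lemma A_fun_eq_trunc_mean:
  fixes P :: "'a measure"
  assumes "prob_space P" and [measurable]: "M \<in> borel_measurable P" "Q \<in> borel_measurable P" and x: "x \<ge> 0"
  shows "A_fun P M x = ennreal (trunc_mean (distr P (borel \<Otimes>\<^sub>M borel) (\<lambda>\<omega>. (M \<omega>, Q \<omega>))) x)"
proof -
  interpret P: prob_space P by fact
  interpret PL: pair_sigma_finite P lborel ..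
  have "A_fun P M x = (\<integral>\<^sup>+y. (\<integral>\<^sup>+\<omega>. indicator {0..x} y * indicator {\<omega> \<in> space P. - ln \<bar>M \<omega>\<bar> > y} \<omega> \<partial>P) \<partial>lborel)"
    unfolding A_fun_def by (intro nn_integral_cong) (simp add: nn_integral_cmult mult.commute)
  also have "\<dots> = (\<integral>\<^sup>+y. (\<integral>\<^sup>+\<omega>. (if 0 \<le> y \<and> y \<le> x \<and> - ln \<bar>M \<omega>\<bar> > y then 1 else 0) \<partial>P) \<partial>lborel)"
    by (intro nn_integral_cong) (auto simp: indicator_def)
  \<comment> \<open>The layer-cake formula: for fixed \<open>\<omega>\<close> the levels
    \<open>y\<close> form an interval whose length is the truncated value.\<close>
  also have "\<dots> = (\<integral>\<^sup>+\<omega>. (\<integral>\<^sup>+y. (if 0 \<le> y \<and> y \<le> x \<and> - ln \<bar>M \<omega>\<bar> > y then 1 else 0) \<partial>lborel) \<partial>P)"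
    by (rule PL.Fubini') measurable
  also have "\<dots> = (\<integral>\<^sup>+\<omega>. ennreal (min (neg_log (M \<omega>)) x) \<partial>P)"
  proof (rule nn_integral_cong)
    fix \<omega>
    define v where "v = - ln \<bar>M \<omega>\<bar>"
    have "(\<integral>\<^sup>+y. (if 0 \<le> y \<and> y \<le> x \<and> v > y then 1 else 0) \<partial>lborel) =
        (\<integral>\<^sup>+y. indicator ({0..x} \<inter> {..<v}) y \<partial>lborel)"
      by (intro nn_integral_cong) (auto simp: indicator_def)
    also have "\<dots> = emeasure lborel ({0..x} \<inter> {..<v})" by simp
    also have "\<dots> = ennreal (min (max 0 v) x)"
    proof -
      consider "v \<le> 0" | "0 < v" "v \<le> x" | "x < v" by linarith
      then show ?thesis
      proof cases
        case 1
        then have "{0..x} \<inter> {..<v} = {}" by auto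
        then show ?thesis using 1 x by (simp add: max_def)
      next
        case 2
        then have "{0..x} \<inter> {..<v} = {0..<v}" by auto
        then show ?thesis using 2 by (simp add: max_def)
      next
        case 3
        then have "{0..x} \<inter> {..<v} = {0..x}" by auto
        then show ?thesis using 3 x by (simp add: max_def min_def)
      qed
    qed
    finally show "(\<integral>\<^sup>+y. (if 0 \<le> y \<and> y \<le> x \<and> - ln \<bar>M \<omega>\<bar> > y then 1 else 0) \<partial>lborel) =
        ennreal (min (neg_log (M \<omega>)) x)"
      by (simp add: v_def neg_log_def)
  qed
  also have "\<dots> = ennreal (\<integral>\<omega>. min (neg_log (M \<omega>)) x \<partial>P)"
  proof (rule nn_integral_eq_integral)
    show "integrable P (\<lambda>\<omega>. min (neg_log (M \<omega>)) x)"
      by (rule P.integrable_const_bound[where B = x]) (use x in \<open>auto simp: min_def\<close>)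
  qed (use x in auto)
  also have "(\<integral>\<omega>. min (neg_log (M \<omega>)) x \<partial>P) = trunc_mean (distr P (borel \<Otimes>\<^sub>M borel) (\<lambda>\<omega>. (M \<omega>, Q \<omega>))) x"
    unfolding trunc_mean_def by (subst integral_distr) auto
  finally show ?thesis .
qed

text \<open>The given variables are indexed from 1 and the canonical sequence from 0; reindexing the
  product by \<open>Suc\<close> connects them.\<close>

lemma distr_sequence:
  fixes P :: "'a measure" and X :: "nat \<Rightarrow> 'a \<Rightarrow> 'b"
  assumes "prob_space P" and rv: "\<And>n. n \<ge> 1 \<Longrightarrow> X n \<in> P \<rightarrow>\<^sub>M N"
    and indep: "prob_space.indep_vars P (\<lambda>_. N) X {1..}"
    and ident: "\<And>n. n \<ge> 1 \<Longrightarrow> distr P N (X n) = \<mu>"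
  shows "distr P (\<Pi>\<^sub>M i\<in>UNIV. \<mu>) (\<lambda>\<omega> n. X (Suc n) \<omega>) = (\<Pi>\<^sub>M i\<in>UNIV. \<mu>)"
proof -
  interpret P: prob_space P by fact
  have "sets \<mu> = sets N" using ident[of 1] by auto
  have "distr P (\<Pi>\<^sub>M i\<in>{1..}. N) (\<lambda>\<omega>. \<lambda>n\<in>{1..}. X n \<omega>) = (\<Pi>\<^sub>M i\<in>{1..}. distr P N (X i))"
    using indep by (subst (asm) P.indep_vars_iff_distr_eq_PiM') (auto intro: rv)
  also have "\<dots> = (\<Pi>\<^sub>M i\<in>{1..}. \<mu>)" by (intro PiM_cong) (auto simp: ident)
  finally have law: "distr P (\<Pi>\<^sub>M i\<in>{1..}. N) (\<lambda>\<omega>. \<lambda>n\<in>{1..}. X n \<omega>) = (\<Pi>\<^sub>M i\<in>{1..}. \<mu>)" .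
  have "prob_space \<mu>" using ident[of 1] P.prob_space_distr[OF rv[of 1]] by simp
  then have "(\<Pi>\<^sub>M i\<in>UNIV. \<mu>) = distr (\<Pi>\<^sub>M i\<in>{1..}. \<mu>) (\<Pi>\<^sub>M i\<in>UNIV. \<mu>) (\<lambda>\<omega>. \<lambda>n\<in>UNIV. \<omega> (Suc n))"
    by (intro distr_PiM_reindex[of "{1..}" "\<lambda>_. \<mu>" Suc UNIV, symmetric]) auto
  also have "\<dots> = distr P (\<Pi>\<^sub>M i\<in>UNIV. \<mu>) ((\<lambda>\<omega>. \<lambda>n\<in>UNIV. \<omega> (Suc n)) \<circ> (\<lambda>\<omega>. \<lambda>n\<in>{1..}. X n \<omega>))"
    unfolding law[symmetric]
  proof (rule distr_distr)
    show "(\<lambda>\<omega>. \<lambda>n\<in>{1..}. X n \<omega>) \<in> P \<rightarrow>\<^sub>M (\<Pi>\<^sub>M i\<in>{1..}. N)"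
      by (rule measurable_restrict) (auto intro: rv)
    show "(\<lambda>\<omega>. \<lambda>n\<in>UNIV. \<omega> (Suc n)) \<in> (\<Pi>\<^sub>M i\<in>{1..}. N) \<rightarrow>\<^sub>M (\<Pi>\<^sub>M i\<in>UNIV. \<mu>)"
      by (rule measurable_restrict)
         (use measurable_component_singleton[of "Suc n" "{1..}" "\<lambda>_. N" for n] in
           \<open>simp add: measurable_cong_sets[OF refl \<open>sets \<mu> = sets N\<close>]\<close>)
  qed
  also have "(\<lambda>\<omega>. \<lambda>n\<in>UNIV. \<omega> (Suc n)) \<circ> (\<lambda>\<omega>. \<lambda>n\<in>{1..}. X n \<omega>) = (\<lambda>\<omega> n. X (Suc n) \<omega>)"
    by (auto simp: fun_eq_iff)
  finally show ?thesis by simp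
qed

section \<open>Proof of the theorem\<close>

lemma log_plus_nonneg [simp]: "log_plus x \<ge> 0"
  by (simp add: log_plus_def)

lemma measurable_log_plus [measurable]: "log_plus \<in> borel_measurable borel"
  unfolding log_plus_def by measurable

lemma log_plus_le_log1p: "log_plus \<bar>t\<bar> \<le> log1p t"
proof (cases "t = 0")
  case False
  then have "ln \<bar>t\<bar> \<le> ln (1 + \<bar>t\<bar>)" by (intro ln_mono) auto
  then show ?thesis by (simp add: log_plus_def log1p_def)
qed (simp add: log_plus_def log1p_def)

lemma log1p_le_log_plus: "log1p t \<le> log_plus \<bar>t\<bar> + 1"
proof (cases "\<bar>t\<bar> \<le> 1")
  case True
  then have "log1p t \<le> ln 2" unfolding log1p_def by (intro ln_mono) (auto intro: add_pos_nonneg)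
  then show ?thesis using ln_2_less_1 log_plus_nonneg[of "\<bar>t\<bar>"] by linarith
next
  case False
  then have "log1p t \<le> ln (2 * \<bar>t\<bar>)" unfolding log1p_def by (intro ln_mono) (auto intro: add_pos_nonneg)
  also have "\<dots> = ln 2 + ln \<bar>t\<bar>" using False by (intro ln_mult_pos) auto
  also have "\<dots> \<le> 1 + log_plus \<bar>t\<bar>" using ln_2_less_1 by (simp add: log_plus_def)
  finally show ?thesis by simp
qed

context perpetuity
begin

text \<open>Factors and additive constants do not affect finiteness of a moment under a probability
  law. The constants absorb the small heights, where \<open>b\<close> may vanish and
  \<open>jr\<close> has its separate value at 0.\<close>

lemma moment_comparison:
  fixes b jr :: "real \<Rightarrow> real" and C t0 j0 :: real
  assumes b_nonneg: "\<And>y. y \<ge> 0 \<Longrightarrow> b y \<ge> 0"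
    and C: "C > 0" "\<And>y. y \<ge> 0 \<Longrightarrow> b y \<le> C * g y" "\<And>y. y \<ge> t0 \<Longrightarrow> g y \<le> C * b y"
    and j0: "j0 > 0" and jr: "\<And>x. jr x = (if x = 0 then j0 else x / A x)"
  obtains K where "K > 0"
    "\<And>t. F (log1p t) \<le> K * (b (log_plus \<bar>t\<bar>) * jr (log_plus \<bar>t\<bar>) + 1)"
    "\<And>t. b (log_plus \<bar>t\<bar>) * jr (log_plus \<bar>t\<bar>) \<le> K * (F (log1p t) + 1)"
    "\<And>t. g (log1p t) \<le> K * (b (log_plus \<bar>t\<bar>) + 1)"
    "\<And>t. b (log_plus \<bar>t\<bar>) \<le> K * g (log1p t)"
proof -
  have jr_nonneg: "jr x \<ge> 0" if "x \<ge> 0" for x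
    using that j0 A_pos[of x] by (auto simp: jr less_imp_le)
  have bj_nonneg: "b x * jr x \<ge> 0" if "x \<ge> 0" for x using that b_nonneg jr_nonneg by simp
  \<comment> \<open>Beyond \<open>t1\<close> both \<open>g x \<le> C * b x\<close> and
    \<open>J1 x \<le> 2 * jr x\<close> hold, the latter because \<open>1 + x \<le> 2 * x\<close>
    there.\<close>
  define t1 where "t1 = max t0 1"
  have t1: "t1 \<ge> 0" by (simp add: t1_def)
  have F_le: "F x \<le> 2 * C * (b x * jr x) + F t1" if x: "x \<ge> 0" for x
  proof (cases "x \<ge> t1")
    case True
    then have x1: "x \<ge> 1" "x \<ge> t0" by (auto simp: t1_def)
    have "J1 x \<le> 2 * x / A x"
      unfolding J1_def using x1 A_pos[of x] A_mono[of x "1 + x"] by (intro frac_le) auto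
    also have "\<dots> = 2 * jr x" using x1 by (simp add: jr)
    finally have "F x \<le> (C * b x) * (2 * jr x)"
      unfolding F_def using C(3)[OF x1(2)] g_pos[OF x] J1_pos[OF x] C(1) b_nonneg[OF x]
      by (intro mult_mono) auto
    then show ?thesis using F_pos[OF t1] by (simp add: algebra_simps)
  next
    case False
    then have "F x \<le> F t1" using x by (intro F_mono) auto
    moreover have "0 \<le> 2 * C * (b x * jr x)"
      using C(1) by (intro mult_nonneg_nonneg[OF _ bj_nonneg[OF x]]) auto
    ultimately show ?thesis by linarith
  qed
  have upper: "b x * jr x \<le> 2 * C * F x + C * g 1 * (j0 + 1 / A 1)" if x: "x \<ge> 0" for x
  proof (cases "x \<ge> 1")
    case True
    have "x * A (1 + x) \<le> (1 + x) * A x" using A_scale[of x "1 + x"] True by simp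
    then have "x / A x \<le> (1 + x) / A (1 + x)"
      using A_pos[of x] A1_pos[of x] True by (simp add: divide_le_eq le_divide_eq mult.commute)
    also have "\<dots> \<le> 2 * J1 x" using J1_pos[OF x] unfolding J1_def by linarith
    finally have "b x * jr x \<le> (C * g x) * (2 * J1 x)"
      using True C(2)[OF x] b_nonneg[OF x] g_pos[OF x] C(1) A_pos[of x] by (intro mult_mono) (auto simp: jr)
    moreover have "0 \<le> C * g 1 * (j0 + 1 / A 1)" using C(1) g_pos[of 1] j0 A_pos[of 1] by simp
    ultimately show ?thesis by (simp add: F_def)
  next
    case False
    have "jr x \<le> j0 + 1 / A 1"
    proof (cases "x = 0")
      case False
      \<comment> \<open>\<open>A\<close> vanishes at 0 no faster than linearly, so
        \<open>x / A x\<close> stays bounded there.\<close>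
      have "x * A 1 \<le> 1 * A x" using A_scale[of x 1] False x \<open>\<not> x \<ge> 1\<close> by simp
      then have "x / A x \<le> 1 / A 1" using A_pos[of x] A_pos[of 1] False x
        by (simp add: divide_le_eq le_divide_eq mult.commute)
      then show ?thesis using False j0 by (simp add: jr)
    qed (use A_pos[of 1] in \<open>simp add: jr\<close>)
    moreover have "b x \<le> C * g 1" using C(1) C(2)[OF x] g_mono[OF x, of 1] False by (smt (verit) mult_left_mono)
    ultimately have "b x * jr x \<le> (C * g 1) * (j0 + 1 / A 1)"
      using b_nonneg[OF x] jr_nonneg[OF x] C(1) g_pos[of 1] by (intro mult_mono) auto
    moreover have "0 \<le> 2 * C * F x" using F_pos[OF x] C(1) by (intro mult_nonneg_nonneg) auto
    ultimately show ?thesis by linarith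
  qed
  have g_le: "g x \<le> C * b x + g t1" if x: "x \<ge> 0" for x
  proof (cases "x \<ge> t1")
    case True
    then have "g x \<le> C * b x" by (intro C) (simp add: t1_def)
    then show ?thesis using g_pos[OF t1] by simp
  next
    case False
    then have "g x \<le> g t1" using x by (intro g_mono) auto
    moreover have "0 \<le> C * b x" using b_nonneg[OF x] C(1) by simp
    ultimately show ?thesis by linarith
  qed
  define K1 where "K1 = 2 ^ Suc k * (F 1 + F t1 + 2 * C)"
  define K2 where "K2 = 2 * C + C * g 1 * (j0 + 1 / A 1)"
  define K3 where "K3 = 2 ^ k * (C + g t1)"
  define K where "K = max (max K1 K2) (max K3 C)"
  have mono: "x * (y + 1) \<le> K * (y + 1)" if "x \<le> K" "y \<ge> 0" for x y
    using that by (intro mult_right_mono) auto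
  show thesis
  proof
    show "K > 0" using C(1) by (simp add: K_def less_max_iff_disj)
    fix t
    define l where "l = log_plus \<bar>t\<bar>"
    have l: "l \<ge> 0" "l \<le> log1p t" "log1p t \<le> l + 1"
      using log_plus_le_log1p[of t] log1p_le_log_plus[of t] by (auto simp: l_def)
    show "F (log1p t) \<le> K * (b (log_plus \<bar>t\<bar>) * jr (log_plus \<bar>t\<bar>) + 1)"
      unfolding l_def[symmetric]
    proof (rule order_trans[OF _ mono])
      have "F (log1p t) \<le> F (l + 1)" using l by (intro F_mono) auto
      also have "\<dots> \<le> 2 ^ Suc k * (F l + F 1)" using l by (intro F_add) auto
      also have "\<dots> \<le> 2 ^ Suc k * ((F 1 + F t1 + 2 * C) * (b l * jr l + 1))"
      proof (intro mult_left_mono)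
        have "0 \<le> (F 1 + F t1) * (b l * jr l)"
          using F_pos[of 1] F_pos[OF t1] by (intro mult_nonneg_nonneg[OF _ bj_nonneg[OF l(1)]]) auto
        then show "F l + F 1 \<le> (F 1 + F t1 + 2 * C) * (b l * jr l + 1)"
          using F_le[OF l(1)] C(1) by (simp add: algebra_simps)
      qed auto
      finally show "F (log1p t) \<le> K1 * (b l * jr l + 1)" by (simp add: K1_def mult.assoc)
    qed (use bj_nonneg[OF l(1)] in \<open>auto simp: K_def\<close>)
    show "b (log_plus \<bar>t\<bar>) * jr (log_plus \<bar>t\<bar>) \<le> K * (F (log1p t) + 1)"
      unfolding l_def[symmetric]
    proof (rule order_trans[OF _ mono])
      define c where "c = C * g 1 * (j0 + 1 / A 1)"
      have c: "c \<ge> 0" using C(1) g_pos[of 1] j0 A_pos[of 1] by (simp add: c_def)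
      have "b l * jr l \<le> 2 * C * F l + c" using upper[OF l(1)] by (simp add: c_def)
      also have "\<dots> \<le> 2 * C * F (log1p t) + c" using F_mono[OF l(1,2)] C(1) by simp
      also have "\<dots> \<le> (2 * C + c) * (F (log1p t) + 1)"
        using c C(1) F_pos[of "log1p t"] by (simp add: algebra_simps add_nonneg_nonneg mult_nonneg_nonneg)
      finally show "b l * jr l \<le> K2 * (F (log1p t) + 1)" by (simp add: K2_def c_def)
    qed (use F_pos[of "log1p t"] in \<open>auto simp: K_def\<close>)
    show "g (log1p t) \<le> K * (b (log_plus \<bar>t\<bar>) + 1)"
      unfolding l_def[symmetric]
    proof (rule order_trans[OF _ mono])
      have "g (log1p t) \<le> g (l + 1)" using l by (intro g_mono) auto
      also have "\<dots> \<le> 2 ^ k * g l" using g_shift[of 1 l] l by simp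
      also have "\<dots> \<le> 2 ^ k * ((C + g t1) * (b l + 1))"
      proof (intro mult_left_mono)
        have "0 \<le> g t1 * b l" using b_nonneg[OF l(1)] g_pos[OF t1] by simp
        then show "g l \<le> (C + g t1) * (b l + 1)"
          using g_le[OF l(1)] C(1) by (simp add: algebra_simps)
      qed auto
      finally show "g (log1p t) \<le> K3 * (b l + 1)" by (simp add: K3_def mult.assoc)
    qed (use b_nonneg[OF l(1)] in \<open>auto simp: K_def\<close>)
    show "b (log_plus \<bar>t\<bar>) \<le> K * g (log1p t)"
      unfolding l_def[symmetric]
    proof -
      have "b l \<le> C * g l" using l by (intro C) auto
      also have "\<dots> \<le> K * g (log1p t)"
        using l C(1) g_mono[OF l(1,2)] g_pos[OF l(1)] by (intro mult_mono) (auto simp: K_def)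
      finally show "b l \<le> K * g (log1p t)" .
    qed
  qed
qed

end

lemma nn_integral_affine_finite:
  assumes f: "f \<in> borel_measurable P" and "finite_measure P" "K \<ge> 0" "\<And>x. f x \<ge> 0"
    and fin: "(\<integral>\<^sup>+x. ennreal (f x) \<partial>P) < \<infinity>"
  shows "(\<integral>\<^sup>+x. ennreal (K * (f x + 1)) \<partial>P) < \<infinity>"
proof -
  interpret finite_measure P by fact
  have "(\<integral>\<^sup>+x. ennreal (K * (f x + 1)) \<partial>P) = (\<integral>\<^sup>+x. ennreal K * (ennreal (f x) + 1) \<partial>P)"
    using assms by (intro nn_integral_cong) (simp add: ennreal_mult' ennreal_plus)
  also have "\<dots> = ennreal K * ((\<integral>\<^sup>+x. ennreal (f x) \<partial>P) + emeasure P (space P))"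
    using f by (subst nn_integral_cmult) (auto simp: nn_integral_add)
  also have "\<dots> < \<infinity>"
  proof -
    have "emeasure P (space P) < \<infinity>" by (simp add: less_top[symmetric])
    then show ?thesis using fin by (simp add: ennreal_mult_less_top)
  qed
  finally show ?thesis .
qed

theorem theorem1p2:
  fixes P :: "'a measure"
    and Mseq Qseq :: "nat \<Rightarrow> 'a \<Rightarrow> real"
    and M Q :: "'a \<Rightarrow> real"
    and b :: "real \<Rightarrow> real" and \<alpha> :: real
  assumes "prob_space P"
    and rv_seq: "\<And>n. n \<ge> 1 \<Longrightarrow> Mseq n \<in> borel_measurable P"
                "\<And>n. n \<ge> 1 \<Longrightarrow> Qseq n \<in> borel_measurable P"
    and rv_generic: "M \<in> borel_measurable P" "Q \<in> borel_measurable P"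
    and indep: "prob_space.indep_vars P (\<lambda>_. borel \<Otimes>\<^sub>M borel)
                  (\<lambda>n \<omega>. (Mseq n \<omega>, Qseq n \<omega>)) {1..}"
    and ident: "\<And>n. n \<ge> 1 \<Longrightarrow>
                  distr P (borel \<Otimes>\<^sub>M borel) (\<lambda>\<omega>. (Mseq n \<omega>, Qseq n \<omega>))
                  = distr P (borel \<Otimes>\<^sub>M borel) (\<lambda>\<omega>. (M \<omega>, Q \<omega>))"
    and M_nonzero: "measure P {\<omega> \<in> space P. M \<omega> = 0} = 0"
    and Q_nonzero: "measure P {\<omega> \<in> space P. Q \<omega> = 0} < 1"
    and b_nonneg: "\<And>x. x \<ge> 0 \<Longrightarrow> b x \<ge> 0"
    and b_meas: "b \<in> borel_measurable (restrict_space borel {0..})"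
    and b_bdd: "locally_bounded_nonneg b"
    and b_rv: "regularly_varying b \<alpha>"
    and alpha_pos: "\<alpha> > 0"
  shows
    "((AE \<omega> in P. (\<lambda>n. Pi_prod Mseq n \<omega>) \<longlonglongrightarrow> 0)
        \<and> (\<integral>\<^sup>+\<omega>. ennreal (b (log_plus \<bar>M \<omega>\<bar>)) * J_fun P M (log_plus \<bar>M \<omega>\<bar>) \<partial>P) < \<infinity>
        \<and> (\<integral>\<^sup>+\<omega>. ennreal (b (log_plus \<bar>Q \<omega>\<bar>)) * J_fun P M (log_plus \<bar>Q \<omega>\<bar>) \<partial>P) < \<infinity>
      \<longrightarrow> Z_converges P Mseq Qseq
        \<and> (\<integral>\<^sup>+\<omega>. ennreal (b (log_plus \<bar>Z_inf Mseq Qseq \<omega>\<bar>)) \<partial>P) < \<infinity>)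
   \<and> (Z_converges P Mseq Qseq
        \<and> \<not> (\<exists>c. AE \<omega> in P. Z_inf Mseq Qseq \<omega> = c)
        \<and> (\<integral>\<^sup>+\<omega>. ennreal (b (log_plus \<bar>Z_inf Mseq Qseq \<omega>\<bar>)) \<partial>P) < \<infinity>
      \<longrightarrow> (\<integral>\<^sup>+\<omega>. ennreal (b (log_plus \<bar>M \<omega>\<bar>)) * J_fun P M (log_plus \<bar>M \<omega>\<bar>) \<partial>P) < \<infinity>
        \<and> (\<integral>\<^sup>+\<omega>. ennreal (b (log_plus \<bar>Q \<omega>\<bar>)) * J_fun P M (log_plus \<bar>Q \<omega>\<bar>) \<partial>P) < \<infinity>)"
proof -
  interpret P: prob_space P by fact
  note [measurable] = rv_generic
  define \<mu> where "\<mu> = distr P (borel \<Otimes>\<^sub>M borel) (\<lambda>\<omega>. (M \<omega>, Q \<omega>))"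
  have MQ: "(\<lambda>\<omega>. (M \<omega>, Q \<omega>)) \<in> P \<rightarrow>\<^sub>M borel \<Otimes>\<^sub>M borel" by measurable
  have mu: "prob_space \<mu>" unfolding \<mu>_def by (rule P.prob_space_distr[OF MQ])
  interpret mu: pair_sequence \<mu>
    by (intro pair_sequence.intro pair_sequence_axioms.intro mu) (simp add: \<mu>_def)
  define X where "X \<omega> n = (Mseq (Suc n) \<omega>, Qseq (Suc n) \<omega>)" for \<omega> n
  have pair: "(\<lambda>\<omega>. (Mseq n \<omega>, Qseq n \<omega>)) \<in> P \<rightarrow>\<^sub>M borel \<Otimes>\<^sub>M borel" if "n \<ge> 1" for n
    using that by (intro measurable_Pair rv_seq)
  have X_law: "distr P mu.S X = mu.S"
    unfolding X_def
    by (rule distr_sequence[OF assms(1) pair indep, of \<mu>]) (auto simp: ident \<mu>_def)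
  have [measurable]: "X \<in> P \<rightarrow>\<^sub>M mu.S"
    unfolding X_def
    by (rule measurable_PiM_single') (auto simp: pair measurable_cong_sets[OF refl mu.sets_pair])
  have AE_X: "(AE \<omega> in P. R (X \<omega>)) \<longleftrightarrow> (AE x in mu.S. R x)" if [measurable]: "Measurable.pred mu.S R" for R
  proof -
    have "(AE x in mu.S. R x) \<longleftrightarrow> (AE x in distr P mu.S X. R x)" by (simp only: X_law)
    also have "\<dots> \<longleftrightarrow> (AE \<omega> in P. R (X \<omega>))" by (rule AE_distr_iff) measurable
    finally show ?thesis ..
  qed
  have int_X: "(\<integral>\<^sup>+\<omega>. f (X \<omega>) \<partial>P) = (\<integral>\<^sup>+x. f x \<partial>mu.S)" if [measurable]: "f \<in> borel_measurable mu.S" for f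
  proof -
    have "(\<integral>\<^sup>+x. f x \<partial>mu.S) = (\<integral>\<^sup>+x. f x \<partial>distr P mu.S X)" by (simp only: X_law)
    also have "\<dots> = (\<integral>\<^sup>+\<omega>. f (X \<omega>) \<partial>P)" by (rule nn_integral_distr) measurable
    finally show ?thesis ..
  qed
  have prods_X: "Pi_prod Mseq n \<omega> = mu.prods n (X \<omega>)" for n \<omega>
    by (induction n) (simp_all add: Pi_prod_def mu.prods_def X_def)
  have Z_X: "Z_sum Mseq Qseq n \<omega> = mu.Zsum n (X \<omega>)" for n \<omega>
    by (induction n) (simp_all add: Z_sum_def mu.Zsum_def prods_X, simp add: X_def)
  have Zinf_X: "Z_inf Mseq Qseq \<omega> = mu.Zlim (X \<omega>)" for \<omega>
    by (simp add: Z_inf_def mu.Zlim_def Z_X)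
  have conv_X: "Z_converges P Mseq Qseq \<longleftrightarrow> (AE x in mu.S. convergent (\<lambda>n. mu.Zsum n x))"
    unfolding Z_converges_def Z_X
  proof (rule AE_X)
    show "Measurable.pred mu.S (\<lambda>x. convergent (\<lambda>n. mu.Zsum n x))"
      unfolding Cauchy_convergent_iff[symmetric] pred_def by (rule sets_Collect_Cauchy) measurable
  qed
  have AE_mu: "(AE p in \<mu>. R p) \<longleftrightarrow> (AE \<omega> in P. R (M \<omega>, Q \<omega>))"
    if [measurable]: "Measurable.pred (borel \<Otimes>\<^sub>M borel) R" for R
    unfolding \<mu>_def by (rule AE_distr_iff[OF MQ]) measurable
  have M_nz: "AE p in \<mu>. fst p \<noteq> 0"
    using M_nonzero by (subst AE_mu) (simp_all add: P.prob_eq_0)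
  have Q_nz: "\<not> (AE p in \<mu>. snd p = 0)"
  proof
    assume "AE p in \<mu>. snd p = 0"
    then have "AE \<omega> in P. Q \<omega> = 0" by (subst (asm) AE_mu) simp_all
    then have "P.prob {\<omega> \<in> space P. Q \<omega> = 0} = 1" by (subst P.prob_Collect_eq_1) simp_all
    then show False using Q_nonzero by simp
  qed
  show ?thesis
  \<comment> \<open>If the multipliers have modulus at least 1 almost surely, both implications hold
    because their premises fail. Otherwise \<open>A\<close> is positive, as the Lyapunov function
    requires.\<close>
  proof (cases "AE p in \<mu>. \<bar>fst p\<bar> \<ge> 1")
    case True
    have "\<not> (AE \<omega> in P. (\<lambda>n. Pi_prod Mseq n \<omega>) \<longlonglongrightarrow> 0)"
      unfolding prods_X using mu.not_tendsto_zero_if_expanding[OF True] by (subst AE_X) simp_all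
    moreover have "\<not> Z_converges P Mseq Qseq"
      unfolding conv_X using mu.expanding_convergent_imp_zero[OF True] Q_nz by blast
    ultimately show ?thesis by blast
  next
    case False
    obtain g k N y0 C t0 where g: "\<And>y. y \<ge> 0 \<Longrightarrow> g y > (0 :: real)"
      "\<And>u v. 0 \<le> u \<Longrightarrow> u \<le> v \<Longrightarrow> g u \<le> g v"
      "\<And>u v. 0 \<le> u \<Longrightarrow> u \<le> v \<Longrightarrow> g v \<le> ((1 + v) / (1 + u)) ^ k * g u"
      "N > (1 :: real)" "\<And>y. y \<ge> y0 \<Longrightarrow> 2 * g (y / N) \<le> g y"
      and C: "C > 0" "\<And>y. y \<ge> 0 \<Longrightarrow> b y \<le> C * g y" "\<And>y. y \<ge> t0 \<Longrightarrow> g y \<le> C * b y"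
      using regularly_varying_comparison[OF b_nonneg b_meas b_bdd b_rv alpha_pos] by blast
    interpret perpetuity \<mu> g k N y0
      by unfold_locales (use g mu.trunc_mean_pos[OF M_nz False] mu.trunc_mean_mono mu.trunc_mean_scale M_nz
        mu.sets_pair in auto)
    \<comment> \<open>Positivity of \<open>p0\<close> makes the value of J at 0 finite, so that J is
      represented by the real function \<open>jr\<close>.\<close>
    define p0 where "p0 = measure P {\<omega> \<in> space P. \<bar>M \<omega>\<bar> < 1}"
    have "p0 \<noteq> 0"
    proof
      assume "p0 = 0"
      then have "AE \<omega> in P. \<not> \<bar>M \<omega>\<bar> < 1" by (simp add: p0_def P.prob_eq_0)
      then have "AE p in \<mu>. \<bar>fst p\<bar> \<ge> 1" by (subst AE_mu) (simp_all add: not_less)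
      then show False using False by simp
    qed
    then have p0: "p0 > 0" by (simp add: p0_def zero_less_measure_iff)
    define jr where "jr x = (if x = 0 then 1 / p0 else x / A x)" for x
    have J: "J_fun P M x = ennreal (jr x)" if "x \<ge> 0" for x
    proof (cases "x = 0")
      case True
      have "J_fun P M x = ennreal 1 / ennreal p0"
        using True by (simp add: J_fun_def p0_def P.emeasure_eq_measure)
      also have "\<dots> = ennreal (1 / p0)" using p0 by (intro divide_ennreal) auto
      finally show ?thesis using True by (simp add: jr_def)
    next
      case False
      have "A_fun P M x = ennreal (A x)"
        unfolding \<mu>_def by (rule A_fun_eq_trunc_mean[OF assms(1) rv_generic that])
      then show ?thesis
        using False that A_pos[of x] by (simp add: J_fun_def jr_def divide_ennreal)
    qed
    obtain K where K: "K > 0"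
      "\<And>t. F (log1p t) \<le> K * (b (log_plus \<bar>t\<bar>) * jr (log_plus \<bar>t\<bar>) + 1)"
      "\<And>t. b (log_plus \<bar>t\<bar>) * jr (log_plus \<bar>t\<bar>) \<le> K * (F (log1p t) + 1)"
      "\<And>t. g (log1p t) \<le> K * (b (log_plus \<bar>t\<bar>) + 1)"
      "\<And>t. b (log_plus \<bar>t\<bar>) \<le> K * g (log1p t)"
      by (rule moment_comparison[of b C t0 "1 / p0" jr]) (use b_nonneg C p0 in \<open>auto simp: jr_def\<close>)
    have jr_nonneg: "jr x \<ge> 0" if "x \<ge> 0" for x
      using that p0 A_pos[of x] by (auto simp: jr_def less_imp_le)
    have [measurable]: "jr \<in> borel_measurable borel" unfolding jr_def by measurable
    have b_lp [measurable]: "(\<lambda>\<omega>. b (log_plus (f \<omega>))) \<in> borel_measurable P'"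
      if [measurable]: "f \<in> borel_measurable P'" for f and P' :: "'c measure"
      by (rule measurable_compose[OF _ b_meas], rule measurable_restrict_space2) auto
    have F_log1p: "(\<lambda>\<omega>. F (log1p (f \<omega>))) \<in> borel_measurable P'" if [measurable]: "f \<in> borel_measurable P'"
      for f and P' :: "'c measure" by (rule measurable_F) auto
    have bJ: "(\<integral>\<^sup>+\<omega>. ennreal (b (log_plus \<bar>T \<omega>\<bar>)) * J_fun P M (log_plus \<bar>T \<omega>\<bar>) \<partial>P) =
        (\<integral>\<^sup>+\<omega>. ennreal (b (log_plus \<bar>T \<omega>\<bar>) * jr (log_plus \<bar>T \<omega>\<bar>)) \<partial>P)" for T
      using b_nonneg jr_nonneg by (intro nn_integral_cong) (simp add: J ennreal_mult)
    \<comment> \<open>Both moment conditions use the J of \<open>M\<close>, so this equivalence,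
      with \<open>M\<close> or \<open>Q\<close> for \<open>T\<close>, serves the premises of (i) and
      the conclusions of (ii).\<close>
    have equiv: "(\<integral>\<^sup>+\<omega>. ennreal (b (log_plus \<bar>T \<omega>\<bar>)) * J_fun P M (log_plus \<bar>T \<omega>\<bar>) \<partial>P) < \<infinity> \<longleftrightarrow>
        integrable P (\<lambda>\<omega>. F (log1p (T \<omega>)))" if [measurable]: "T \<in> borel_measurable P" for T
    proof
      assume fin: "(\<integral>\<^sup>+\<omega>. ennreal (b (log_plus \<bar>T \<omega>\<bar>)) * J_fun P M (log_plus \<bar>T \<omega>\<bar>) \<partial>P) < \<infinity>"
      have "(\<integral>\<^sup>+\<omega>. ennreal (F (log1p (T \<omega>))) \<partial>P) \<le>
          (\<integral>\<^sup>+\<omega>. ennreal (K * (b (log_plus \<bar>T \<omega>\<bar>) * jr (log_plus \<bar>T \<omega>\<bar>) + 1)) \<partial>P)"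
        by (intro nn_integral_mono ennreal_leI K)
      also have "\<dots> < \<infinity>"
        using fin K(1) b_nonneg jr_nonneg unfolding bJ
        by (intro nn_integral_affine_finite P.finite_measure_axioms) auto
      finally show "integrable P (\<lambda>\<omega>. F (log1p (T \<omega>)))"
        using F_pos by (intro integrableI_nonneg F_log1p) (auto simp: less_imp_le)
    next
      assume int: "integrable P (\<lambda>\<omega>. F (log1p (T \<omega>)))"
      have "(\<integral>\<^sup>+\<omega>. ennreal (F (log1p (T \<omega>))) \<partial>P) < \<infinity>"
        using int F_pos by (subst nn_integral_eq_integral) (auto simp: less_imp_le)
      then have "(\<integral>\<^sup>+\<omega>. ennreal (K * (F (log1p (T \<omega>)) + 1)) \<partial>P) < \<infinity>"
        using K(1) F_pos by (intro nn_integral_affine_finite P.finite_measure_axioms F_log1p) (auto simp: less_imp_le)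
      moreover have "(\<integral>\<^sup>+\<omega>. ennreal (b (log_plus \<bar>T \<omega>\<bar>)) * J_fun P M (log_plus \<bar>T \<omega>\<bar>) \<partial>P) \<le>
          (\<integral>\<^sup>+\<omega>. ennreal (K * (F (log1p (T \<omega>)) + 1)) \<partial>P)"
        unfolding bJ by (intro nn_integral_mono ennreal_leI K)
      ultimately show "(\<integral>\<^sup>+\<omega>. ennreal (b (log_plus \<bar>T \<omega>\<bar>)) * J_fun P M (log_plus \<bar>T \<omega>\<bar>) \<partial>P) < \<infinity>"
        by (rule le_less_trans[rotated])
    qed
    have F_mu: "integrable \<mu> (\<lambda>p. F (log1p (f p))) \<longleftrightarrow> integrable P (\<lambda>\<omega>. F (log1p (f (M \<omega>, Q \<omega>))))"
      if "f \<in> borel_measurable (borel \<Otimes>\<^sub>M borel)" for f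
      using integrable_distr_eq[OF MQ F_log1p[OF that]] by (simp only: \<mu>_def[symmetric])
    have F_M: "integrable P (\<lambda>\<omega>. F (log1p (M \<omega>))) \<longleftrightarrow> integrable \<mu> (\<lambda>p. F (log1p (fst p)))"
      and F_Q: "integrable P (\<lambda>\<omega>. F (log1p (Q \<omega>))) \<longleftrightarrow> integrable \<mu> (\<lambda>p. F (log1p (snd p)))"
      using F_mu[of fst] F_mu[of snd] by simp_all
    have g_Z [measurable]: "(\<lambda>x. g (log1p (mu.Zlim x))) \<in> borel_measurable mu.S" by (rule measurable_g_log1p) measurable
    show ?thesis
      unfolding equiv[OF rv_generic(1)] equiv[OF rv_generic(2)] F_M F_Q
    proof (intro conjI impI; elim conjE)
      assume lim: "AE \<omega> in P. (\<lambda>n. Pi_prod Mseq n \<omega>) \<longlonglongrightarrow> 0"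
        and FM: "integrable \<mu> (\<lambda>p. F (log1p (fst p)))" and FQ: "integrable \<mu> (\<lambda>p. F (log1p (snd p)))"
      have lim': "AE x in mu.S. (\<lambda>n. mu.prods n x) \<longlonglongrightarrow> 0"
        using lim unfolding prods_X by (subst (asm) AE_X) simp_all
      show "Z_converges P Mseq Qseq"
        unfolding conv_X by (rule perpetuity_moment(1)[OF FM FQ lim'])
      have "(\<integral>\<^sup>+x. ennreal (g (log1p (mu.Zlim x))) \<partial>mu.S) < \<infinity>"
        unfolding mu.Zlim_def by (rule perpetuity_moment(2)[OF FM FQ lim'])
      then have "(\<integral>\<^sup>+x. ennreal K * ennreal (g (log1p (mu.Zlim x))) \<partial>mu.S) < \<infinity>"
        by (subst nn_integral_cmult) (auto simp: ennreal_mult_less_top)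
      moreover have "(\<integral>\<^sup>+\<omega>. ennreal (b (log_plus \<bar>Z_inf Mseq Qseq \<omega>\<bar>)) \<partial>P) \<le>
          (\<integral>\<^sup>+\<omega>. ennreal K * ennreal (g (log1p (mu.Zlim (X \<omega>)))) \<partial>P)"
        unfolding Zinf_X using K(1) K(5) g(1) by (intro nn_integral_mono) (simp add: less_imp_le ennreal_leI flip: ennreal_mult)
      moreover have "(\<integral>\<^sup>+\<omega>. ennreal K * ennreal (g (log1p (mu.Zlim (X \<omega>)))) \<partial>P) =
          (\<integral>\<^sup>+x. ennreal K * ennreal (g (log1p (mu.Zlim x))) \<partial>mu.S)"
        by (rule int_X) measurable
      ultimately show "(\<integral>\<^sup>+\<omega>. ennreal (b (log_plus \<bar>Z_inf Mseq Qseq \<omega>\<bar>)) \<partial>P) < \<infinity>" by simp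
    next
      assume conv: "Z_converges P Mseq Qseq" and nondeg: "\<not> (\<exists>c. AE \<omega> in P. Z_inf Mseq Qseq \<omega> = c)"
        and fin: "(\<integral>\<^sup>+\<omega>. ennreal (b (log_plus \<bar>Z_inf Mseq Qseq \<omega>\<bar>)) \<partial>P) < \<infinity>"
      define \<nu> where "\<nu> = distr mu.S borel mu.Zlim"
      have nu: "prob_space \<nu>" unfolding \<nu>_def by (rule mu.seq.P.prob_space_distr) measurable
      have inv: "distr (\<mu> \<Otimes>\<^sub>M \<nu>) borel (\<lambda>w. snd (fst w) + fst (fst w) * snd w) = \<nu>"
        unfolding \<nu>_def using conv by (intro mu.Zlim_law_invariant) (simp add: conv_X)
      have "(AE z in \<nu>. z = c) \<longleftrightarrow> (AE \<omega> in P. Z_inf Mseq Qseq \<omega> = c)" for c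
      proof -
        have "(AE z in \<nu>. z = c) \<longleftrightarrow> (AE x in mu.S. mu.Zlim x = c)"
          unfolding \<nu>_def by (rule AE_distr_iff) measurable
        also have "\<dots> \<longleftrightarrow> (AE \<omega> in P. Z_inf Mseq Qseq \<omega> = c)"
          unfolding Zinf_X by (rule AE_X[symmetric]) measurable
        finally show ?thesis .
      qed
      then have nondeg': "\<not> (\<exists>c. AE z in \<nu>. z = c)" using nondeg by simp
      have [measurable]: "(\<lambda>\<omega>. Z_inf Mseq Qseq \<omega>) \<in> borel_measurable P"
        unfolding Zinf_X by measurable
      have "(\<integral>\<^sup>+z. ennreal (g (log1p z)) \<partial>\<nu>) = (\<integral>\<^sup>+x. ennreal (g (log1p (mu.Zlim x))) \<partial>mu.S)"
        unfolding \<nu>_def by (rule nn_integral_distr) (auto intro!: measurable_g_log1p measurable_compose[OF _ measurable_ennreal])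
      also have "\<dots> = (\<integral>\<^sup>+\<omega>. ennreal (g (log1p (mu.Zlim (X \<omega>)))) \<partial>P)"
        by (rule int_X[symmetric]) measurable
      also have "\<dots> \<le> (\<integral>\<^sup>+\<omega>. ennreal (K * (b (log_plus \<bar>Z_inf Mseq Qseq \<omega>\<bar>) + 1)) \<partial>P)"
        unfolding Zinf_X by (intro nn_integral_mono ennreal_leI K)
      also have "\<dots> < \<infinity>"
        using fin K(1) b_nonneg by (intro nn_integral_affine_finite P.finite_measure_axioms) auto
      finally have moment: "(\<integral>\<^sup>+z. ennreal (g (log1p z)) \<partial>\<nu>) < \<infinity>" .
      have sets_nu: "sets \<nu> = sets borel" by (simp add: \<nu>_def)
      show "integrable \<mu> (\<lambda>p. F (log1p (fst p)))" "integrable \<mu> (\<lambda>p. F (log1p (snd p)))"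
        by (rule invariant_law_moment[OF nu sets_nu inv nondeg' moment])+
    qed
  qed
qed

end
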